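(* Let $\nu = e^{-f}$ be a probability density on $\mathbb{R}^n$ that satisfies the log-Sobolev inequality with constant $\alpha>0$ and is $(L,M)$-smooth. Let $0 < \epsilon \le \min\{ \frac{1}{8L}, \frac{1}{M}, \frac{3\alpha}{32 L^2} \}$. For any initial distribution $x_0 \sim \rho_0$, the iterates $x_k \sim \rho_k$ of the Proximal Langevin Algorithm with step size $\epsilon$ satisfy, for all $k \ge 0$, \[ H_\nu(\rho_k) \le e^{-\alpha \epsilon k} H_\nu(\rho_0) + \frac{34\, \epsilon^2 n(L^3 + 9n^2 M^2)}{\alpha}. \]
   Context: Proximal Langevin Algorithm (PLA) with step size $\epsilon>0$ for $\nu=e^{-f}$: starting from a random $x_0\in\mathbb{R}^n$, set $x_{k+1} = x_k - \epsilon \nabla f(x_{k+1}) + \sqrt{2\epsilon}\, z_k$, where $z_k \sim \mathcal{N}(0,I)$ are independent of each other and of $x_0,\dots,x_k$; equivalently $x_{k+1} = \arg\min_{x} \{ f(x) + \frac{1}{2\epsilon}\|x - (x_k + \sqrt{2\epsilon} z_k)\|^2\}$ (well defined when $\epsilon\|\nabla^2 f\|<1$). $\rho_k$ denotes the law of $x_k$. Densities are assumed smooth with finite second moments. KL divergence: $H_\nu(\rho) = \int \rho \log\frac{\rho}{\nu}\,dx$. Relative Fisher information: $J_\nu(\rho) = \int \rho \|\nabla \log \frac{\rho}{\nu}\|^2 dx$. $\nu$ satisfies the log-Sobolev inequality (LSI) with constant $\alpha>0$ if $H_\nu(\rho) \le \frac{1}{2\alpha} J_\nu(\rho)$ for all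 $\rho$. $\nu=e^{-f}$ is $(L,M)$-smooth if $f$ is three times differentiable, $\|\nabla^2 f(x)\|_{\mathrm{op}} \le L$ for all $x$ (i.e. $-LI\preceq \nabla^2 f\preceq LI$), and $\|\nabla^2 f(x) - \nabla^2 f(y)\|_{\mathrm{op}} \le M\|x-y\|$ for all $x,y$. *)

theory Defs
  imports "HOL-Probability.Probability"
begin

definition grad :: "('a::euclidean_space \<Rightarrow> real) \<Rightarrow> 'a \<Rightarrow> 'a" where
  "grad F x = (SOME g. (F has_derivative (\<lambda>h. g \<bullet> h)) (at x))"

definition hess :: "(real^'n \<Rightarrow> real) \<Rightarrow> real^'n \<Rightarrow> real^'n^'n" where
  "hess F x = (SOME H. (grad F has_derivative (\<lambda>h. H *v h)) (at x))"

definition LM_smooth :: "(real^'n \<Rightarrow> real) \<Rightarrow> real \<Rightarrow> real \<Rightarrow> bool" where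
  "LM_smooth f L M \<longleftrightarrow>
     (\<forall>x. (f has_derivative (\<lambda>h. grad f x \<bullet> h)) (at x)) \<and>
     (\<forall>x. (grad f has_derivative (\<lambda>h. hess f x *v h)) (at x)) \<and>
     (\<forall>x. hess f differentiable (at x)) \<and>
     (\<forall>x. onorm (\<lambda>h. hess f x *v h) \<le> L) \<and>
     (\<forall>x y. onorm (\<lambda>h. (hess f x - hess f y) *v h) \<le> M * dist x y)"

text \<open>Admissible densities (standing assumption: smooth, here C^1, with finite second moment).\<close>

definition admissible_density :: "('a::euclidean_space \<Rightarrow> real) \<Rightarrow> bool" where
  "admissible_density \<rho> \<longleftrightarrow>
     (\<forall>x. 0 \<le> \<rho> x) \<and> \<rho> \<in> borel_measurable borel \<and>
     (\<integral>\<^sup>+x. ennreal (\<rho> x) \<partial>lborel) = 1 \<and>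
     (\<forall>x. \<rho> differentiable (at x)) \<and> continuous_on UNIV (grad \<rho>) \<and>
     (\<integral>\<^sup>+x. ennreal (\<rho> x * (norm x)\<^sup>2) \<partial>lborel) < \<infinity>"

text \<open>KL divergence H_nu(rho) = int rho log(rho/nu) of a density, as an extended real:
  integral of the positive part minus integral of the negative part.\<close>

definition KL_dens :: "('a::euclidean_space \<Rightarrow> real) \<Rightarrow> ('a \<Rightarrow> real) \<Rightarrow> ereal" where
  "KL_dens \<nu> \<rho> =
     enn2ereal (\<integral>\<^sup>+x. ennreal (\<rho> x * ln (\<rho> x / \<nu> x)) \<partial>lborel)
     - enn2ereal (\<integral>\<^sup>+x. ennreal (- (\<rho> x * ln (\<rho> x / \<nu> x))) \<partial>lborel)"

definition KL :: "('a::euclidean_space \<Rightarrow> real) \<Rightarrow> 'a measure \<Rightarrow> ereal" where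
  "KL \<nu> \<mu> = (if sets \<mu> = sets borel \<and> absolutely_continuous lborel \<mu>
              then KL_dens \<nu> (\<lambda>x. enn2real (RN_deriv lborel \<mu> x)) else \<infinity>)"

definition Fisher :: "('a::euclidean_space \<Rightarrow> real) \<Rightarrow> ('a \<Rightarrow> real) \<Rightarrow> ennreal" where
  "Fisher \<nu> \<rho> = (\<integral>\<^sup>+x. ennreal (if \<rho> x > 0
        then \<rho> x * (norm (grad (\<lambda>y. ln (\<rho> y / \<nu> y)) x))\<^sup>2 else 0) \<partial>lborel)"

definition LSI :: "('a::euclidean_space \<Rightarrow> real) \<Rightarrow> real \<Rightarrow> bool" where
  "LSI \<nu> \<alpha> \<longleftrightarrow> (\<forall>\<rho>. admissible_density \<rho> \<longrightarrow>
       KL_dens \<nu> \<rho> \<le> ereal (1 / (2 * \<alpha>)) * enn2ereal (Fisher \<nu> \<rho>))"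

definition std_gauss :: "(real^'n) measure" where
  "std_gauss = density lborel (\<lambda>z. ennreal ((2 * pi) powr (- real CARD('n) / 2)
                                              * exp (- (norm z)\<^sup>2 / 2)))"

definition prox :: "real \<Rightarrow> (real^'n \<Rightarrow> real) \<Rightarrow> real^'n \<Rightarrow> real^'n" where
  "prox \<epsilon> f y = (SOME x. \<forall>x'. f x + (norm (x - y))\<^sup>2 / (2 * \<epsilon>)
                              \<le> f x' + (norm (x' - y))\<^sup>2 / (2 * \<epsilon>))"

text \<open>Law rho_k of the k-th PLA iterate: x_{k+1} = prox(x_k + sqrt(2 eps) z_k),
  z_k ~ N(0,I) independent of x_k.\<close>

primrec PLA_law :: "real \<Rightarrow> (real^'n \<Rightarrow> real) \<Rightarrow> (real^'n) measure \<Rightarrow> nat \<Rightarrow> (real^'n) measure" where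
  "PLA_law \<epsilon> f \<mu>0 0 = \<mu>0"
| "PLA_law \<epsilon> f \<mu>0 (Suc k) =
     distr (PLA_law \<epsilon> f \<mu>0 k \<Otimes>\<^sub>M std_gauss) borel
           (\<lambda>(x, z). prox \<epsilon> f (x + sqrt (2 * \<epsilon>) *\<^sub>R z))"

end

theory Submission
  imports Defs
begin

text \<open>
  One step of the algorithm from \<open>x\<^sub>0\<close> is interpolated by \<open>x\<^sub>t = X\<^sub>t(x\<^sub>0 + \<surd>(2t) z)\<close>, where \<open>X\<^sub>t\<close> is the inverse of
  \<open>T\<^sub>t = id + t\<nabla>f\<close>, so the law of \<open>x\<^sub>t\<close> has the explicit density \<open>\<rho>\<^sub>t = (p\<^sub>t \<circ> T\<^sub>t) \<cdot> det(I + t\<nabla>\<^sup>2f)\<close> with \<open>p\<^sub>t\<close> the heat flow of the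
  initial density. Put \<open>H(t) = H\<^sub>\<nu>(\<rho>\<^sub>t)\<close> and \<open>\<Psi>\<^sub>s = ln(\<rho>\<^sub>s/\<nu>)\<close>. Convexity of the entropy gives
  \<open>H(s) - H(t) \<le> E \<Psi>\<^sub>s(x\<^sub>s) - E \<Psi>\<^sub>s(x\<^sub>t)\<close>, and differentiating \<open>r \<mapsto> E \<Psi>\<^sub>s(x\<^sub>r)\<close> along the random curve (no stochastic
  calculus, no Laplacian) bounds the right-hand side by \<open>(s - t) \<Phi>(s, r)\<close> for some \<open>r\<close> between \<open>t\<close> and \<open>s\<close>, with \<open>\<Phi>\<close> continuous and
  \<open>\<Phi>(s, s) \<le> - J\<^sub>\<nu>(\<rho>\<^sub>s)/2 + s\<^sup>2 (6 n L\<^sup>3 + 4 n\<^sup>2 M\<^sup>2)\<close>. The log-Sobolev inequality turns this into an implicit Euler inequality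
  for \<open>H\<close>, whence \<open>H(\<epsilon>) \<le> e\<^sup>-\<^sup>\<alpha>\<^sup>\<epsilon> H(0) + (1 - e\<^sup>-\<^sup>\<alpha>\<^sup>\<epsilon>) b\<close> with a bias \<open>b\<close> of order \<open>\<epsilon>\<^sup>2/\<alpha>\<close>; this form iterates without loss.
  All of this is done for initial densities with bounded support, where \<open>\<rho>\<^sub>t\<close> is dominated by Gaussians; the general case follows by
  truncation and Fatou's lemma.
\<close>

section \<open>Change of variables over an arbitrary finite index type\<close>

text \<open>The obstacle is regularity. The Hessian is merely differentiable, so the gradient of the
  log-determinant in \<open>\<Psi>\<close> exists everywhere but may be discontinuous in space, and
  second derivatives of \<open>\<Psi>\<close> are out of reach. Freezing the observable
  \<open>\<Psi>\<close> at one time and moving only the law leaves an expectation whose time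
  derivative involves the first gradient of \<open>\<Psi>\<close> alone. Its velocity still contains
  the noise \<open>z\<close>; conditioning on \<open>x0 + sqrt (2 t) z\<close> turns that noise into
  the score of the heat flow. Freezing at the later time \<open>s\<close> is what makes the scheme
  implicit: the dissipation, and with it the log-Sobolev inequality, appears at the same time as
  \<open>H(s)\<close>. The score blows up as \<open>t\<close> tends to 0, so estimates are made on
  \<open>[a, b]\<close> with \<open>a > 0\<close>, and the passage to the initial entropy is a
  separate limit. The constants come from \<open>s L <= 1/8\<close>: the Jacobian
  \<open>I + s hess f\<close> has norm at most \<open>9/8\<close> and its inverse at most
  \<open>8/7\<close>.\<close>

text \<open>The change of variables theorem of the library requires the index type to be well-ordered. The copy \<open>ix\<close> of a
  finite type carries such an order, and \<open>jac\<close> is the determinant computed after passing to that copy.\<close>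

typedef 'a ix = "UNIV :: 'a set" morphisms of_ix to_ix by simp

instance ix :: (finite) finite
proof
  have "(UNIV :: 'a ix set) = to_ix ` UNIV"
    by (metis of_ix_inverse surjI)
  then show "finite (UNIV :: 'a ix set)"
    by (metis finite_code finite_imageI)
qed

instantiation ix :: (finite) wellorder
begin
definition less_eq_ix :: "'a ix \<Rightarrow> 'a ix \<Rightarrow> bool" where
  "less_eq_ix i j \<longleftrightarrow> to_nat (of_ix i) \<le> to_nat (of_ix j)"
definition less_ix :: "'a ix \<Rightarrow> 'a ix \<Rightarrow> bool" where
  "less_ix i j \<longleftrightarrow> to_nat (of_ix i) < to_nat (of_ix j)"
instance
proof
  fix P :: "'a ix \<Rightarrow> bool" and a
  assume *: "\<And>x. (\<And>y. y < x \<Longrightarrow> P y) \<Longrightarrow> P x"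
  show "P a"
    by (induction a rule: measure_induct_rule[of "\<lambda>i. to_nat (of_ix i)"])
       (use * in \<open>auto simp: less_ix_def\<close>)
qed (auto simp: less_eq_ix_def less_ix_def of_ix_inject)
end

lemma sum_of_ix: "(\<Sum>i\<in>UNIV. g (of_ix i)) = (\<Sum>j\<in>UNIV. g j)" for g :: "'n::finite \<Rightarrow> 'b::comm_monoid_add"
  by (rule sum.reindex_bij_witness[of _ to_ix of_ix]) (auto simp: to_ix_inverse of_ix_inverse)

definition reindex :: "real^'n \<Rightarrow> real^('n ix)" where "reindex v = (\<chi> i. v $ of_ix i)"
definition unreindex :: "real^('n ix) \<Rightarrow> real^'n" where "unreindex w = (\<chi> i. w $ to_ix i)"
definition reindex_mat :: "real^'n^'n \<Rightarrow> real^('n ix)^('n ix)" where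
  "reindex_mat B = (\<chi> i j. B $ of_ix i $ of_ix j)"
definition jac :: "real^'n^'n \<Rightarrow> real" where "jac B = det (reindex_mat B)"

lemma reindex_unreindex[simp]: "reindex (unreindex w) = w" and unreindex_reindex[simp]: "unreindex (reindex v) = v"
  by (simp_all add: reindex_def unreindex_def of_ix_inverse to_ix_inverse vec_eq_iff)

lemma linear_reindex: "linear reindex" and linear_unreindex: "linear unreindex"
  by (auto intro!: linearI simp: reindex_def unreindex_def vec_eq_iff)

lemma norm_reindex[simp]: "norm (reindex v) = norm v"
  unfolding norm_vec_def L2_set_def reindex_def
  using sum_of_ix[of "\<lambda>i. (norm (v $ i))\<^sup>2"] by simp

lemma norm_unreindex[simp]: "norm (unreindex w) = norm w"
  by (metis norm_reindex reindex_unreindex)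

lemma reindex_mat_vec: "reindex_mat B *v w = reindex (B *v unreindex w)"
  unfolding reindex_mat_def reindex_def unreindex_def matrix_vector_mult_def vec_eq_iff
  using sum_of_ix[of "\<lambda>j. B $ k $ j * w $ to_ix j" for k] by (simp add: of_ix_inverse)

lemma reindex_mat_mult: "reindex_mat (B ** C) = reindex_mat B ** reindex_mat C"
  unfolding reindex_mat_def matrix_matrix_mult_def vec_eq_iff
  using sum_of_ix[of "\<lambda>k. B $ i $ k * C $ k $ j" for i j] by simp

lemma reindex_mat_one: "reindex_mat (mat 1) = mat 1"
  by (simp add: reindex_mat_def mat_def vec_eq_iff of_ix_inject)

lemma jac_mult: "jac (B ** C) = jac B * jac C"
  by (simp add: jac_def reindex_mat_mult det_mul)

lemma jac_one[simp]: "jac (mat 1) = 1"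
  by (simp add: jac_def reindex_mat_one)

lemma CARD_ix[simp]: "CARD('a::finite ix) = CARD('a)"
  by (rule bij_betw_same_card[of of_ix])
     (rule bij_betw_byWitness[where f'=to_ix], auto simp: of_ix_inverse to_ix_inverse)

lemma measurable_reindex[measurable]: "reindex \<in> borel_measurable borel"
  and measurable_unreindex[measurable]: "unreindex \<in> borel_measurable borel"
  by (auto intro!: borel_measurable_continuous_onI linear_continuous_on
      simp: linear_reindex linear_unreindex linear_conv_bounded_linear[symmetric])

lemma prod_of_ix: "(\<Prod>i\<in>UNIV. g (of_ix i)) = (\<Prod>j\<in>UNIV. g j)" for g :: "'n::finite \<Rightarrow> 'b::comm_monoid_mult"
  by (rule prod.reindex_bij_witness[of _ to_ix of_ix]) (auto simp: to_ix_inverse of_ix_inverse)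

lemma prod_Basis_vec: "(\<Prod>b\<in>Basis. g (x \<bullet> b)) = (\<Prod>i\<in>UNIV. g (x $ i))" for x :: "real^'n"
proof -
  have "(\<Prod>b\<in>(\<lambda>i. axis i (1::real))`(UNIV::'n set). g (x \<bullet> b)) = (\<Prod>i\<in>UNIV. g (x $ i))"
    by (subst prod.reindex) (auto simp: inj_on_def axis_eq_axis inner_axis)
  moreover have "(Basis :: (real^'n) set) = (\<lambda>i. axis i (1::real))`(UNIV::'n set)"
    by (auto simp: Basis_vec_def)
  ultimately show ?thesis by simp
qed

lemma lborel_unreindex: "distr lborel borel (unreindex :: _ \<Rightarrow> real^'n) = lborel"
proof (rule lborel_eqI[symmetric])
  fix l u :: "real^'n" assume lu: "\<And>b. b \<in> Basis \<Longrightarrow> l \<bullet> b \<le> u \<bullet> b"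
  have le: "l $ i \<le> u $ i" for i using lu[of "axis i 1"] by (simp add: inner_axis)
  have "unreindex -` box l u = box (reindex l) (reindex u)"
    by (auto simp: mem_box_cart reindex_def unreindex_def) (metis of_ix_inverse to_ix_inverse UNIV_I)+
  moreover have "emeasure lborel (box (reindex l) (reindex u)) = (\<Prod>b\<in>Basis. (reindex u - reindex l) \<bullet> b)"
  proof (rule emeasure_lborel_box)
    fix b :: "real^'n ix" assume "b \<in> Basis"
    then obtain i where "b = axis i 1" by (auto simp: Basis_vec_def)
    then show "reindex l \<bullet> b \<le> reindex u \<bullet> b" using le by (simp add: inner_axis reindex_def)
  qed
  moreover have "(\<Prod>b\<in>Basis. (reindex u - reindex l) \<bullet> b) = (\<Prod>b\<in>Basis. (u - l) \<bullet> b)"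
    using prod_of_ix[of "\<lambda>i. (u - l) $ i"]
    by (simp only: prod_Basis_vec[of "\<lambda>x. x"]) (simp add: reindex_def)
  ultimately show "emeasure (distr lborel borel unreindex) (box l u) = (\<Prod>b\<in>Basis. (u - l) \<bullet> b)"
    by (simp add: emeasure_distr)
qed simp

text \<open>The image of the unit ball lies in the ball of radius \<open>c\<close>, and its volume
  is the determinant times that of the unit ball.\<close>

lemma jac_bound:
  fixes B :: "real^'n^'n"
  assumes "\<And>h. norm (B *v h) \<le> c * norm h" and "0 \<le> c"
  shows "\<bar>jac B\<bar> \<le> c ^ CARD('n)"
proof -
  let ?u = "measure lborel (ball (0::real^'n ix) 1)"
  have m: "(\<lambda>w. reindex_mat B *v w) ` ball 0 1 \<in> lmeasurable"
    and eq: "measure lebesgue ((\<lambda>w. reindex_mat B *v w) ` ball 0 1) = \<bar>det (matrix (\<lambda>w. reindex_mat B *v w))\<bar> * ?u"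
    by (auto intro!: measurable_linear_image simp: measure_linear_image)
  have "(\<lambda>w. reindex_mat B *v w) ` ball 0 1 \<subseteq> cball 0 c"
  proof clarsimp
    fix x :: "real^'n ix" assume "norm x < 1"
    have "norm (reindex_mat B *v x) \<le> c * norm x"
      using assms(1)[of "unreindex x"] by (simp add: reindex_mat_vec)
    also have "\<dots> \<le> c" using \<open>norm x < 1\<close> assms(2) by (intro mult_left_le) auto
    finally show "norm (reindex_mat B *v x) \<le> c" .
  qed
  then have "measure lebesgue ((\<lambda>w. reindex_mat B *v w) ` ball 0 1) \<le> measure lebesgue (cball (0::real^'n ix) c)"
    using m by (intro measure_mono_fmeasurable) auto
  also have "\<dots> = c ^ DIM(real^'n ix) * ?u"
    using assms(2) by (simp add: content_cball_conv_ball content_ball_conv_unit_ball[of c])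
  finally have "\<bar>det (reindex_mat B)\<bar> * ?u \<le> c ^ CARD('n) * ?u" by (simp add: eq)
  moreover have "?u > 0" by (rule content_ball_pos) simp
  ultimately show ?thesis by (simp add: jac_def)
qed

lemma has_derivative_borel_measurable:
  fixes T :: "'a::real_normed_vector \<Rightarrow> 'b::real_normed_vector"
  assumes "\<And>x. (T has_derivative T' x) (at x)"
  shows "T \<in> borel_measurable borel"
  by (intro borel_measurable_continuous_onI continuous_at_imp_continuous_on ballI)
     (rule has_derivative_continuous[OF assms])

lemma change_of_variables_wo:
  fixes T :: "real^'m::{finite,wellorder} \<Rightarrow> real^'m::_"
  assumes T: "\<And>x. (T has_derivative (\<lambda>h. B x *v h)) (at x)" and bij: "bij T"
    and p[measurable]: "p \<in> borel_measurable borel" and B[measurable]: "(\<lambda>x. det (B x)) \<in> borel_measurable borel"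
    and p0: "\<And>x. 0 \<le> p x" and fin: "integrable lborel p"
  shows "(\<integral>\<^sup>+x. ennreal (p (T x) * \<bar>det (B x)\<bar>) \<partial>lborel) = (\<integral>\<^sup>+x. ennreal (p x) \<partial>lborel)"
proof -
  have [measurable]: "T \<in> borel_measurable borel"
    using T by (rule has_derivative_borel_measurable)
  have "p absolutely_integrable_on UNIV"
    using fin unfolding set_integrable_def by (simp add: integrable_completion)
  \<comment> \<open>The change of variables is applied to a vector-valued integrand, hence the
    detour through \<open>real^1\<close> and \<open>vec\<close>.\<close>
  then have "(\<lambda>x. vec (p x) :: real^1) absolutely_integrable_on (T ` UNIV) \<and>
      integral (T ` UNIV) (\<lambda>x. vec (p x) :: real^1) = vec (integral (T ` UNIV) p)"
    using bij by (simp add: bij_is_surj absolutely_integrable_on_1_iff integral_on_1_eq)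
  then have *: "(\<lambda>x. \<bar>det (matrix ((*v) (B x)))\<bar> * p (T x)) absolutely_integrable_on UNIV \<and>
    integral UNIV (\<lambda>x. \<bar>det (matrix ((*v) (B x)))\<bar> * p (T x)) = integral (T ` UNIV) p"
    using has_absolute_integral_change_of_variables[of UNIV T "\<lambda>x. (*v) (B x)" "\<lambda>x. vec (p x) :: real^1"
        "vec (integral (T ` UNIV) p)"] T bij
    by (simp add: bij_is_inj absolutely_integrable_on_1_iff integral_on_1_eq vec_eq_iff)
  then have ai: "(\<lambda>x. p (T x) * \<bar>det (B x)\<bar>) absolutely_integrable_on UNIV"
    and eq: "integral UNIV (\<lambda>x. p (T x) * \<bar>det (B x)\<bar>) = integral UNIV p"
    using bij by (auto simp: mult.commute bij_is_surj)
  have i2: "integrable lborel (\<lambda>x. p (T x) * \<bar>det (B x)\<bar>)"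
    using ai unfolding set_integrable_def by (simp add: integrable_completion)
  have "(\<integral>\<^sup>+x. ennreal (p (T x) * \<bar>det (B x)\<bar>) \<partial>lborel) = ennreal (\<integral>x. p (T x) * \<bar>det (B x)\<bar> \<partial>lborel)"
    using i2 p0 by (intro nn_integral_eq_integral) auto
  also have "(\<integral>x. p (T x) * \<bar>det (B x)\<bar> \<partial>lborel) = (\<integral>x. p x \<partial>lborel)"
    using eq i2 fin by (simp add: integral_lborel)
  also have "ennreal \<dots> = (\<integral>\<^sup>+x. ennreal (p x) \<partial>lborel)"
    using fin p0 by (intro nn_integral_eq_integral[symmetric]) auto
  finally show ?thesis .
qed

lemma nn_integral_unreindex: "h \<in> borel_measurable borel \<Longrightarrow> (\<integral>\<^sup>+x. h (unreindex x) \<partial>lborel) = (\<integral>\<^sup>+x. h x \<partial>lborel)"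
  for h :: "real^'n \<Rightarrow> ennreal"
  using nn_integral_distr[of "unreindex :: _ \<Rightarrow> real^'n" lborel borel h] by (simp add: lborel_unreindex)

lemma change_of_variables:
  fixes T :: "real^'n \<Rightarrow> real^'n"
  assumes T: "\<And>x. (T has_derivative (\<lambda>h. B x *v h)) (at x)" and bij: "bij T"
    and p[measurable]: "p \<in> borel_measurable borel" and B[measurable]: "(\<lambda>x. jac (B x)) \<in> borel_measurable borel"
    and p0: "\<And>x. 0 \<le> p x" and fin: "integrable lborel p"
  shows "(\<integral>\<^sup>+x. ennreal (p (T x) * \<bar>jac (B x)\<bar>) \<partial>lborel) = (\<integral>\<^sup>+x. ennreal (p x) \<partial>lborel)"
proof -
  have Tm[measurable]: "T \<in> borel_measurable borel"
    using T by (rule has_derivative_borel_measurable)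
  have lin: "bounded_linear reindex" "bounded_linear unreindex" for x
    using linear_reindex linear_unreindex by (auto simp: linear_conv_bounded_linear)
  have "(\<integral>\<^sup>+x. ennreal (p (T x) * \<bar>jac (B x)\<bar>) \<partial>lborel) =
    (\<integral>\<^sup>+x. ennreal (p (unreindex (reindex (T (unreindex x)))) * \<bar>det (reindex_mat (B (unreindex x)))\<bar>) \<partial>lborel)"
    by (subst nn_integral_unreindex[symmetric]) (simp_all add: jac_def[symmetric])
  also have "\<dots> = (\<integral>\<^sup>+x. ennreal (p (unreindex x)) \<partial>lborel)"
  proof (rule change_of_variables_wo[where B="\<lambda>x. reindex_mat (B (unreindex x))" and p="\<lambda>x. p (unreindex x)" and T="\<lambda>x. reindex (T (unreindex x))"])
    fix x :: "real^'n ix"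
    have "((\<lambda>x. reindex (T (unreindex x))) has_derivative (\<lambda>h. reindex (B (unreindex x) *v unreindex h))) (at x)"
      by (rule bounded_linear.has_derivative[OF lin(1)
            has_derivative_compose[OF bounded_linear_imp_has_derivative[OF lin(2)] T]])
    then show "((\<lambda>x. reindex (T (unreindex x))) has_derivative (\<lambda>h. reindex_mat (B (unreindex x)) *v h)) (at x)"
      by (simp only: reindex_mat_vec)
  next
    have "bij reindex" "bij (unreindex :: _ \<Rightarrow> real^'n)"
      by (rule bij_betw_byWitness[where f'=unreindex], auto, rule bij_betw_byWitness[where f'=reindex], auto)
    then show "bij (\<lambda>x. reindex (T (unreindex x)))"
      using bij bij_comp[OF bij_comp[of unreindex T] , of reindex] by (auto simp: o_def)
  next
    show "integrable lborel (\<lambda>x. p (unreindex x))"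
      using fin integrable_distr_eq[of unreindex lborel borel p] by (simp add: lborel_unreindex)
  qed (use p0 in \<open>simp_all add: jac_def[symmetric]\<close>)
  also have "\<dots> = (\<integral>\<^sup>+x. ennreal (p x) \<partial>lborel)"
    by (rule nn_integral_unreindex) measurable
  finally show ?thesis .
qed

section \<open>Parameter integrals and Gaussian densities\<close>

text \<open>On the convex set \<open>U\<close> the mean value inequality bounds the remainder
  quotient by \<open>2 * g\<close>, so dominated convergence applies along every sequence.
  Continuity of \<open>F'\<close> in the parameter is not assumed, which matters because the
  gradient \<open>W s\<close> below may be discontinuous.\<close>

lemma has_derivative_integral_dominated:
  fixes F :: "'a::euclidean_space \<Rightarrow> 'w \<Rightarrow> real"
  assumes U: "open U" "convex U" "x0 \<in> U"
    and d: "AE w in M. \<forall>x\<in>U. ((\<lambda>x. F x w) has_derivative (\<lambda>h. F' x w \<bullet> h)) (at x) \<and> norm (F' x w) \<le> g w"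
    and g: "integrable M g" and i: "\<And>x. x \<in> U \<Longrightarrow> integrable M (F x)"
    and m[measurable]: "F' x0 \<in> borel_measurable M"
  shows "((\<lambda>x. \<integral>w. F x w \<partial>M) has_derivative (\<lambda>h. (\<integral>w. F' x0 w \<partial>M) \<bullet> h)) (at x0)"
  unfolding has_derivative_iff_norm tendsto_at_iff_sequentially
proof (intro conjI allI impI)
  show "bounded_linear ((\<bullet>) (\<integral>w. F' x0 w \<partial>M))" by (rule bounded_linear_inner_right)
next
  fix X :: "nat \<Rightarrow> 'a" assume X: "\<forall>i. X i \<in> UNIV - {x0}" and lim: "X \<longlonglongrightarrow> x0"
  have "eventually (\<lambda>i. X i \<in> U) sequentially"
    using lim U(1,3) by (rule topological_tendstoD)
  then obtain N where N: "\<And>i. i \<ge> N \<Longrightarrow> X i \<in> U" by (auto simp: eventually_sequentially)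
  \<comment> \<open>The remainder quotient along the sequence, shifted by \<open>N\<close> so that
    all points lie in \<open>U\<close>.\<close>
  define Q where "Q i w = \<bar>F (X (i + N)) w - F x0 w - F' x0 w \<bullet> (X (i + N) - x0)\<bar> / norm (X (i + N) - x0)" for i w
  have iF': "integrable M (F' x0)"
    by (rule Bochner_Integration.integrable_bound[OF g]) (use d U(3) in \<open>auto elim!: eventually_mono intro: order_trans[OF _ abs_ge_self]\<close>)
  have iF[simp]: "integrable M (F (X (i + N)))" "integrable M (F x0)" for i using i N U by auto
  have ii[simp]: "integrable M (\<lambda>w. F' x0 w \<bullet> v)" for v using iF' by simp
  have lipd: "AE w in M. \<forall>i. \<bar>F (X (i + N)) w - F x0 w\<bar> \<le> g w * norm (X (i + N) - x0)"
    using d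
  proof eventually_elim
    case (elim w)
    show ?case
    proof
      fix i
      have "norm (F (X (i + N)) w - F x0 w) \<le> g w * norm (X (i + N) - x0)"
      proof (rule differentiable_bound[OF U(2)])
        show "((\<lambda>x. F x w) has_derivative (\<lambda>h. F' x w \<bullet> h)) (at x within U)" if "x \<in> U" for x
          using elim that by (blast intro: has_derivative_at_withinI)
        show "onorm ((\<bullet>) (F' x w)) \<le> g w" if "x \<in> U" for x
        proof (rule onorm_bound)
          show "0 \<le> g w" using elim U(3) norm_ge_zero order_trans by blast
          show "norm (F' x w \<bullet> h) \<le> g w * norm h" for h
            using elim that Cauchy_Schwarz_ineq2[of "F' x w" h] mult_right_mono[of "norm (F' x w)" "g w" "norm h"]
            by force
        qed
      qed (use N U in auto)
      then show "\<bar>F (X (i + N)) w - F x0 w\<bar> \<le> g w * norm (X (i + N) - x0)" by simp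
    qed
  qed
  have Qb: "AE w in M. norm (Q i w) \<le> 2 * g w" for i
    using d lipd
  proof eventually_elim
    case (elim w)
    have "\<bar>F' x0 w \<bullet> (X (i + N) - x0)\<bar> \<le> g w * norm (X (i + N) - x0)"
      using elim(1) U(3) Cauchy_Schwarz_ineq2[of "F' x0 w" "X (i + N) - x0"]
        mult_right_mono[of "norm (F' x0 w)" "g w" "norm (X (i + N) - x0)"] by force
    then have "\<bar>F (X (i + N)) w - F x0 w - F' x0 w \<bullet> (X (i + N) - x0)\<bar> \<le> 2 * g w * norm (X (i + N) - x0)"
      using elim(2)[rule_format, of i] by linarith
    then show ?case using X by (simp add: Q_def divide_le_eq)
  qed
  have limN: "(\<lambda>i. X (i + N)) \<longlonglongrightarrow> x0" using lim by (rule LIMSEQ_ignore_initial_segment)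
  have Ql: "AE w in M. (\<lambda>i. Q i w) \<longlonglongrightarrow> 0"
    using d
  proof eventually_elim
    case (elim w)
    then have "((\<lambda>y. norm (F y w - F x0 w - F' x0 w \<bullet> (y - x0)) / norm (y - x0)) \<longlongrightarrow> 0) (at x0)"
      using U(3) unfolding has_derivative_iff_norm by blast
    moreover have "\<forall>i. X (i + N) \<in> UNIV - {x0}" using X by simp
    ultimately show ?case
      using limN unfolding tendsto_at_iff_sequentially Q_def by (auto simp: o_def)
  qed
  have Qm[measurable]: "Q i \<in> borel_measurable M" for i
    unfolding Q_def using borel_measurable_integrable[OF iF(1)[of i]] borel_measurable_integrable[OF iF(2)] by measurable
  have "(\<lambda>i. \<integral>w. Q i w \<partial>M) \<longlonglongrightarrow> (\<integral>w. 0 \<partial>M)"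
    by (rule integral_dominated_convergence[where w="\<lambda>w. 2 * g w"]) (use g Qb Ql in auto)
  then have Qi: "(\<lambda>i. \<integral>w. Q i w \<partial>M) \<longlonglongrightarrow> 0" by simp
  have *: "norm ((\<integral>w. F (X (i + N)) w \<partial>M) - (\<integral>w. F x0 w \<partial>M) - (\<integral>w. F' x0 w \<partial>M) \<bullet> (X (i + N) - x0)) / norm (X (i + N) - x0)
     \<le> (\<integral>w. Q i w \<partial>M)" for i
  proof -
    have "(\<integral>w. F (X (i + N)) w \<partial>M) - (\<integral>w. F x0 w \<partial>M) - (\<integral>w. F' x0 w \<partial>M) \<bullet> (X (i + N) - x0)
      = (\<integral>w. F (X (i + N)) w - F x0 w - F' x0 w \<bullet> (X (i + N) - x0) \<partial>M)"
      using iF' by (simp add: Bochner_Integration.integral_diff)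
    also have "norm \<dots> \<le> (\<integral>w. \<bar>F (X (i + N)) w - F x0 w - F' x0 w \<bullet> (X (i + N) - x0)\<bar> \<partial>M)"
      unfolding real_norm_def[symmetric] by (rule integral_norm_bound)
    also have "\<dots> = (\<integral>w. Q i w * norm (X (i + N) - x0) \<partial>M)"
      using X by (intro Bochner_Integration.integral_cong) (auto simp: Q_def)
    finally show ?thesis using X by (simp add: divide_le_eq)
  qed
  have "(\<lambda>i. norm ((\<integral>w. F (X (i + N)) w \<partial>M) - (\<integral>w. F x0 w \<partial>M) - (\<integral>w. F' x0 w \<partial>M) \<bullet> (X (i + N) - x0)) / norm (X (i + N) - x0)) \<longlonglongrightarrow> 0"
    by (rule tendsto_sandwich[OF _ _ tendsto_const Qi]) (use * in auto)
  then show "((\<lambda>y. norm ((\<integral>w. F y w \<partial>M) - (\<integral>w. F x0 w \<partial>M) - (\<integral>w. F' x0 w \<partial>M) \<bullet> (y - x0)) / norm (y - x0)) \<circ> X) \<longlonglongrightarrow> 0"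
    by (rule_tac LIMSEQ_offset[where k=N]) (simp add: o_def)
qed

lemma continuous_on_integral_dominated:
  fixes F :: "'a::metric_space \<Rightarrow> 'w \<Rightarrow> 'b::{banach,second_countable_topology}"
  assumes c: "AE w in M. continuous_on S (\<lambda>x. F x w)"
    and b: "\<And>x. x \<in> S \<Longrightarrow> AE w in M. norm (F x w) \<le> g w"
    and g: "integrable M g" and m: "\<And>x. x \<in> S \<Longrightarrow> F x \<in> borel_measurable M"
  shows "continuous_on S (\<lambda>x. \<integral>w. F x w \<partial>M)"
  unfolding continuous_on_sequentially
proof (intro allI ballI impI)
  fix x a assume a: "a \<in> S" and x: "(\<forall>n. x n \<in> S) \<and> x \<longlonglongrightarrow> a"
  have "(\<lambda>n. \<integral>w. F (x n) w \<partial>M) \<longlonglongrightarrow> (\<integral>w. F a w \<partial>M)"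
  proof (rule integral_dominated_convergence[where w=g])
    show "AE w in M. (\<lambda>n. F (x n) w) \<longlonglongrightarrow> F a w"
      using c by eventually_elim (use a x in \<open>auto simp: continuous_on_sequentially o_def\<close>)
  qed (use a x b g m in auto)
  then show "((\<lambda>x. \<integral>w. F x w \<partial>M) \<circ> x) \<longlonglongrightarrow> (\<integral>w. F a w \<partial>M)" by (simp add: o_def)
qed

text \<open>The heat kernel at time \<open>t\<close>, that is the density of
  \<open>N(0, 2 t I)\<close>: the law of \<open>sqrt (2 t) z\<close>. The standard Gaussian is the
  case \<open>t = 1/2\<close>.\<close>

definition gauss :: "real \<Rightarrow> real^'n \<Rightarrow> real" where
  "gauss t u = (4 * pi * t) powr (- real CARD('n) / 2) * exp (- (norm u)\<^sup>2 / (4 * t))"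

lemma gauss_pos: "t > 0 \<Longrightarrow> gauss t u > 0"
  by (simp add: gauss_def)

lemma gauss_nonneg[simp]: "gauss t u \<ge> 0"
  by (simp add: gauss_def)

lemma measurable_gauss[measurable]: "gauss t \<in> borel_measurable borel"
  unfolding gauss_def by measurable

lemma gauss_prod:
  assumes "t > 0"
  shows "gauss t (u::real^'n) = (\<Prod>b\<in>Basis. normal_density 0 (sqrt (2 * t)) (u \<bullet> b))"
proof -
  have "(\<Prod>b\<in>(Basis::(real^'n) set). normal_density 0 (sqrt (2 * t)) (u \<bullet> b))
     = (1 / sqrt (4 * pi * t)) ^ CARD('n) * (\<Prod>b\<in>(Basis::(real^'n) set). exp (- (u \<bullet> b)\<^sup>2 / (4 * t)))"
    using assms by (simp add: normal_density_def prod.distrib power_divide prod_dividef mult.assoc)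
  also have "(\<Prod>b\<in>(Basis::(real^'n) set). exp (- (u \<bullet> b)\<^sup>2 / (4 * t))) = exp (- (\<Sum>b\<in>(Basis::(real^'n) set). (u \<bullet> b)\<^sup>2) / (4 * t))"
    by (simp add: exp_sum[symmetric] sum_divide_distrib sum_negf)
  also have "(\<Sum>b\<in>(Basis::(real^'n) set). (u \<bullet> b)\<^sup>2) = (norm u)\<^sup>2"
    by (simp add: norm_eq_sqrt_inner euclidean_inner[of u u] power2_eq_square sum_nonneg)
  also have "(1 / sqrt (4 * pi * t)) ^ CARD('n) = (4 * pi * t) powr (- real CARD('n) / 2)"
  proof -
    have "1 / sqrt (4 * pi * t) = (4 * pi * t) powr (- 1 / 2)"
      using assms by (simp add: powr_minus_divide powr_half_sqrt)
    then show ?thesis using assms by (simp add: powr_power)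
  qed
  finally show ?thesis by (simp add: gauss_def)
qed

lemma nn_integral_gauss: "t > 0 \<Longrightarrow> (\<integral>\<^sup>+u. ennreal (gauss t (u::real^'n)) \<partial>lborel) = 1"
proof -
  assume t: "t > 0"
  have "(\<integral>\<^sup>+u. ennreal (gauss t (u::real^'n)) \<partial>lborel) = (\<integral>\<^sup>+(u::real^'n). (\<Prod>b\<in>Basis. ennreal (normal_density 0 (sqrt (2 * t)) (u \<bullet> b))) \<partial>lborel)"
    using t by (simp add: gauss_prod prod_ennreal)
  also have "\<dots> = (\<Prod>b\<in>(Basis::(real^'n) set). \<integral>\<^sup>+x. ennreal (normal_density 0 (sqrt (2 * t)) x) \<partial>lborel)"
    by (rule nn_integral_lborel_prod) auto
  also have "(\<integral>\<^sup>+x. ennreal (normal_density 0 (sqrt (2 * t)) x) \<partial>lborel) = 1"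
    using t by (subst nn_integral_eq_integral) auto
  finally show ?thesis by simp
qed

lemma integrable_gauss: "t > 0 \<Longrightarrow> integrable lborel (gauss t)"
  by (rule integrableI_nonneg) (auto simp: nn_integral_gauss)

lemma integrable_exp_norm: "\<kappa> > 0 \<Longrightarrow> integrable lborel (\<lambda>x::real^'n. exp (- \<kappa> * (norm x)\<^sup>2))"
proof -
  assume k: "\<kappa> > 0"
  let ?c = "(4 * pi * (1 / (4 * \<kappa>))) powr (- real CARD('n) / 2)"
  have "integrable lborel (\<lambda>x::real^'n. inverse ?c * gauss (1 / (4 * \<kappa>)) x)"
    using k by (intro integrable_mult_right integrable_gauss) auto
  also have "(\<lambda>x::real^'n. inverse ?c * gauss (1 / (4 * \<kappa>)) x) = (\<lambda>x. exp (- \<kappa> * (norm x)\<^sup>2))"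
    using k by (auto simp: gauss_def fun_eq_iff field_simps)
  finally show ?thesis .
qed

text \<open>From \<open>(1 + u)^4 <= 8 + 8 u^4\<close> and \<open>v^2 / 2 <= exp v\<close> for
  \<open>v = \<kappa> u^2 / 2\<close>, where \<open>v^2 / 2 = \<kappa>^2 u^4 / 8\<close>. Half of
  the Gaussian rate is spent on the polynomial.\<close>

lemma poly_le_exp:
  fixes u \<kappa> :: real
  assumes "\<kappa> > 0" "u \<ge> 0"
  shows "(1 + u) ^ 4 \<le> (8 + 64 / \<kappa>\<^sup>2) * exp (\<kappa> * u\<^sup>2 / 2)"
proof -
  let ?v = "\<kappa> * u\<^sup>2 / 2"
  have "(1 + u)\<^sup>2 \<le> 2 * (1 + u\<^sup>2)" using sum_squares_ge_zero[of "1-u" 0] by (simp add: power2_eq_square algebra_simps)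
  then have "((1 + u)\<^sup>2)\<^sup>2 \<le> (2 * (1 + u\<^sup>2))\<^sup>2" by (intro power_mono) auto
  also have "\<dots> = 4 * (1 + u\<^sup>2)\<^sup>2" by (simp add: power2_eq_square algebra_simps)
  also have "(1 + u\<^sup>2)\<^sup>2 \<le> 2 * (1 + u^4)"
    using zero_le_power2[of "1 - u\<^sup>2"] by (simp add: power2_eq_square algebra_simps power4_eq_xxxx)
  finally have 1: "(1 + u) ^ 4 \<le> 8 + 8 * u ^ 4" by simp
  have v0: "?v \<ge> 0" using assms by simp
  have "1 + ?v + ?v\<^sup>2 / 2 \<le> exp ?v" using exp_lower_Taylor_quadratic[OF v0] .
  moreover have "?v\<^sup>2 / 2 = \<kappa>\<^sup>2 * u ^ 4 / 8" by (simp add: power2_eq_square power4_eq_xxxx)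
  ultimately have "\<kappa>\<^sup>2 * u ^ 4 / 8 \<le> exp ?v" "1 \<le> exp ?v" using v0 by (auto simp: add_nonneg_nonneg)
  then have "8 * u ^ 4 \<le> 64 / \<kappa>\<^sup>2 * exp ?v" using assms by (simp add: field_simps)
  moreover have "(8 + 64 / \<kappa>\<^sup>2) * exp ?v = 8 * exp ?v + 64 / \<kappa>\<^sup>2 * exp ?v" by (rule distrib_right)
  ultimately show ?thesis using 1 \<open>1 \<le> exp ?v\<close> by linarith
qed

lemma integrable_poly_exp_norm:
  "\<kappa> > 0 \<Longrightarrow> integrable lborel (\<lambda>x::real^'n. (1 + norm x) ^ 4 * exp (- \<kappa> * (norm x)\<^sup>2))"
proof -
  assume k: "\<kappa> > 0"
  have "integrable lborel (\<lambda>x::real^'n. (8 + 64 / \<kappa>\<^sup>2) * exp (- (\<kappa> / 2) * (norm x)\<^sup>2))"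
    using k by (intro integrable_mult_right integrable_exp_norm) auto
  then show ?thesis
  proof (rule Bochner_Integration.integrable_bound)
    show "AE x in lborel. norm ((1 + norm x) ^ 4 * exp (- \<kappa> * (norm x)\<^sup>2)) \<le> norm ((8 + 64 / \<kappa>\<^sup>2) * exp (- (\<kappa> / 2) * (norm (x::real^'n))\<^sup>2))"
    proof (rule AE_I2)
      fix x :: "real^'n"
      have "(1 + norm x) ^ 4 * exp (- \<kappa> * (norm x)\<^sup>2) \<le> (8 + 64 / \<kappa>\<^sup>2) * exp (\<kappa> * (norm x)\<^sup>2 / 2) * exp (- \<kappa> * (norm x)\<^sup>2)"
        using poly_le_exp[OF k norm_ge_zero] by (intro mult_right_mono) auto
      also have "\<dots> = (8 + 64 / \<kappa>\<^sup>2) * exp (- (\<kappa> / 2) * (norm x)\<^sup>2)"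
        by (simp add: mult.assoc exp_add[symmetric])
      finally show "norm ((1 + norm x) ^ 4 * exp (- \<kappa> * (norm x)\<^sup>2)) \<le> norm ((8 + 64 / \<kappa>\<^sup>2) * exp (- (\<kappa> / 2) * (norm x)\<^sup>2))"
        by (simp add: abs_mult)
    qed
  qed measurable
qed

lemma std_gauss_eq: "std_gauss = density lborel (\<lambda>z::real^'n. ennreal (gauss (1/2) z))"
  by (simp add: std_gauss_def gauss_def)

lemma sets_std_gauss[simp, measurable_cong]: "sets std_gauss = sets borel"
  and space_std_gauss[simp]: "space std_gauss = UNIV"
  by (simp_all add: std_gauss_def)

lemma prob_space_std_gauss: "prob_space (std_gauss :: (real^'n) measure)"
  by (rule prob_spaceI) (simp add: std_gauss_eq emeasure_density nn_integral_gauss)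

lemma integrable_std_gauss_poly: "integrable (std_gauss :: (real^'n) measure) (\<lambda>z. (1 + norm z) ^ 4)"
proof -
  have "integrable lborel (\<lambda>z::real^'n. (2 * pi) powr (- real CARD('n) / 2) * ((1 + norm z) ^ 4 * exp (- (1/2) * (norm z)\<^sup>2)))"
    by (intro integrable_mult_right integrable_poly_exp_norm) simp
  then show ?thesis
    by (simp add: std_gauss_eq integrable_density gauss_def mult_ac)
qed

lemma nn_integral_shift_gauss:
  fixes x :: "real^'n"
  assumes t: "t > 0" and h[measurable]: "h \<in> borel_measurable borel"
  shows "(\<integral>\<^sup>+z. h (x + sqrt (2 * t) *\<^sub>R z) \<partial>std_gauss) = (\<integral>\<^sup>+y. ennreal (gauss t (y - x)) * h y \<partial>lborel)"
proof -
  let ?c = "sqrt (2 * t)"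
  have c: "?c > 0" using t by simp
  have g: "gauss t (?c *\<^sub>R z) * ?c ^ CARD('n) = gauss (1/2) z" for z :: "real^'n"
  proof -
    have "(4 * pi * t) powr (- real CARD('n) / 2) * ?c ^ CARD('n) = (2 * pi) powr (- real CARD('n) / 2)"
    proof -
      have "?c ^ CARD('n) = (2 * t) powr (real CARD('n) / 2)"
        using t by (simp add: powr_half_sqrt[symmetric] powr_power)
      moreover have "(4 * pi * t) powr (- real CARD('n) / 2) = (2 * pi) powr (- real CARD('n) / 2) * (2 * t) powr (- real CARD('n) / 2)"
        using t by (subst powr_mult[symmetric]) (auto simp: mult_ac)
      ultimately show ?thesis using t by (simp add: powr_add[symmetric])
    qed
    then show ?thesis using t by (simp add: gauss_def power_mult_distrib)
  qed
  have "(\<integral>\<^sup>+y. ennreal (gauss t (y - x)) * h y \<partial>lborel)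
      = (\<integral>\<^sup>+y. ennreal (gauss t (y - x)) * h y \<partial>density (distr lborel borel (\<lambda>z. x + ?c *\<^sub>R z)) (\<lambda>_. \<bar>?c\<bar> ^ DIM(real^'n)))"
    using c by (subst lborel_affine[of ?c x]) auto
  also have "\<dots> = (\<integral>\<^sup>+z. ennreal (?c ^ CARD('n)) * (ennreal (gauss t (?c *\<^sub>R z)) * h (x + ?c *\<^sub>R z)) \<partial>lborel)"
    using c by (simp add: nn_integral_density nn_integral_distr)
  also have "\<dots> = (\<integral>\<^sup>+z. ennreal (gauss (1/2) z) * h (x + ?c *\<^sub>R z) \<partial>lborel)"
    using c by (simp add: g[symmetric] ennreal_mult mult_ac)
  also have "\<dots> = (\<integral>\<^sup>+z. h (x + ?c *\<^sub>R z) \<partial>std_gauss)"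
    by (simp add: std_gauss_eq nn_integral_density)
  finally show ?thesis by simp
qed

text \<open>The joint law of the starting point and the noisy point, in a form where the order of
  integration can be exchanged; this is how \<open>conditional_score\<close> conditions on the noisy
  point.\<close>

lemma distr_pair_shift_gauss:
  fixes \<mu> :: "(real^'n) measure"
  assumes t: "t > 0" and \<mu>: "prob_space \<mu>" "sets \<mu> = sets borel"
  shows "distr (\<mu> \<Otimes>\<^sub>M std_gauss) (borel \<Otimes>\<^sub>M borel) (\<lambda>(x, z). (x, x + sqrt (2 * t) *\<^sub>R z))
       = density (\<mu> \<Otimes>\<^sub>M lborel) (\<lambda>(x, y). ennreal (gauss t (y - x)))"
proof (rule measure_eqI)
  interpret \<mu>: prob_space \<mu> by fact
  interpret G: prob_space "std_gauss :: (real^'n) measure" by (rule prob_space_std_gauss)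
  note [measurable_cong] = \<mu>(2)
  show "sets (distr (\<mu> \<Otimes>\<^sub>M std_gauss) (borel \<Otimes>\<^sub>M borel) (\<lambda>(x, z). (x, x + sqrt (2 * t) *\<^sub>R z)))
      = sets (density (\<mu> \<Otimes>\<^sub>M lborel) (\<lambda>(x, y). ennreal (gauss t (y - x))))"
    using sets_pair_measure_cong[OF \<mu>(2) sets_lborel, symmetric] by simp
  fix A assume "A \<in> sets (distr (\<mu> \<Otimes>\<^sub>M std_gauss) (borel \<Otimes>\<^sub>M borel) (\<lambda>(x::real^'n, z). (x, x + sqrt (2 * t) *\<^sub>R z)))"
  then have A[measurable]: "A \<in> sets (borel \<Otimes>\<^sub>M borel)" by simp
  have "emeasure (distr (\<mu> \<Otimes>\<^sub>M std_gauss) (borel \<Otimes>\<^sub>M borel) (\<lambda>(x, z). (x, x + sqrt (2 * t) *\<^sub>R z))) A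
     = (\<integral>\<^sup>+w. indicator A w \<partial>distr (\<mu> \<Otimes>\<^sub>M std_gauss) (borel \<Otimes>\<^sub>M borel) (\<lambda>(x, z). (x, x + sqrt (2 * t) *\<^sub>R z)))"
    by simp
  also have "\<dots> = (\<integral>\<^sup>+w. indicator A (fst w, fst w + sqrt (2 * t) *\<^sub>R snd w) \<partial>(\<mu> \<Otimes>\<^sub>M std_gauss))"
    by (subst nn_integral_distr) (auto simp: case_prod_beta)
  also have "\<dots> = (\<integral>\<^sup>+x. \<integral>\<^sup>+z. indicator A (x, x + sqrt (2 * t) *\<^sub>R z) \<partial>std_gauss \<partial>\<mu>)"
    by (subst G.nn_integral_fst[symmetric]) simp_all
  also have "\<dots> = (\<integral>\<^sup>+x. \<integral>\<^sup>+y. ennreal (gauss t (y - x)) * indicator A (x, y) \<partial>lborel \<partial>\<mu>)"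
    by (intro nn_integral_cong nn_integral_shift_gauss t) measurable
  also have "\<dots> = (\<integral>\<^sup>+w. (case w of (x, y) \<Rightarrow> ennreal (gauss t (y - x))) * indicator A w \<partial>(\<mu> \<Otimes>\<^sub>M lborel))"
    by (subst lborel.nn_integral_fst[symmetric]) simp_all
  also have "\<dots> = emeasure (density (\<mu> \<Otimes>\<^sub>M lborel) (\<lambda>(x, y). ennreal (gauss t (y - x)))) A"
  proof (subst emeasure_density)
    show "A \<in> sets (\<mu> \<Otimes>\<^sub>M lborel)" by measurable
  qed (measurable)
  finally show "emeasure (distr (\<mu> \<Otimes>\<^sub>M std_gauss) (borel \<Otimes>\<^sub>M borel) (\<lambda>(x, z). (x, x + sqrt (2 * t) *\<^sub>R z))) A
     = emeasure (density (\<mu> \<Otimes>\<^sub>M lborel) (\<lambda>(x, y). ennreal (gauss t (y - x)))) A" .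
qed

section \<open>Matrices close to the identity\<close>

text \<open>The radius \<open>1/8\<close> is the bound on \<open>\<epsilon> L\<close> in the step
  size condition. It produces the factors \<open>9/8\<close> and \<open>8/7 = 1 / (1 - 1/8)\<close>
  of all later estimates.\<close>

definition near_id :: "real^'n^'n \<Rightarrow> bool" where
  "near_id B \<longleftrightarrow> (\<forall>h. norm (B *v h - h) \<le> norm h / 8)"

lemma near_id_bounds:
  assumes "near_id B"
  shows "norm (B *v h) \<le> 9 / 8 * norm h" "7 / 8 * norm h \<le> norm (B *v h)"
proof -
  have 1: "norm (B *v h - h) \<le> norm h / 8" using assms by (simp add: near_id_def)
  then show "norm (B *v h) \<le> 9 / 8 * norm h" using norm_triangle_sub[of "B *v h" h] by linarith
  show "7 / 8 * norm h \<le> norm (B *v h)" using 1 norm_triangle_sub[of h "B *v h"] by (simp add: norm_minus_commute)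
qed

lemma near_id_inverse:
  fixes B :: "real^'n^'n"
  assumes "near_id B"
  shows "matrix_inv B ** B = mat 1" "B ** matrix_inv B = mat 1"
proof -
  have "inj ((*v) B)"
  proof (rule injI)
    fix x y assume "B *v x = B *v y"
    then have "B *v (x - y) = 0" by (simp add: matrix_vector_mult_diff_distrib)
    then show "x = y" using near_id_bounds(2)[OF assms, of "x - y"] by simp
  qed
  then obtain C where "C ** B = mat 1" using matrix_left_invertible_injective by blast
  then have "B ** C = mat 1 \<and> C ** B = mat 1" using matrix_left_right_inverse by blast
  then have "B ** matrix_inv B = mat 1 \<and> matrix_inv B ** B = mat 1"
    unfolding matrix_inv_def by (rule someI)
  then show "matrix_inv B ** B = mat 1" "B ** matrix_inv B = mat 1" by auto
qed

lemma near_id_inverse_vec: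
  assumes "near_id B"
  shows "matrix_inv B *v (B *v h) = h" "B *v (matrix_inv B *v h) = h"
  using near_id_inverse[OF assms] by (simp_all add: matrix_vector_mul_assoc)

lemma near_id_inverse_bound: "near_id B \<Longrightarrow> norm (matrix_inv B *v h) \<le> 8 / 7 * norm h"
  using near_id_bounds(2)[of B "matrix_inv B *v h"] by (simp add: near_id_inverse_vec)

lemma inner_matrix_vec_transpose: "x \<bullet> (B *v y) = (transpose B *v x) \<bullet> y" for B :: "real^'n^'m"
  by (metis dot_lmul_matrix transpose_matrix_vector)

text \<open>Test \<open>B\<close> on \<open>transpose B *v h\<close> and cancel one factor of the
  norm. Transposes arise because the chain rule for the gradient of \<open>ln (p s (T s x))\<close>
  multiplies the score by the transposed Jacobian.\<close>

lemma transpose_bound: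
  fixes B :: "real^'n^'n"
  assumes "\<And>h. norm (B *v h) \<le> c * norm h"
  shows "norm (transpose B *v h) \<le> c * norm h"
proof (cases "transpose B *v h = 0")
  case True
  have "0 \<le> norm (B *v h)" by simp
  also have "\<dots> \<le> c * norm h" by (rule assms)
  finally show ?thesis using True by simp
next
  case False
  have "norm (transpose B *v h) ^ 2 = h \<bullet> (B *v (transpose B *v h))"
    by (simp add: inner_matrix_vec_transpose power2_norm_eq_inner)
  also have "\<dots> \<le> norm h * (c * norm (transpose B *v h))"
    by (rule order_trans[OF norm_cauchy_schwarz mult_left_mono[OF assms norm_ge_zero]])
  finally have "norm (transpose B *v h) * norm (transpose B *v h) \<le> c * norm h * norm (transpose B *v h)"
    by (simp add: power2_eq_square mult_ac)
  then show ?thesis using False by simp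
qed

lemma near_id_transpose:
  fixes B :: "real^'n^'n"
  assumes "near_id B" shows "near_id (transpose B)"
proof -
  have "norm (transpose (B - mat 1) *v h) \<le> 1 / 8 * norm h" for h
    by (rule transpose_bound) (use assms in \<open>simp add: near_id_def matrix_vector_mult_diff_rdistrib\<close>)
  moreover have "transpose (B - mat 1) = transpose B - mat 1"
    by (simp add: transpose_def vec_eq_iff mat_def)
  ultimately show ?thesis by (simp add: near_id_def matrix_vector_mult_diff_rdistrib)
qed

lemma transpose_inverse_vec:
  fixes B :: "real^'n^'n"
  assumes "near_id B"
  shows "transpose (matrix_inv B) *v (transpose B *v h) = h" "transpose B *v (transpose (matrix_inv B) *v h) = h"
  using near_id_inverse[OF assms]
  by (simp_all del: transpose_matrix_vector add: matrix_vector_mul_assoc matrix_transpose_mul[symmetric] transpose_mat)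

lemma continuous_on_matrix_vec[continuous_intros]:
  fixes B :: "'a::topological_space \<Rightarrow> real^'n^'m"
  assumes "continuous_on S B" "continuous_on S v"
  shows "continuous_on S (\<lambda>x. B x *v v x)"
  unfolding matrix_vector_mult_def using assms
  by (intro continuous_on_vec_lambda continuous_intros) auto

text \<open>If \<open>w\<close> is the value at \<open>a\<close>, then the inverse of
  \<open>B x\<close> applied to \<open>v x\<close>, minus \<open>w\<close>, is that inverse applied
  to \<open>v x - B x w\<close>; the uniform bound \<open>8/7\<close> reduces the claim to
  continuity of \<open>B\<close> and \<open>v\<close>.\<close>

lemma continuous_on_matrix_inv_vec:
  fixes B :: "'a::metric_space \<Rightarrow> real^'n^'n"
  assumes B: "continuous_on S B" and v: "continuous_on S v" and n: "\<And>x. x \<in> S \<Longrightarrow> near_id (B x)"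
  shows "continuous_on S (\<lambda>x. matrix_inv (B x) *v v x)"
  unfolding continuous_on_def
proof
  fix a assume a: "a \<in> S"
  let ?w = "matrix_inv (B a) *v v a"
  have 1: "((\<lambda>x. B x *v ?w) \<longlongrightarrow> B a *v ?w) (at a within S)"
    using continuous_on_matrix_vec[OF B continuous_on_const] a by (auto simp: continuous_on_def)
  have 2: "(v \<longlongrightarrow> v a) (at a within S)" using v a by (auto simp: continuous_on_def)
  have 3: "((\<lambda>x. 8 / 7 * norm (v x - B x *v ?w)) \<longlongrightarrow> 8 / 7 * norm (v a - B a *v ?w)) (at a within S)"
    by (intro tendsto_intros 1 2)
  then have 4: "((\<lambda>x. 8 / 7 * norm (v x - B x *v ?w)) \<longlongrightarrow> 0) (at a within S)"
    using n[OF a] by (simp add: near_id_inverse_vec)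
  have "\<forall>\<^sub>F x in at a within S. norm (matrix_inv (B x) *v v x - ?w) \<le> 8 / 7 * norm (v x - B x *v ?w)"
    unfolding eventually_at_filter
  proof (rule always_eventually, intro allI impI)
    fix x assume "x \<in> S"
    then have "matrix_inv (B x) *v v x - ?w = matrix_inv (B x) *v (v x - B x *v ?w)"
      using n by (simp add: matrix_vector_mult_diff_distrib near_id_inverse_vec)
    then show "norm (matrix_inv (B x) *v v x - ?w) \<le> 8 / 7 * norm (v x - B x *v ?w)"
      using near_id_inverse_bound[OF n[OF \<open>x \<in> S\<close>]] by simp
  qed
  then show "((\<lambda>x. matrix_inv (B x) *v v x) \<longlongrightarrow> ?w) (at a within S)"
    by (intro Lim_null_comparison[THEN LIM_zero_cancel, OF _ 4])
qed

section \<open>Determinants near the identity: positivity, Lipschitz bounds and derivative\<close>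

lemma continuous_on_jac[continuous_intros]:
  fixes B :: "'a::topological_space \<Rightarrow> real^'n^'n"
  assumes "continuous_on S B" shows "continuous_on S (\<lambda>x. jac (B x))"
  unfolding jac_def det_def reindex_mat_def using assms by (intro continuous_intros) auto

text \<open>The segment from the identity to \<open>B\<close> stays among invertible matrices, so
  the determinant cannot change sign along it.\<close>

lemma near_id_jac_pos:
  fixes B :: "real^'n^'n"
  assumes "near_id B" shows "jac B > 0"
proof (rule ccontr)
  assume neg: "\<not> jac B > 0"
  define P where "P \<tau> = mat 1 + \<tau> *\<^sub>R (B - mat 1)" for \<tau> :: real
  have n: "near_id (P \<tau>)" if "0 \<le> \<tau>" "\<tau> \<le> 1" for \<tau>
    unfolding near_id_def
  proof
    fix h
    have "P \<tau> *v h - h = \<tau> *\<^sub>R (B *v h - h)"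
      by (simp add: P_def matrix_vector_mult_add_rdistrib scaleR_matrix_vector_assoc[symmetric] matrix_vector_mult_diff_rdistrib)
    then have "norm (P \<tau> *v h - h) = \<tau> * norm (B *v h - h)" using that by simp
    also have "\<dots> \<le> 1 * (norm h / 8)" using assms that by (intro mult_mono) (auto simp: near_id_def)
    finally show "norm (P \<tau> *v h - h) \<le> norm h / 8" by simp
  qed
  have nz: "jac (P \<tau>) \<noteq> 0" if "0 \<le> \<tau>" "\<tau> \<le> 1" for \<tau>
    using near_id_inverse(1)[OF n[OF that]] jac_mult[of "matrix_inv (P \<tau>)" "P \<tau>"] by auto
  have c: "continuous_on {0..1} (\<lambda>\<tau>. jac (P \<tau>))" unfolding P_def by (intro continuous_intros)
  have "\<exists>\<tau>\<ge>0. \<tau> \<le> 1 \<and> jac (P \<tau>) = 0"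
    by (rule IVT2'[OF _ _ _ c]) (use neg in \<open>auto simp: P_def\<close>)
  then show False using nz by blast
qed

text \<open>The upper bound \<open>jac_bound\<close> applied to the inverse matrix.\<close>

lemma jac_lower_bound:
  fixes B :: "real^'n^'n"
  assumes n: "near_id B" and c: "c > 0" and b: "\<And>h. c * norm h \<le> norm (B *v h)"
  shows "c ^ CARD('n) \<le> jac B"
proof -
  have "\<bar>jac (matrix_inv B)\<bar> \<le> (1 / c) ^ CARD('n)"
    by (rule jac_bound) (use b[of "matrix_inv B *v h" for h] c in \<open>auto simp: near_id_inverse_vec[OF n] field_simps\<close>)
  moreover have "jac (matrix_inv B) * jac B = 1"
    using jac_mult[of "matrix_inv B" B] near_id_inverse[OF n] by simp
  moreover have p: "jac B > 0" by (rule near_id_jac_pos[OF n])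
  ultimately have "1 \<le> (1 / c) ^ CARD('n) * jac B"
    using mult_right_mono[of "jac (matrix_inv B)" "(1 / c) ^ CARD('n)" "jac B"] by simp
  then show ?thesis using c by (simp add: power_divide field_simps)
qed

text \<open>The quotient \<open>E\<close> of \<open>B\<close> by \<open>C\<close> has operator norm
  at most \<open>1 + 8/7 \<delta>\<close>, hence determinant at most the \<open>n\<close>-th power
  of this, and \<open>ln (1 + u) <= u\<close>. Exchanging \<open>B\<close> and \<open>C\<close>
  gives the other sign.\<close>

lemma ln_jac_lipschitz:
  fixes B C :: "real^'n^'n"
  assumes n: "near_id B" "near_id C" and d: "\<And>h. norm ((B - C) *v h) \<le> \<delta> * norm h" and d0: "\<delta> \<ge> 0"
  shows "\<bar>ln (jac B) - ln (jac C)\<bar> \<le> 8 / 7 * real CARD('n) * \<delta>"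
proof -
  have *: "ln (jac B) - ln (jac C) \<le> 8 / 7 * real CARD('n) * \<delta>"
    if n: "near_id B" "near_id C" and d: "\<And>h. norm ((B - C) *v h) \<le> \<delta> * norm h" for B C :: "real^'n^'n"
  proof -
    define E where "E = B ** matrix_inv C"
    have "E ** C = B" by (simp add: E_def matrix_mul_assoc[symmetric] near_id_inverse[OF n(2)])
    then have eq: "jac B = jac E * jac C" using jac_mult by metis
    have p: "jac B > 0" "jac C > 0" using n near_id_jac_pos by auto
    then have pE: "jac E > 0" using eq zero_less_mult_pos2 by fastforce
    have "norm (E *v h) \<le> (1 + 8 / 7 * \<delta>) * norm h" for h
    proof -
      have "E *v h = h + (B - C) *v (matrix_inv C *v h)"
        by (simp add: E_def matrix_vector_mult_diff_rdistrib near_id_inverse_vec[OF n(2)] matrix_vector_mul_assoc[symmetric])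
      also have "norm \<dots> \<le> norm h + \<delta> * norm (matrix_inv C *v h)"
        by (rule order_trans[OF norm_triangle_ineq]) (simp add: d)
      also have "\<dots> \<le> norm h + \<delta> * (8 / 7 * norm h)"
        by (intro add_left_mono mult_left_mono near_id_inverse_bound n d0)
      finally show ?thesis by (simp add: algebra_simps)
    qed
    then have "\<bar>jac E\<bar> \<le> (1 + 8 / 7 * \<delta>) ^ CARD('n)" using d0 by (intro jac_bound) auto
    then have "ln (jac E) \<le> ln ((1 + 8 / 7 * \<delta>) ^ CARD('n))" using pE by simp
    also have "\<dots> = real CARD('n) * ln (1 + 8 / 7 * \<delta>)" using d0 by (simp add: ln_realpow)
    also have "\<dots> \<le> real CARD('n) * (8 / 7 * \<delta>)" using d0 by (intro mult_left_mono ln_add_one_self_le_self) auto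
    finally have "ln (jac E) \<le> 8 / 7 * real CARD('n) * \<delta>" by simp
    moreover have "ln (jac B) = ln (jac E) + ln (jac C)" using eq p pE by (simp add: ln_mult)
    ultimately show ?thesis by simp
  qed
  have "norm ((C - B) *v h) \<le> \<delta> * norm h" for h
    using d[of h] by (simp add: matrix_vector_mult_diff_rdistrib norm_minus_commute)
  then have "ln (jac C) - ln (jac B) \<le> 8 / 7 * real CARD('n) * \<delta>" by (intro *[OF n(2,1)])
  with *[OF n d] show ?thesis by linarith
qed

text \<open>The derivative of \<open>jac\<close> at \<open>B\<close> in direction \<open>H\<close>:
  the Leibniz sum with the product rule applied to each term. In this form joint continuity in
  \<open>B\<close> and \<open>H\<close> is evident.\<close>

definition djac :: "real^'n^'n \<Rightarrow> real^'n^'n \<Rightarrow> real" where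
  "djac B H = (\<Sum>p\<in>{p. p permutes (UNIV::'n ix set)}. of_int (sign p) *
     (\<Sum>i\<in>UNIV. reindex_mat H $ i $ p i * (\<Prod>j\<in>UNIV - {i}. reindex_mat B $ j $ p j)))"

lemma has_derivative_jac:
  fixes B :: "'a::real_normed_vector \<Rightarrow> real^'n^'n"
  assumes "(B has_derivative B') (at x)"
  shows "((\<lambda>x. jac (B x)) has_derivative (\<lambda>h. djac (B x) (B' h))) (at x)"
proof -
  have "((\<lambda>x. B x $ i $ j) has_derivative (\<lambda>h. B' h $ i $ j)) (at x)" for i j
    by (intro bounded_linear.has_derivative[OF bounded_linear_vec_nth] assms)
  then show ?thesis
    unfolding jac_def det_def djac_def reindex_mat_def
    by (auto intro!: has_derivative_sum has_derivative_mult_right has_derivative_prod)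
qed

lemma continuous_on_djac[continuous_intros]:
  fixes B :: "'a::topological_space \<Rightarrow> real^'n^'n"
  assumes "continuous_on S B" "continuous_on S H" shows "continuous_on S (\<lambda>x. djac (B x) (H x))"
  unfolding djac_def reindex_mat_def using assms by (intro continuous_intros) auto

section \<open>Gradients: uniqueness, Lipschitz bounds and measurability\<close>

lemma grad_eq: "(F has_derivative (\<lambda>h. g \<bullet> h)) (at x) \<Longrightarrow> grad F x = g"
proof -
  assume *: "(F has_derivative (\<lambda>h. g \<bullet> h)) (at x)"
  then have "(F has_derivative (\<lambda>h. grad F x \<bullet> h)) (at x)" unfolding grad_def by (rule someI)
  then have "(\<lambda>h. grad F x \<bullet> h) = (\<lambda>h. g \<bullet> h)" using * by (rule has_derivative_unique)
  then show ?thesis by (metis inner_eq_zero_iff inner_diff_left right_minus_eq)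
qed

lemma bounded_linear_functional_inner:
  fixes l :: "'a::euclidean_space \<Rightarrow> real"
  assumes "bounded_linear l" shows "l h = (\<Sum>b\<in>Basis. l b *\<^sub>R b) \<bullet> h"
proof -
  interpret bounded_linear l by fact
  have "l h = l (\<Sum>b\<in>Basis. (h \<bullet> b) *\<^sub>R b)" by (simp add: euclidean_representation)
  also have "\<dots> = (\<Sum>b\<in>Basis. (h \<bullet> b) * l b)" by (simp add: sum scaleR)
  also have "\<dots> = (\<Sum>b\<in>Basis. l b *\<^sub>R b) \<bullet> h"
    by (simp add: inner_sum_left inner_sum_right inner_commute mult.commute)
  finally show ?thesis .
qed

text \<open>The difference quotient in the direction of \<open>v\<close> itself tends to
  \<open>v \<bullet> v\<close>. Applied to the log-determinant, this bounds its gradient through the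
  Lipschitz constant of the Hessian.\<close>

lemma gradient_norm_le_lipschitz:
  fixes F :: "'a::euclidean_space \<Rightarrow> real"
  assumes d: "(F has_derivative (\<lambda>h. v \<bullet> h)) (at x)" and l: "\<And>y. \<bar>F y - F x\<bar> \<le> c * norm (y - x)"
  shows "norm v \<le> c"
proof (cases "v = 0")
  case True
  obtain b :: 'a where "b \<in> Basis" using nonempty_Basis by blast
  then have "0 \<le> c" using l[of "x + b"] by simp
  then show ?thesis using True by simp
next
  case False
  have "((\<lambda>t. F (x + t *\<^sub>R v)) has_derivative (\<lambda>t. v \<bullet> (t *\<^sub>R v))) (at (0::real))"
    by (rule has_derivative_compose[of "\<lambda>t. x + t *\<^sub>R v" "\<lambda>t. t *\<^sub>R v"])
       (auto intro!: derivative_eq_intros simp: d)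
  then have "((\<lambda>t. F (x + t *\<^sub>R v)) has_real_derivative (v \<bullet> v)) (at 0)"
    by (simp add: has_field_derivative_def mult.commute[of _ "v \<bullet> v"])
  then have lim: "((\<lambda>t. (F (x + t *\<^sub>R v) - F x) / t) \<longlongrightarrow> v \<bullet> v) (at 0)"
    by (simp add: has_field_derivative_iff)
  have "v \<bullet> v \<le> c * norm v"
  proof (rule tendsto_upperbound[OF lim])
    show "\<forall>\<^sub>F t in at 0. (F (x + t *\<^sub>R v) - F x) / t \<le> c * norm v"
    proof (rule always_eventually, rule allI)
      fix t :: real
      have "\<bar>(F (x + t *\<^sub>R v) - F x) / t\<bar> \<le> c * norm v"
      proof (cases "t = 0")
        case True
        have "0 \<le> c * norm v" using l[of "x + v"] by (auto intro: order_trans[rotated])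
        then show ?thesis using True by simp
      next
        case False
        then show ?thesis using l[of "x + t *\<^sub>R v"] by (simp add: field_simps)
      qed
      then show "(F (x + t *\<^sub>R v) - F x) / t \<le> c * norm v" by linarith
    qed
  qed simp
  then have "norm v * norm v \<le> c * norm v" by (simp add: power2_norm_eq_inner[symmetric] power2_eq_square)
  then show ?thesis using False by simp
qed

text \<open>Each directional derivative is a pointwise limit of measurable difference quotients. The
  gradient itself may be discontinuous, so this is the source of measurability of
  \<open>W s\<close>.\<close>

lemma measurable_gradient:
  fixes F :: "'a::euclidean_space \<Rightarrow> real"
  assumes d: "\<And>x. (F has_derivative (\<lambda>h. v x \<bullet> h)) (at x)"
  shows "v \<in> borel_measurable borel"
proof (subst borel_measurable_euclidean_space[where f=v])
  have [measurable]: "F \<in> borel_measurable borel" using d by (rule has_derivative_borel_measurable)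
  show "\<forall>b\<in>Basis. (\<lambda>x. v x \<bullet> b) \<in> borel_measurable borel"
  proof
    fix b :: 'a assume "b \<in> Basis"
    show "(\<lambda>x. v x \<bullet> b) \<in> borel_measurable borel"
    proof (rule borel_measurable_LIMSEQ_real)
      fix x
      have "((\<lambda>t. F (x + t *\<^sub>R b)) has_derivative (\<lambda>t. v x \<bullet> (t *\<^sub>R b))) (at (0::real))"
        by (rule has_derivative_compose[of "\<lambda>t. x + t *\<^sub>R b" "\<lambda>t. t *\<^sub>R b"])
           (auto intro!: derivative_eq_intros simp: d)
      then have "((\<lambda>t. F (x + t *\<^sub>R b)) has_real_derivative (v x \<bullet> b)) (at 0)"
        by (simp add: has_field_derivative_def mult.commute[of _ "v x \<bullet> b"])
      then have "((\<lambda>t. (F (x + t *\<^sub>R b) - F x) / t) \<longlongrightarrow> v x \<bullet> b) (at 0)"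
        by (simp add: has_field_derivative_iff)
      moreover have "filterlim (\<lambda>n. 1 / real (Suc n)) (at 0) sequentially"
        by (rule filterlim_atI, rule LIMSEQ_inverse_real_of_nat[unfolded inverse_eq_divide]) simp
      ultimately show "(\<lambda>n. (F (x + (1 / real (Suc n)) *\<^sub>R b) - F x) / (1 / real (Suc n))) \<longlonglongrightarrow> v x \<bullet> b"
        by (rule filterlim_compose)
    qed measurable
  qed
qed

section \<open>The proximal map\<close>

locale LM =
  fixes f :: "real^'n \<Rightarrow> real" and L M :: real
  assumes smooth: "LM_smooth f L M"
begin

abbreviation "G \<equiv> grad f"
abbreviation "A \<equiv> hess f"

lemma f_deriv: "(f has_derivative (\<lambda>h. G x \<bullet> h)) (at x)"
  and G_deriv: "(G has_derivative (\<lambda>h. A x *v h)) (at x)"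
  and A_diff: "A differentiable (at x)"
  using smooth by (auto simp: LM_smooth_def)

lemma A_deriv: "(A has_derivative frechet_derivative A (at x)) (at x)"
  using A_diff by (simp add: frechet_derivative_works)

lemma A_bound: "norm (A x *v h) \<le> L * norm h"
proof -
  have "norm (A x *v h) \<le> onorm (\<lambda>h. A x *v h) * norm h" by (rule onorm) simp
  also have "\<dots> \<le> L * norm h" using smooth by (intro mult_right_mono) (auto simp: LM_smooth_def)
  finally show ?thesis .
qed

lemma A_lip: "norm ((A x - A y) *v h) \<le> M * dist x y * norm h"
proof -
  have "norm ((A x - A y) *v h) \<le> onorm (\<lambda>h. (A x - A y) *v h) * norm h" by (rule onorm) simp
  also have "\<dots> \<le> M * dist x y * norm h" using smooth by (intro mult_right_mono) (auto simp: LM_smooth_def)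
  finally show ?thesis .
qed

lemma L_nonneg: "0 \<le> L"
proof -
  have "0 \<le> onorm (\<lambda>h. A 0 *v h)" by (rule onorm_pos_le) simp
  also have "\<dots> \<le> L" using smooth unfolding LM_smooth_def by blast
  finally show ?thesis .
qed

lemma M_nonneg: "0 \<le> M"
proof -
  obtain b :: "real^'n" where b: "b \<in> Basis" using nonempty_Basis by blast
  have "0 \<le> onorm (\<lambda>h. (A b - A 0) *v h)" by (rule onorm_pos_le) simp
  also have "\<dots> \<le> M * dist b 0" using smooth unfolding LM_smooth_def by blast
  finally show ?thesis using b by simp
qed

lemma G_lip: "norm (G x - G y) \<le> L * norm (x - y)"
proof (rule differentiable_bound[of UNIV])
  show "(G has_derivative (\<lambda>h. A x *v h)) (at x within UNIV)" for x using G_deriv by simp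
  show "onorm (\<lambda>h. A x *v h) \<le> L" for x using smooth by (auto simp: LM_smooth_def)
qed auto

lemma G_growth: "norm (G x) \<le> norm (G 0) + L * norm x"
  using G_lip[of x 0] norm_triangle_sub[of "G x" "G 0"] by simp

lemma A_cont[continuous_intros]: "continuous_on S g \<Longrightarrow> continuous_on S (\<lambda>x. A (g x))"
  by (rule continuous_on_compose2[of UNIV A])
     (auto intro!: continuous_at_imp_continuous_on differentiable_imp_continuous_within A_diff)

lemma G_cont[continuous_intros]: "continuous_on S g \<Longrightarrow> continuous_on S (\<lambda>x. G (g x))"
  by (rule continuous_on_compose2[of UNIV G])
     (auto intro!: continuous_at_imp_continuous_on has_derivative_continuous G_deriv)

lemma f_cont[continuous_intros]: "continuous_on S g \<Longrightarrow> continuous_on S (\<lambda>x. f (g x))"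
  by (rule continuous_on_compose2[of UNIV f])
     (auto intro!: continuous_at_imp_continuous_on has_derivative_continuous f_deriv)

lemma f_G_meas[measurable]: "f \<in> borel_measurable borel" "G \<in> borel_measurable borel"
  by (auto intro!: borel_measurable_continuous_onI continuous_intros)

definition "T s x = x + s *\<^sub>R G x"
definition "Bm s x = mat 1 + s *\<^sub>R A x"
definition "D s x = jac (Bm s x)"
definition "X s = inv (T s)"
text \<open>The absolute value admits negative times: the perturbation \<open>T (- \<sigma>)\<close>
  in \<open>integration_by_parts\<close> is covered by the same lemmas.\<close>

definition "small s \<longleftrightarrow> \<bar>s\<bar> * L \<le> 1 / 8"

lemma small_le: "small s \<Longrightarrow> 0 \<le> r \<Longrightarrow> r \<le> s \<Longrightarrow> small r"
  using mult_right_mono[of r s L] L_nonneg by (auto simp: small_def)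

lemma Bm_vec: "Bm s x *v h = h + s *\<^sub>R (A x *v h)"
  by (simp add: Bm_def matrix_vector_mult_add_rdistrib scaleR_matrix_vector_assoc[symmetric])

lemma sA_bound: "norm (s *\<^sub>R (A x *v h)) \<le> \<bar>s\<bar> * L * norm h"
  using mult_left_mono[OF A_bound[of x h] abs_ge_zero[of s]] by (simp add: mult.assoc)

lemma Bm_near: "small s \<Longrightarrow> near_id (Bm s x)"
  unfolding near_id_def
proof
  fix h :: "real^'n" assume "small s"
  then have "\<bar>s\<bar> * L * norm h \<le> 1 / 8 * norm h" unfolding small_def by (intro mult_right_mono) auto
  then show "norm (Bm s x *v h - h) \<le> norm h / 8" using sA_bound[of s x h] by (simp add: Bm_vec)
qed

lemma T_deriv: "(T s has_derivative (\<lambda>h. Bm s x *v h)) (at x)"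
  unfolding T_def[abs_def] Bm_vec by (auto intro!: derivative_eq_intros G_deriv)

lemma T_meas[measurable]: "T s \<in> borel_measurable borel"
  unfolding T_def[abs_def] by measurable

lemma T_expand: assumes "small s" shows "7 / 8 * norm (x - y) \<le> norm (T s x - T s y)"
proof -
  have "norm (s *\<^sub>R (G x - G y)) \<le> \<bar>s\<bar> * L * norm (x - y)"
    using mult_left_mono[OF G_lip[of x y] abs_ge_zero[of s]] by (simp add: mult.assoc)
  also have "\<dots> \<le> 1 / 8 * norm (x - y)" using assms unfolding small_def by (intro mult_right_mono) auto
  finally have "norm (s *\<^sub>R (G x - G y)) \<le> 1 / 8 * norm (x - y)" .
  moreover have "T s x - T s y = (x - y) + s *\<^sub>R (G x - G y)" by (simp add: T_def algebra_simps)
  ultimately show ?thesis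
    using norm_triangle_ineq4[of "(x - y) + s *\<^sub>R (G x - G y)" "s *\<^sub>R (G x - G y)"] by simp
qed

text \<open>Injectivity is the expansion bound; a preimage of \<open>y\<close> is the fixed point of
  the contraction sending \<open>x\<close> to \<open>y - s G x\<close>.\<close>

lemma T_bij: assumes "small s" shows "bij (T s)"
proof (rule bijI)
  show "inj (T s)"
    by (rule injI) (metis T_expand[OF assms] diff_self norm_le_zero_iff norm_zero mult_le_0_iff right_minus_eq zero_less_divide_iff zero_less_numeral not_le)
  show "surj (T s)"
  proof (rule surjI)
    fix y
    have "\<exists>!x. y - s *\<^sub>R G x = x"
    proof (rule banach_fix_type[of "1/8"])
      show "\<forall>x x'. dist (y - s *\<^sub>R G x) (y - s *\<^sub>R G x') \<le> 1 / 8 * dist x x'"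
      proof (intro allI)
        fix x x'
        have "dist (y - s *\<^sub>R G x) (y - s *\<^sub>R G x') = \<bar>s\<bar> * norm (G x - G x')"
          by (simp add: dist_norm norm_minus_commute scaleR_diff_right[symmetric])
        also have "\<dots> \<le> \<bar>s\<bar> * (L * norm (x - x'))" by (intro mult_left_mono G_lip) auto
        also have "\<dots> \<le> 1 / 8 * norm (x - x')"
          using assms unfolding small_def mult.assoc[symmetric] by (intro mult_right_mono) auto
        finally show "dist (y - s *\<^sub>R G x) (y - s *\<^sub>R G x') \<le> 1 / 8 * dist x x'" by (simp add: dist_norm)
      qed
    qed auto
    then have "y - s *\<^sub>R G (THE x. y - s *\<^sub>R G x = x) = (THE x. y - s *\<^sub>R G x = x)" by (rule theI')
    then show "T s (THE x. y - s *\<^sub>R G x = x) = y" unfolding T_def by (simp add: algebra_simps)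
  qed
qed

section \<open>The inverse map \<open>X\<close>: regularity in space and time\<close>

lemma X_T[simp]: "small s \<Longrightarrow> X s (T s x) = x"
  using T_bij by (simp add: X_def bij_is_inj)

lemma T_X[simp]: "small s \<Longrightarrow> T s (X s y) = y"
  using T_bij by (simp add: X_def bij_is_surj surj_f_inv_f)

lemma X_lip: "small s \<Longrightarrow> norm (X s y - X s y') \<le> 8 / 7 * norm (y - y')"
  using T_expand[of s "X s y" "X s y'"] by simp

text \<open>A resolvent identity: a change of time from \<open>r\<close> to \<open>s\<close> is
  traded for a shift of the argument. It reduces every statement about the time dependence of
  \<open>X\<close> to its Lipschitz bound or derivative in space at one fixed time.\<close>

lemma X_pert: assumes "small s" "small r"
  shows "X r y' = X s (y' + (s - r) *\<^sub>R G (X r y'))"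
proof -
  have "T s (X r y') = T r (X r y') + (s - r) *\<^sub>R G (X r y')" by (simp add: T_def algebra_simps)
  then have "T s (X r y') = y' + (s - r) *\<^sub>R G (X r y')" using assms by simp
  then show ?thesis by (metis X_T assms(1))
qed

lemma X_growth: "small s \<Longrightarrow> norm (X s y) \<le> 8 / 7 * (norm y + \<bar>s\<bar> * norm (G 0))"
proof -
  assume s: "small s"
  have "norm (X s y - X s (T s 0)) \<le> 8 / 7 * norm (y - T s 0)" by (rule X_lip[OF s])
  also have "\<dots> \<le> 8 / 7 * (norm y + norm (T s 0))" by (intro mult_left_mono norm_triangle_ineq4) auto
  finally show ?thesis unfolding X_T[OF s] by (simp add: T_def)
qed

lemma X_cont: "small s \<Longrightarrow> continuous_on S (X s)"
proof (rule lipschitz_on_continuous_on)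
  assume "small s"
  then show "(8 / 7)-lipschitz_on S (X s)" by (intro lipschitz_onI) (unfold dist_norm, rule X_lip, auto)
qed

lemma X_meas[measurable]: "small s \<Longrightarrow> X s \<in> borel_measurable borel"
  by (intro borel_measurable_continuous_onI X_cont)

lemma X_deriv: assumes "small s"
  shows "(X s has_derivative (\<lambda>h. matrix_inv (Bm s (X s y)) *v h)) (at y)"
proof (rule has_derivative_inverse_basic[where f="T s" and T=UNIV])
  show "(T s has_derivative (\<lambda>h. Bm s (X s y) *v h)) (at (X s y))" by (rule T_deriv)
  show "(\<lambda>h. matrix_inv (Bm s (X s y)) *v h) \<circ> (\<lambda>h. Bm s (X s y) *v h) = id"
    using near_id_inverse_vec[OF Bm_near[OF assms]] by (auto simp: fun_eq_iff)
  show "continuous (at y) (X s)" using X_cont[OF assms, of UNIV] by (simp add: continuous_on_eq_continuous_at)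
qed (use assms in auto)

lemma X_curve_tendsto:
  assumes S: "\<And>r. r \<in> S \<Longrightarrow> small r" "r \<in> S" and y: "(y \<longlongrightarrow> y r) (at r within S)"
  shows "((\<lambda>r'. X r' (y r')) \<longlongrightarrow> X r (y r)) (at r within S)"
proof (rule Lim_null_comparison[THEN LIM_zero_cancel])
  let ?x = "X r (y r)"
  have "((\<lambda>r'. 8 / 7 * norm (y r' - y r - (r' - r) *\<^sub>R G ?x)) \<longlongrightarrow> 8 / 7 * norm (y r - y r - (r - r) *\<^sub>R G ?x)) (at r within S)"
    by (intro tendsto_intros y)
  then show "((\<lambda>r'. 8 / 7 * norm (y r' - y r - (r' - r) *\<^sub>R G ?x)) \<longlongrightarrow> 0) (at r within S)" by simp
  show "\<forall>\<^sub>F r' in at r within S. norm (X r' (y r') - ?x) \<le> 8 / 7 * norm (y r' - y r - (r' - r) *\<^sub>R G ?x)"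
    unfolding eventually_at_filter
  proof (rule always_eventually, intro allI impI)
    fix r' assume "r' \<in> S"
    then have s: "small r'" using S by simp
    show "norm (X r' (y r') - ?x) \<le> 8 / 7 * norm (y r' - y r - (r' - r) *\<^sub>R G ?x)"
      using X_lip[OF s, of "y r'" "y r + (r' - r) *\<^sub>R G ?x"]
      by (subst X_pert[OF s S(1)[OF S(2)]]) (simp add: algebra_simps)
  qed
qed

text \<open>By \<open>X_pert\<close> the curve equals \<open>X r (\<eta> r')\<close> with the time
  \<open>r\<close> fixed, so the chain rule needs only the spatial derivative of \<open>X r\<close>
  and the derivative of \<open>\<eta>\<close> at \<open>r\<close>.\<close>

lemma X_curve_deriv:
  assumes U: "open U" "r \<in> U" "\<And>r. r \<in> U \<Longrightarrow> small r"
    and y: "(y has_vector_derivative y') (at r)"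
  shows "((\<lambda>r. X r (y r)) has_vector_derivative matrix_inv (Bm r (X r (y r))) *v (y' - G (X r (y r)))) (at r)"
proof -
  let ?x = "X r (y r)"
  have sr: "small r" using U by simp
  have "(y \<longlongrightarrow> y r) (at r within U)"
    using has_vector_derivative_continuous[OF y] by (simp add: isCont_def at_within_open[OF U(2,1)])
  from X_curve_tendsto[of U, OF U(3,2) this]
  have ct: "((\<lambda>r'. X r' (y r')) \<longlongrightarrow> ?x) (at r)" by (simp add: at_within_open[OF U(2,1)])
  define \<eta> where "\<eta> r' = y r' - (r' - r) *\<^sub>R G (X r' (y r'))" for r'
  have \<eta>: "(\<eta> has_vector_derivative (y' - G ?x)) (at r)"
  proof -
    \<comment> \<open>A function \<open>(r' - r) g(r')\<close> is differentiable at \<open>r\<close>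
      with derivative \<open>g(r)\<close> as soon as \<open>g\<close> is continuous there; the
      continuity is \<open>ct\<close>.\<close>
    have "((\<lambda>r'. (r' - r) *\<^sub>R G (X r' (y r'))) has_vector_derivative G ?x) (at r)"
    proof -
      have "((\<lambda>r'. G (X r' (y r'))) \<longlongrightarrow> G ?x) (at r)"
        using has_derivative_continuous[OF G_deriv[of ?x]] ct by (rule isCont_tendsto_compose)
      then have "((\<lambda>r'. G (X r' (y r')) - G ?x) \<longlongrightarrow> 0) (at r)" by (rule LIM_zero)
      then have lim0: "((\<lambda>r'. norm (G (X r' (y r')) - G ?x)) \<longlongrightarrow> 0) (at r)" by (rule tendsto_norm_zero)
      have eq0: "norm ((r' - r) *\<^sub>R G (X r' (y r')) - (r - r) *\<^sub>R G ?x - (r' - r) *\<^sub>R G ?x) / norm (r' - r)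
          = norm (G (X r' (y r')) - G ?x)" if "r' \<noteq> r" for r'
        using that by (simp add: scaleR_diff_right[symmetric])
      have "((\<lambda>r'. norm ((r' - r) *\<^sub>R G (X r' (y r')) - (r - r) *\<^sub>R G ?x - (r' - r) *\<^sub>R G ?x) / norm (r' - r)) \<longlongrightarrow> 0) (at r)"
        by (rule Lim_transform_eventually[OF lim0], unfold eventually_at_filter)
           (rule always_eventually, use eq0 in metis)
      then show ?thesis
        unfolding has_vector_derivative_def has_derivative_iff_norm
        by (auto simp: norm_divide bounded_linear_scaleR_left)
    qed
    from has_vector_derivative_diff[OF y this] show ?thesis by (simp add: \<eta>_def[abs_def])
  qed
  have e: "\<eta> r = y r" by (simp add: \<eta>_def)
  have "((\<lambda>r'. X r (\<eta> r')) has_vector_derivative matrix_inv (Bm r ?x) *v (y' - G ?x)) (at r)"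
    using has_derivative_compose[OF \<eta>[unfolded has_vector_derivative_def] X_deriv[OF sr, of "\<eta> r"]]
    unfolding has_vector_derivative_def e by (simp add: matrix_vector_mult_scaleR)
  moreover have "X r (\<eta> r') = X r' (y r')" if "r' \<in> U" for r'
    using X_pert[OF sr U(3)[OF that], of "y r'"] by (simp add: \<eta>_def algebra_simps)
  ultimately show ?thesis
    by (rule has_vector_derivative_transform_within_open[OF _ U(1,2)]) auto
qed

section \<open>The Jacobian determinant \<open>D\<close> and its logarithmic gradient\<close>

lemma D_pos: "small s \<Longrightarrow> D s x > 0"
  unfolding D_def by (intro near_id_jac_pos Bm_near)

lemma D_nz: "small s \<Longrightarrow> D s x \<noteq> 0"
  using D_pos[of s x] by simp

lemma D_upper: assumes "small s" shows "D s x \<le> (9/8) ^ CARD('n)"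
  using jac_bound[of "Bm s x" "9/8"] near_id_bounds(1)[OF Bm_near[OF assms]] by (force simp: D_def)

text \<open>Kept sharp in \<open>s\<close>, as the derivative at 0 of \<open>n ln (1 - s L)\<close>
  supplies the term \<open>n L\<close> in \<open>integration_by_parts\<close>.\<close>

lemma D_lower: assumes "small s" shows "(1 - \<bar>s\<bar> * L) ^ CARD('n) \<le> D s x"
  unfolding D_def
proof (rule jac_lower_bound[OF Bm_near[OF assms]])
  show "0 < 1 - \<bar>s\<bar> * L" using assms by (simp add: small_def)
  show "(1 - \<bar>s\<bar> * L) * norm h \<le> norm (Bm s x *v h)" for h
    using sA_bound[of s x h] norm_triangle_ineq4[of "Bm s x *v h" "s *\<^sub>R (A x *v h)"]
    by (simp add: Bm_vec algebra_simps)
qed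

lemma lnD_bound: assumes "small s" shows "\<bar>ln (D s x)\<bar> \<le> 8 / 7 * real CARD('n) * (\<bar>s\<bar> * L)"
proof -
  have "near_id (mat 1 :: real^'n^'n)" by (simp add: near_id_def)
  then have "\<bar>ln (jac (Bm s x)) - ln (jac (mat 1 :: real^'n^'n))\<bar> \<le> 8 / 7 * real CARD('n) * (\<bar>s\<bar> * L)"
    using assms sA_bound[of s x] L_nonneg
    by (intro ln_jac_lipschitz Bm_near) (auto simp: matrix_vector_mult_diff_rdistrib Bm_vec)
  then show ?thesis by (simp add: D_def)
qed

lemma lnD_lip: assumes "small s" shows "\<bar>ln (D s x) - ln (D s y)\<bar> \<le> 8 / 7 * real CARD('n) * \<bar>s\<bar> * M * norm (x - y)"
proof -
  have "\<bar>ln (D s x) - ln (D s y)\<bar> \<le> 8 / 7 * real CARD('n) * (\<bar>s\<bar> * (M * dist x y))"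
    unfolding D_def
  proof (rule ln_jac_lipschitz[OF Bm_near Bm_near])
    fix h
    have "(Bm s x - Bm s y) *v h = s *\<^sub>R ((A x - A y) *v h)"
      by (simp add: matrix_vector_mult_diff_rdistrib Bm_vec scaleR_diff_right)
    then have "norm ((Bm s x - Bm s y) *v h) \<le> \<bar>s\<bar> * (M * dist x y * norm h)"
      by (simp add: mult_left_mono A_lip)
    then show "norm ((Bm s x - Bm s y) *v h) \<le> \<bar>s\<bar> * (M * dist x y) * norm h" by (simp add: mult.assoc)
  qed (use assms M_nonneg in auto)
  then show ?thesis by (simp add: dist_norm mult.assoc)
qed

text \<open>The gradient of \<open>ln (D s x)\<close>, assembled from its directional derivatives.
  It contains the derivative of the Hessian, of which no continuity in \<open>x\<close> is
  known.\<close>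

definition "lam s x = (\<Sum>b\<in>Basis. (djac (Bm s x) (s *\<^sub>R frechet_derivative A (at x) b) / D s x) *\<^sub>R b)"

lemma lnD_deriv: assumes "small s" shows "((\<lambda>x. ln (D s x)) has_derivative (\<lambda>h. lam s x \<bullet> h)) (at x)"
proof -
  have "((\<lambda>x. Bm s x) has_derivative (\<lambda>h. s *\<^sub>R frechet_derivative A (at x) h)) (at x)"
    unfolding Bm_def by (auto intro!: derivative_eq_intros A_deriv)
  from has_derivative_jac[OF this]
  have "((\<lambda>x. D s x) has_derivative (\<lambda>h. djac (Bm s x) (s *\<^sub>R frechet_derivative A (at x) h))) (at x)"
    by (simp add: D_def)
  from has_derivative_ln[OF D_pos[OF assms] this]
  have *: "((\<lambda>x. ln (D s x)) has_derivative (\<lambda>h. djac (Bm s x) (s *\<^sub>R frechet_derivative A (at x) h) / D s x)) (at x)"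
    by (simp add: field_simps)
  have eq: "(\<lambda>h. djac (Bm s x) (s *\<^sub>R frechet_derivative A (at x) h) / D s x) = (\<lambda>h. lam s x \<bullet> h)"
    unfolding lam_def by (rule ext) (rule bounded_linear_functional_inner[OF has_derivative_bounded_linear[OF *]])
  show ?thesis using * unfolding eq .
qed

text \<open>Read off from the Lipschitz bound \<open>lnD_lip\<close> rather than from the formula;
  one factor \<open>n\<close> comes from the determinant and one factor \<open>s\<close> from the
  perturbation of the identity.\<close>

lemma lam_bound: assumes "small s" shows "norm (lam s x) \<le> 8 / 7 * real CARD('n) * \<bar>s\<bar> * M"
  by (rule gradient_norm_le_lipschitz[OF lnD_deriv[OF assms]]) (use lnD_lip[OF assms] in auto)

lemma Bm_cont[continuous_intros]: "continuous_on S g \<Longrightarrow> continuous_on S h \<Longrightarrow> continuous_on S (\<lambda>s. Bm (g s) (h s))"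
  unfolding Bm_def by (intro continuous_intros)

lemma D_cont[continuous_intros]: "continuous_on S g \<Longrightarrow> continuous_on S h \<Longrightarrow> continuous_on S (\<lambda>s. D (g s) (h s))"
  unfolding D_def by (intro continuous_intros)

lemma T_cont[continuous_intros]: "continuous_on S g \<Longrightarrow> continuous_on S h \<Longrightarrow> continuous_on S (\<lambda>s. T (g s) (h s))"
  unfolding T_def by (intro continuous_intros)

lemma D_meas[measurable]: "D s \<in> borel_measurable borel"
  by (intro borel_measurable_continuous_onI continuous_intros)

lemma lam_cont: "(\<And>s. s \<in> S \<Longrightarrow> small s) \<Longrightarrow> continuous_on S (\<lambda>s. lam s x)"
  unfolding lam_def by (intro continuous_intros) (auto simp: D_nz)

section \<open>Pushforward of densities under \<open>X\<close>\<close>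

lemma nn_integral_pushforward:
  assumes s: "small s" and p[measurable]: "p \<in> borel_measurable borel" and p0: "\<And>x. 0 \<le> p x"
    and fin: "integrable lborel p"
  shows "(\<integral>\<^sup>+x. ennreal (p (T s x) * D s x) \<partial>lborel) = (\<integral>\<^sup>+y. ennreal (p y) \<partial>lborel)"
  using change_of_variables[OF T_deriv T_bij[OF s] p _ p0 fin] D_pos[OF s] D_meas[of s]
  by (simp add: D_def[symmetric] abs_of_pos)

lemma distr_X:
  assumes s: "small s" and p[measurable]: "p \<in> borel_measurable borel" and p0: "\<And>x. 0 \<le> p x"
    and fin: "integrable lborel p"
  shows "distr (density lborel (\<lambda>y. ennreal (p y))) borel (X s) = density lborel (\<lambda>x. ennreal (p (T s x) * D s x))"
proof (rule measure_eqI)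
  note [measurable] = X_meas[OF s]
  fix S assume "S \<in> sets (distr (density lborel (\<lambda>y. ennreal (p y))) borel (X s))"
  then have S[measurable]: "S \<in> sets borel" by simp
  have pre: "X s -` S \<in> sets borel" using measurable_sets[OF X_meas[OF s] S] by simp
  let ?q = "\<lambda>y. p y * indicator S (X s y)"
  have q: "integrable lborel ?q"
    by (rule Bochner_Integration.integrable_bound[OF fin]) (use p0 in \<open>auto simp: abs_mult indicator_def\<close>)
  have "emeasure (distr (density lborel (\<lambda>y. ennreal (p y))) borel (X s)) S = (\<integral>\<^sup>+y. ennreal (p y) * indicator (X s -` S) y \<partial>lborel)"
    by (subst emeasure_distr) (auto simp: emeasure_density pre)
  also have "\<dots> = (\<integral>\<^sup>+y. ennreal (?q y) \<partial>lborel)"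
    by (intro nn_integral_cong) (auto simp: indicator_def)
  also have "\<dots> = (\<integral>\<^sup>+x. ennreal (?q (T s x) * D s x) \<partial>lborel)"
    by (rule nn_integral_pushforward[symmetric, OF s _ _ q]) (use p0 in \<open>auto simp: indicator_def\<close>)
  also have "\<dots> = (\<integral>\<^sup>+x. ennreal (p (T s x) * D s x) * indicator S x \<partial>lborel)"
    using s by (intro nn_integral_cong) (auto simp: indicator_def)
  also have "\<dots> = emeasure (density lborel (\<lambda>x. ennreal (p (T s x) * D s x))) S"
    by (subst emeasure_density) auto
  finally show "emeasure (distr (density lborel (\<lambda>y. ennreal (p y))) borel (X s)) S =
    emeasure (density lborel (\<lambda>x. ennreal (p (T s x) * D s x))) S" .
qed simp

text \<open>The point \<open>x = X \<epsilon> y\<close> solves the first-order condition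
  \<open>y = x + \<epsilon> G x\<close>; the quadratic penalty dominates the possible nonconvexity
  of \<open>f\<close>, so this critical point is the unique minimiser and the choice in
  \<open>prox\<close> returns it.\<close>

lemma prox_eq_X:
  assumes e: "\<epsilon> > 0" "8 * L * \<epsilon> \<le> 1"
  shows "prox \<epsilon> f y = X \<epsilon> y"
proof -
  have s: "small \<epsilon>" using e by (simp add: small_def mult_ac)
  define x where "x = X \<epsilon> y"
  have Tx: "y = x + \<epsilon> *\<^sub>R G x" using T_X[OF s, of y] by (simp add: T_def x_def)
  \<comment> \<open>The mean value inequality on a ball gives the constant \<open>L\<close> in place
    of the sharp \<open>L / 2\<close>; the step size condition still makes
    \<open>1 / (2 \<epsilon>) - L\<close> positive.\<close>
  have desc: "f x' \<ge> f x + G x \<bullet> (x' - x) - L * norm (x' - x) ^ 2" for x'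
  proof -
    have "norm ((f x' - G x \<bullet> x') - (f x - G x \<bullet> x)) \<le> (L * norm (x' - x)) * norm (x' - x)"
    proof (rule differentiable_bound[of "cball x (norm (x' - x))"])
      fix u assume u: "u \<in> cball x (norm (x' - x))"
      show "((\<lambda>u. f u - G x \<bullet> u) has_derivative (\<lambda>h. (G u - G x) \<bullet> h)) (at u within cball x (norm (x' - x)))"
        unfolding inner_diff_left
        by (intro has_derivative_diff has_derivative_at_withinI[OF f_deriv]
            bounded_linear_imp_has_derivative bounded_linear_inner_right)
      show "onorm (\<lambda>h. (G u - G x) \<bullet> h) \<le> L * norm (x' - x)"
      proof (rule onorm_le)
        fix h
        have "norm ((G u - G x) \<bullet> h) \<le> norm (G u - G x) * norm h" by (simp add: Cauchy_Schwarz_ineq2)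
        also have "\<dots> \<le> (L * norm (u - x)) * norm h" by (intro mult_right_mono G_lip) auto
        also have "\<dots> \<le> (L * norm (x' - x)) * norm h"
          using u L_nonneg by (intro mult_right_mono mult_left_mono) (auto simp: dist_norm norm_minus_commute)
        finally show "norm ((G u - G x) \<bullet> h) \<le> L * norm (x' - x) * norm h" .
      qed
    qed (auto simp: dist_norm norm_minus_commute)
    then have "\<bar>f x' - f x - G x \<bullet> (x' - x)\<bar> \<le> L * norm (x' - x) ^ 2"
      by (simp add: inner_diff_right power2_eq_square algebra_simps)
    then show ?thesis by linarith
  qed
  have key: "f x' + (norm (x' - y))\<^sup>2 / (2 * \<epsilon>) \<ge> f x + (norm (x - y))\<^sup>2 / (2 * \<epsilon>) + (1 / (2 * \<epsilon>) - L) * norm (x' - x) ^ 2" for x'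
  proof -
    have xy: "x - y = - (\<epsilon> *\<^sub>R G x)" and x'y: "x' - y = (x' - x) - \<epsilon> *\<^sub>R G x"
      using Tx by (auto simp: algebra_simps)
    have "(norm (x' - y))\<^sup>2 = norm (x' - x) ^ 2 - 2 * \<epsilon> * (G x \<bullet> (x' - x)) + (norm (x - y))\<^sup>2"
      unfolding xy x'y power2_norm_eq_inner by (simp add: inner_diff_left inner_diff_right inner_commute algebra_simps)
    then have "(norm (x' - y))\<^sup>2 / (2 * \<epsilon>) = norm (x' - x) ^ 2 / (2 * \<epsilon>) - (G x \<bullet> (x' - x)) + (norm (x - y))\<^sup>2 / (2 * \<epsilon>)"
      using e(1) by (simp add: field_simps)
    then show ?thesis using desc[of x'] by (simp add: algebra_simps)
  qed
  have pos: "1 / (2 * \<epsilon>) - L > 0" using e by (simp add: field_simps)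
  show ?thesis
    unfolding prox_def x_def[symmetric]
  proof (rule some_equality)
    show "\<forall>x'. f x + (norm (x - y))\<^sup>2 / (2 * \<epsilon>) \<le> f x' + (norm (x' - y))\<^sup>2 / (2 * \<epsilon>)"
    proof
      fix x'
      have "0 \<le> (1 / (2 * \<epsilon>) - L) * norm (x' - x) ^ 2" using pos by (intro mult_nonneg_nonneg) auto
      then show "f x + (norm (x - y))\<^sup>2 / (2 * \<epsilon>) \<le> f x' + (norm (x' - y))\<^sup>2 / (2 * \<epsilon>)"
        using key[of x'] by linarith
    qed
    fix u assume "\<forall>x'. f u + (norm (u - y))\<^sup>2 / (2 * \<epsilon>) \<le> f x' + (norm (x' - y))\<^sup>2 / (2 * \<epsilon>)"
    then have "f u + (norm (u - y))\<^sup>2 / (2 * \<epsilon>) \<le> f x + (norm (x - y))\<^sup>2 / (2 * \<epsilon>)" by blast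
    then have "(1 / (2 * \<epsilon>) - L) * norm (u - x) ^ 2 \<le> 0" using key[of u] by linarith
    then have "norm (u - x) ^ 2 \<le> 0" using pos by (simp add: mult_le_0_iff not_le)
    then show "u = x" by simp
  qed
qed

end

section \<open>The heat flow of a probability measure\<close>

definition ggauss :: "real \<Rightarrow> real^'n \<Rightarrow> real^'n" where
  "ggauss t u = (- (gauss t u / (2 * t))) *\<^sub>R u"

lemma gauss_deriv: "t > 0 \<Longrightarrow> (gauss t has_derivative (\<lambda>h. ggauss t u \<bullet> h)) (at (u::real^'n))"
proof -
  assume t: "t > 0"
  have "((\<lambda>u. (4 * pi * t) powr (- real CARD('n) / 2) * exp (- (u \<bullet> u) / (4 * t))) has_derivative
    (\<lambda>h. (4 * pi * t) powr (- real CARD('n) / 2) * (exp (- (u \<bullet> u) / (4 * t)) * (- (2 * (u \<bullet> h)) / (4 * t))))) (at u)" for u :: "real^'n"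
    using t by (auto intro!: derivative_eq_intros simp: inner_commute field_simps)
  then show ?thesis
    by (simp add: ggauss_def gauss_def[abs_def] power2_norm_eq_inner field_simps)
qed

lemma gauss_cont[continuous_intros]:
  assumes "continuous_on S g" "continuous_on S h" "\<And>x. x \<in> S \<Longrightarrow> g x > 0"
  shows "continuous_on S (\<lambda>x. gauss (g x) (h x))"
proof -
  have "4 * pi * g x \<noteq> 0" if "x \<in> S" for x using assms(3)[OF that] by simp
  moreover have "4 * g x \<noteq> 0" if "x \<in> S" for x using assms(3)[OF that] by simp
  ultimately show ?thesis
    unfolding gauss_def using assms by (intro continuous_intros) auto
qed

lemma ggauss_cont[continuous_intros]:
  assumes "continuous_on S g" "continuous_on S h" "\<And>x. x \<in> S \<Longrightarrow> g x > 0"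
  shows "continuous_on S (\<lambda>x. ggauss (g x) (h x))"
proof -
  have "2 * g x \<noteq> 0" if "x \<in> S" for x using assms(3)[OF that] by simp
  then show ?thesis unfolding ggauss_def using assms by (intro continuous_intros) auto
qed

lemma gauss_le:
  assumes "a > 0" "t \<ge> a" shows "gauss t (u::real^'n) \<le> (4 * pi * a) powr (- real CARD('n) / 2)"
proof -
  have "gauss t u \<le> (4 * pi * t) powr (- real CARD('n) / 2)"
    unfolding gauss_def using assms by (intro mult_left_le) auto
  also have "\<dots> \<le> (4 * pi * a) powr (- real CARD('n) / 2)"
    using assms by (intro powr_mono2') auto
  finally show ?thesis .
qed

text \<open>With \<open>v = |u|^2 / (4 t)\<close> one has \<open>|u| <= 1 + 4 t v\<close>, and the
  kernel supplies \<open>exp (- v)\<close>. The bound is uniform in \<open>u\<close> and in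
  \<open>t >= a\<close>, as domination requires.\<close>

lemma ggauss_le:
  assumes "a > 0" "t \<ge> a"
  shows "norm (ggauss t (u::real^'n)) \<le> (4 * pi * a) powr (- real CARD('n) / 2) * (1 / (2 * a) + 2)"
proof -
  let ?v = "(norm u)\<^sup>2 / (4 * t)"
  have t: "t > 0" using assms by simp
  have "2 * norm u \<le> 1 + (norm u)\<^sup>2" using zero_le_power2[of "norm u - 1"] by (simp add: power2_diff)
  then have "norm u \<le> 1 + (norm u)\<^sup>2" using norm_ge_zero[of u] by linarith
  also have "\<dots> = 1 + 4 * t * ?v" using t by simp
  also have "\<dots> \<le> (1 + 4 * t) * exp ?v"
  proof -
    have "1 \<le> exp ?v" using t by simp
    moreover have "?v \<le> exp ?v" using exp_ge_add_one_self[of ?v] by linarith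
    then have "4 * t * ?v \<le> 4 * t * exp ?v" using t by (intro mult_left_mono) auto
    moreover have "(1 + 4 * t) * exp ?v = exp ?v + 4 * t * exp ?v" by (simp only: distrib_right mult_1_left)
    ultimately show ?thesis by (simp only: add_mono)
  qed
  finally have "norm u * exp (- ?v) \<le> 1 + 4 * t" by (simp add: exp_minus field_simps)
  then have "norm u * exp (- ?v) / (2 * t) \<le> (1 + 4 * t) / (2 * t)" using t by (intro divide_right_mono) auto
  also have "\<dots> = 1 / (2 * t) + 2" using t by (simp add: field_simps)
  also have "\<dots> \<le> 1 / (2 * a) + 2" using assms by (simp add: frac_le)
  finally have 1: "norm u * exp (- ?v) / (2 * t) \<le> 1 / (2 * a) + 2" .
  have "norm (ggauss t u) = (4 * pi * t) powr (- real CARD('n) / 2) * (norm u * exp (- ?v) / (2 * t))"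
    using t by (simp add: ggauss_def gauss_def)
  also have "\<dots> \<le> (4 * pi * a) powr (- real CARD('n) / 2) * (1 / (2 * a) + 2)"
    using assms t 1 by (intro mult_mono powr_mono2') auto
  finally show ?thesis .
qed

text \<open>Stated for an arbitrary law \<open>\<mu>\<close> because it serves twice: for the law at
  the start of a step, and in \<open>lsi_rho\<close> for the mollification of
  \<open>rho s\<close>.\<close>

locale heat = prob_space \<mu> for \<mu> :: "(real^'n) measure" +
  assumes sets_mu[measurable_cong, simp]: "sets \<mu> = sets borel"
begin

definition "p t y = (\<integral>x. gauss t (y - x) \<partial>\<mu>)"
definition "gp t y = (\<integral>x. ggauss t (y - x) \<partial>\<mu>)"

lemma space_mu[simp]: "space \<mu> = UNIV"
  using sets_eq_imp_space_eq[OF sets_mu] by simp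

lemma ggauss_meas[measurable]: "t > 0 \<Longrightarrow> ggauss t \<in> borel_measurable borel"
  by (intro borel_measurable_continuous_onI continuous_intros)

lemma int_gauss[simp]: "t > 0 \<Longrightarrow> integrable \<mu> (\<lambda>x. gauss t (y - x))"
  using gauss_le[of t t]
  by (intro integrable_const_bound[where B="(4 * pi * t) powr (- real CARD('n) / 2)"]) auto

lemma int_ggauss[simp]: "t > 0 \<Longrightarrow> integrable \<mu> (\<lambda>x. ggauss t (y - x))"
  using ggauss_le[of t t]
  by (intro integrable_const_bound[where B="(4 * pi * t) powr (- real CARD('n) / 2) * (1 / (2 * t) + 2)"]) auto

lemma p_pos: assumes t: "t > 0" shows "p t y > 0"
proof -
  have "p t y \<noteq> 0"
  proof
    assume "p t y = 0"
    then have "AE x in \<mu>. gauss t (y - x) = 0"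
      unfolding p_def using t by (subst (asm) integral_nonneg_eq_0_iff_AE) auto
    then have "AE x in \<mu>. False" by eventually_elim (use gauss_pos[OF t] in \<open>metis less_irrefl\<close>)
    then show False by simp
  qed
  moreover have "p t y \<ge> 0" unfolding p_def by simp
  ultimately show ?thesis by simp
qed

lemma p_nonneg[simp]: "p t y \<ge> 0" unfolding p_def by simp

lemma p_deriv: assumes t: "t > 0" shows "(p t has_derivative (\<lambda>h. gp t y \<bullet> h)) (at y)"
  unfolding p_def[abs_def] gp_def
proof (rule has_derivative_integral_dominated[of UNIV])
  show "AE w in \<mu>. \<forall>x\<in>UNIV. ((\<lambda>x. gauss t (x - w)) has_derivative (\<lambda>h. ggauss t (x - w) \<bullet> h)) (at x) \<and>
      norm (ggauss t (x - w)) \<le> (4 * pi * t) powr (- real CARD('n) / 2) * (1 / (2 * t) + 2)"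
  proof (intro AE_I2 ballI conjI)
    fix w x :: "real^'n"
    show "((\<lambda>x. gauss t (x - w)) has_derivative (\<lambda>h. ggauss t (x - w) \<bullet> h)) (at x)"
      by (rule has_derivative_compose[OF _ gauss_deriv[OF t], where f="\<lambda>x. x - w" and f'="\<lambda>h. h"])
         (auto intro!: derivative_eq_intros)
    show "norm (ggauss t (x - w)) \<le> (4 * pi * t) powr (- real CARD('n) / 2) * (1 / (2 * t) + 2)"
      using t by (intro ggauss_le) auto
  qed
qed (use t in auto)

lemma p_cont[continuous_intros]:
  fixes g :: "'b::metric_space \<Rightarrow> real"
  assumes g: "continuous_on S g" and h: "continuous_on S h" and a: "a > 0" "\<And>x. x \<in> S \<Longrightarrow> g x \<ge> a"
  shows "continuous_on S (\<lambda>x. p (g x) (h x))"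
  unfolding p_def
proof (rule continuous_on_integral_dominated[where g="\<lambda>_. (4 * pi * a) powr (- real CARD('n) / 2)"])
  have pos: "g x > 0" if "x \<in> S" for x using a(1) a(2)[OF that] by simp
  show "AE w in \<mu>. continuous_on S (\<lambda>x. gauss (g x) (h x - w))"
    by (intro AE_I2 continuous_intros g h pos)
  show "AE w in \<mu>. norm (gauss (g x) (h x - w)) \<le> (4 * pi * a) powr (- real CARD('n) / 2)" if "x \<in> S" for x
    using gauss_le[OF a(1) a(2)[OF that]] by auto
qed auto

lemma gp_cont[continuous_intros]:
  fixes g :: "'b::metric_space \<Rightarrow> real"
  assumes g: "continuous_on S g" and h: "continuous_on S h" and a: "a > 0" "\<And>x. x \<in> S \<Longrightarrow> g x \<ge> a"
  shows "continuous_on S (\<lambda>x. gp (g x) (h x))"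
  unfolding gp_def
proof (rule continuous_on_integral_dominated[where g="\<lambda>_. (4 * pi * a) powr (- real CARD('n) / 2) * (1 / (2 * a) + 2)"])
  have pos: "g x > 0" if "x \<in> S" for x using a(1) a(2)[OF that] by simp
  show "AE w in \<mu>. continuous_on S (\<lambda>x. ggauss (g x) (h x - w))"
    by (intro AE_I2 continuous_intros g h pos)
  show "AE w in \<mu>. norm (ggauss (g x) (h x - w)) \<le> (4 * pi * a) powr (- real CARD('n) / 2) * (1 / (2 * a) + 2)" if "x \<in> S" for x
    using ggauss_le[OF a(1) a(2)[OF that]] by auto
  show "(\<lambda>w. ggauss (g x) (h x - w)) \<in> borel_measurable \<mu>" if "x \<in> S" for x
    using pos[OF that] by measurable
qed auto

lemma p_meas[measurable]: "t > 0 \<Longrightarrow> p t \<in> borel_measurable borel"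
  by (rule borel_measurable_continuous_onI, rule p_cont[where a=t]) (auto intro: continuous_intros)

lemma gp_meas[measurable]: "t > 0 \<Longrightarrow> gp t \<in> borel_measurable borel"
  by (rule borel_measurable_continuous_onI, rule gp_cont[where a=t]) (auto intro: continuous_intros)

definition "score t y = gp t y /\<^sub>R p t y"

lemma lnp_deriv: assumes t: "t > 0" shows "((\<lambda>y. ln (p t y)) has_derivative (\<lambda>h. score t y \<bullet> h)) (at y)"
  using has_derivative_ln[OF p_pos[OF t] p_deriv[OF t]] by (simp add: score_def mult.commute)

lemma score_cont[continuous_intros]:
  fixes g :: "'b::metric_space \<Rightarrow> real"
  assumes g: "continuous_on S g" and h: "continuous_on S h" and a: "a > 0" "\<And>x. x \<in> S \<Longrightarrow> g x \<ge> a"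
  shows "continuous_on S (\<lambda>x. score (g x) (h x))"
proof -
  have "p (g x) (h x) \<noteq> 0" if "x \<in> S" for x using a(1) a(2)[OF that] p_pos[of "g x" "h x"] by simp
  then show ?thesis
    unfolding score_def
    by (intro continuous_on_scaleR continuous_on_inverse p_cont[OF assms] gp_cont[OF assms]) auto
qed

lemma score_meas[measurable]: "t > 0 \<Longrightarrow> score t \<in> borel_measurable borel"
  unfolding score_def[abs_def] by measurable

interpretation G: prob_space "std_gauss :: (real^'n) measure" by (rule prob_space_std_gauss)
interpretation PG: pair_prob_space \<mu> "std_gauss :: (real^'n) measure" ..
interpretation PL: pair_sigma_finite \<mu> "lborel :: (real^'n) measure" ..

abbreviation "P \<equiv> \<mu> \<Otimes>\<^sub>M (std_gauss :: (real^'n) measure)"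

lemma prob_space_P: "prob_space P"
  by (rule PG.P.prob_space_axioms)

lemma nn_integral_gauss_p: "t > 0 \<Longrightarrow> (\<integral>\<^sup>+x. ennreal (gauss t (y - x)) \<partial>\<mu>) = ennreal (p t y)"
  unfolding p_def by (rule nn_integral_eq_integral) auto

lemma nn_integral_Y:
  assumes t: "t > 0" and [measurable]: "h \<in> borel_measurable borel"
  shows "(\<integral>\<^sup>+w. h (fst w + sqrt (2 * t) *\<^sub>R snd w) \<partial>P) = (\<integral>\<^sup>+y. ennreal (p t y) * h y \<partial>lborel)"
proof -
  have "(\<integral>\<^sup>+w. h (fst w + sqrt (2 * t) *\<^sub>R snd w) \<partial>P) = (\<integral>\<^sup>+x. \<integral>\<^sup>+z. h (x + sqrt (2 * t) *\<^sub>R z) \<partial>std_gauss \<partial>\<mu>)"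
    by (subst G.nn_integral_fst[symmetric]) simp_all
  also have "\<dots> = (\<integral>\<^sup>+x. \<integral>\<^sup>+y. ennreal (gauss t (y - x)) * h y \<partial>lborel \<partial>\<mu>)"
    using t by (intro nn_integral_cong nn_integral_shift_gauss) auto
  also have "\<dots> = (\<integral>\<^sup>+y. \<integral>\<^sup>+x. ennreal (gauss t (y - x)) * h y \<partial>\<mu> \<partial>lborel)"
    by (rule PL.Fubini'[symmetric]) simp
  also have "\<dots> = (\<integral>\<^sup>+y. ennreal (p t y) * h y \<partial>lborel)"
    by (intro nn_integral_cong) (simp add: nn_integral_multc nn_integral_gauss_p[OF t])
  finally show ?thesis .
qed

lemma distr_Y:
  assumes t: "t > 0"
  shows "distr P borel (\<lambda>w. fst w + sqrt (2 * t) *\<^sub>R snd w) = density lborel (\<lambda>y. ennreal (p t y))"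
proof (rule measure_eqI)
  note [measurable] = p_meas[OF t]
  fix S assume "S \<in> sets (distr P borel (\<lambda>w. fst w + sqrt (2 * t) *\<^sub>R snd w))"
  then have [measurable]: "S \<in> sets borel" by simp
  have "emeasure (distr P borel (\<lambda>w. fst w + sqrt (2 * t) *\<^sub>R snd w)) S
     = (\<integral>\<^sup>+y. indicator S y \<partial>distr P borel (\<lambda>w. fst w + sqrt (2 * t) *\<^sub>R snd w))" by simp
  also have "\<dots> = (\<integral>\<^sup>+w. indicator S (fst w + sqrt (2 * t) *\<^sub>R snd w) \<partial>P)"
    by (rule nn_integral_distr) measurable
  also have "\<dots> = (\<integral>\<^sup>+y. ennreal (p t y) * indicator S y \<partial>lborel)"
    by (rule nn_integral_Y[OF t]) measurable
  also have "\<dots> = emeasure (density lborel (\<lambda>y. ennreal (p t y))) S"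
    by (subst emeasure_density) auto
  finally show "emeasure (distr P borel (\<lambda>w. fst w + sqrt (2 * t) *\<^sub>R snd w)) S =
    emeasure (density lborel (\<lambda>y. ennreal (p t y))) S" .
qed simp

lemma nn_integral_p: "t > 0 \<Longrightarrow> (\<integral>\<^sup>+y. ennreal (p t y) \<partial>lborel) = 1"
  using nn_integral_Y[of t "\<lambda>_. 1"] prob_space.emeasure_space_1[OF prob_space_P] by simp

lemma integrable_p: "t > 0 \<Longrightarrow> integrable lborel (p t)"
  by (rule integrableI_nonneg) (auto simp: nn_integral_p)

text \<open>Given the noisy point \<open>y\<close>, the noise \<open>z / sqrt (2 t)\<close> is
  \<open>(y - x) / (2 t)\<close>, and the kernel times this vector is minus the gradient of the
  kernel. Integrating over \<open>x\<close> leaves \<open>- gp t y\<close>: Tweedie's formula in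
  weak form.\<close>

lemma conditional_score:
  fixes h :: "real^'n \<Rightarrow> real^'n"
  assumes t: "t > 0" and h[measurable]: "h \<in> borel_measurable borel"
    and i: "integrable P (\<lambda>w. norm (h (fst w + sqrt (2 * t) *\<^sub>R snd w)) * norm (snd w))"
  shows "integrable lborel (\<lambda>y. h y \<bullet> gp t y)"
    and "(\<integral>w. h (fst w + sqrt (2 * t) *\<^sub>R snd w) \<bullet> (snd w /\<^sub>R sqrt (2 * t)) \<partial>P) = - (\<integral>y. h y \<bullet> gp t y \<partial>lborel)"
proof -
  note [measurable] = gp_meas[OF t] ggauss_meas[OF t]
  let ?\<phi> = "\<lambda>(x, y). h y \<bullet> ((y - x) /\<^sub>R (2 * t))"
  let ?\<tau> = "\<lambda>(x::real^'n, z). (x, x + sqrt (2 * t) *\<^sub>R z)"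
  have D: "distr P (borel \<Otimes>\<^sub>M borel) ?\<tau> = density (\<mu> \<Otimes>\<^sub>M lborel) (\<lambda>(x, y). ennreal (gauss t (y - x)))"
    by (rule distr_pair_shift_gauss[OF t prob_space_axioms sets_mu])
  have sc: "inverse (2 * t) * sqrt (2 * t) = inverse (sqrt (2 * t))"
    using t by (metis inverse_eq_divide real_div_sqrt divide_inverse less_imp_le mult.commute mult_pos_pos real_sqrt_divide sqrt_divide_self_eq zero_less_numeral)
  have eq: "?\<phi> (?\<tau> w) = h (fst w + sqrt (2 * t) *\<^sub>R snd w) \<bullet> (snd w /\<^sub>R sqrt (2 * t))" for w
    using sc by (simp add: case_prod_beta)
  have intY: "integrable P (\<lambda>w. h (fst w + sqrt (2 * t) *\<^sub>R snd w) \<bullet> (snd w /\<^sub>R sqrt (2 * t)))"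
  proof (rule Bochner_Integration.integrable_bound[OF integrable_mult_right[OF i, of "inverse (sqrt (2 * t))"]])
    show "AE w in P. norm (h (fst w + sqrt (2 * t) *\<^sub>R snd w) \<bullet> (snd w /\<^sub>R sqrt (2 * t))) \<le>
      norm (inverse (sqrt (2 * t)) * (norm (h (fst w + sqrt (2 * t) *\<^sub>R snd w)) * norm (snd w)))"
    proof (rule AE_I2)
      fix w :: "(real^'n) \<times> (real^'n)"
      have "norm (h (fst w + sqrt (2 * t) *\<^sub>R snd w) \<bullet> (snd w /\<^sub>R sqrt (2 * t)))
        \<le> norm (h (fst w + sqrt (2 * t) *\<^sub>R snd w)) * norm (snd w /\<^sub>R sqrt (2 * t))"
        by (simp only: real_norm_def Cauchy_Schwarz_ineq2)
      also have "\<dots> = norm (inverse (sqrt (2 * t)) * (norm (h (fst w + sqrt (2 * t) *\<^sub>R snd w)) * norm (snd w)))"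
        using t by (simp add: abs_mult)
      finally show "norm (h (fst w + sqrt (2 * t) *\<^sub>R snd w) \<bullet> (snd w /\<^sub>R sqrt (2 * t)))
        \<le> norm (inverse (sqrt (2 * t)) * (norm (h (fst w + sqrt (2 * t) *\<^sub>R snd w)) * norm (snd w)))" .
    qed
  qed measurable
  have De: "(\<lambda>(x, y). ennreal (gauss t (y - x))) = (\<lambda>w. ennreal (case w of (x, y) \<Rightarrow> gauss t (y - x)))"
    by (auto simp: fun_eq_iff)
  have i1: "integrable (distr P (borel \<Otimes>\<^sub>M borel) ?\<tau>) ?\<phi>"
    by (subst integrable_distr_eq) (use intY eq in auto)
  have gm: "(\<lambda>(x, y). gauss t (y - x)) \<in> borel_measurable (\<mu> \<Otimes>\<^sub>M lborel)" by measurable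
  have i2: "integrable (\<mu> \<Otimes>\<^sub>M lborel) (\<lambda>w. (case w of (x, y) \<Rightarrow> gauss t (y - x)) *\<^sub>R ?\<phi> w)"
  proof -
    have "integrable (density (\<mu> \<Otimes>\<^sub>M lborel) (\<lambda>w. ennreal (case w of (x, y) \<Rightarrow> gauss t (y - x)))) ?\<phi>"
      using i1 unfolding D De .
    then show ?thesis
      by (subst (asm) integrable_density) (auto simp: case_prod_beta)
  qed
  have e2: "gauss t (y - x) *\<^sub>R (h y \<bullet> ((y - x) /\<^sub>R (2 * t))) = - (h y \<bullet> ggauss t (y - x))" for x y
  proof -
    have "g * (inverse (2 * t) * c) = - (- (g / (2 * t)) * c)" for g c :: real
      using t by (simp add: field_simps)
    then show ?thesis by (simp only: ggauss_def inner_scaleR_right real_scaleR_def)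
  qed
  have inner: "(\<integral>x. gauss t (y - x) *\<^sub>R (h y \<bullet> ((y - x) /\<^sub>R (2 * t))) \<partial>\<mu>) = - (h y \<bullet> gp t y)" for y
    unfolding e2 gp_def using t by simp
  have i3: "integrable (lborel \<Otimes>\<^sub>M \<mu>) (\<lambda>(y, x). gauss t (y - x) *\<^sub>R (h y \<bullet> ((y - x) /\<^sub>R (2 * t))))"
    using PL.integrable_product_swap[OF i2] by (simp add: case_prod_beta)
  interpret LP: pair_sigma_finite "lborel :: (real^'n) measure" \<mu> ..
  have "integrable lborel (\<lambda>y. \<integral>x. gauss t (y - x) *\<^sub>R (h y \<bullet> ((y - x) /\<^sub>R (2 * t))) \<partial>\<mu>)"
    using LP.integrable_fst'[OF i3] by simp
  then show "integrable lborel (\<lambda>y. h y \<bullet> gp t y)" unfolding inner by simp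
  have "(\<integral>w. h (fst w + sqrt (2 * t) *\<^sub>R snd w) \<bullet> (snd w /\<^sub>R sqrt (2 * t)) \<partial>P) = (\<integral>w. ?\<phi> (?\<tau> w) \<partial>P)"
    by (simp only: eq)
  also have "\<dots> = (\<integral>w. ?\<phi> w \<partial>distr P (borel \<Otimes>\<^sub>M borel) ?\<tau>)"
    by (rule integral_distr[symmetric]) measurable
  also have "\<dots> = (\<integral>w. ?\<phi> w \<partial>density (\<mu> \<Otimes>\<^sub>M lborel) (\<lambda>w. ennreal (case w of (x, y) \<Rightarrow> gauss t (y - x))))"
    unfolding D De ..
  also have "\<dots> = (\<integral>w. (case w of (x, y) \<Rightarrow> gauss t (y - x)) *\<^sub>R ?\<phi> w \<partial>(\<mu> \<Otimes>\<^sub>M lborel))"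
    by (rule integral_density) (auto simp: case_prod_beta)
  also have "\<dots> = (\<integral>y. \<integral>x. gauss t (y - x) *\<^sub>R (h y \<bullet> ((y - x) /\<^sub>R (2 * t))) \<partial>\<mu> \<partial>lborel)"
  proof -
    define K where "K x y = gauss t (y - x) *\<^sub>R (h y \<bullet> ((y - x) /\<^sub>R (2 * t)))" for x y
    have eqK: "(\<lambda>w. (case w of (x, y) \<Rightarrow> gauss t (y - x)) *\<^sub>R ?\<phi> w) = (\<lambda>(x, y). K x y)"
      by (auto simp: K_def fun_eq_iff)
    show ?thesis
      unfolding eqK K_def[symmetric] by (rule PL.integral_snd[symmetric]) (use i2[unfolded eqK] in simp)
  qed
  also have "\<dots> = - (\<integral>y. h y \<bullet> gp t y \<partial>lborel)" unfolding inner by simp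
  finally show "(\<integral>w. h (fst w + sqrt (2 * t) *\<^sub>R snd w) \<bullet> (snd w /\<^sub>R sqrt (2 * t)) \<partial>P) = - (\<integral>y. h y \<bullet> gp t y \<partial>lborel)" .
qed

end

section \<open>Initial laws with bounded support: growth of the score and Gaussian decay\<close>

locale heat_compact = heat \<mu> for \<mu> :: "(real^'n) measure" +
  fixes R :: real
  assumes R0: "0 \<le> R" and supp: "AE x in \<mu>. norm x \<le> R"
begin

text \<open>The score is the average of \<open>(x - y) / (2 t)\<close> over the conditional law of
  the starting point given \<open>y\<close>, and that point has norm at most
  \<open>R\<close>.\<close>

lemma score_bound: assumes t: "t > 0" shows "norm (score t y) \<le> (norm y + R) / (2 * t)"
proof -
  have "norm (gp t y) \<le> (\<integral>x. (norm y + R) / (2 * t) * gauss t (y - x) \<partial>\<mu>)"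
    unfolding gp_def
  proof (rule order_trans[OF integral_norm_bound integral_mono_AE])
    show "integrable \<mu> (\<lambda>x. norm (ggauss t (y - x)))" "integrable \<mu> (\<lambda>x. (norm y + R) / (2 * t) * gauss t (y - x))"
      using t by auto
    have "AE x in \<mu>. norm (ggauss t (y - x)) \<le> (norm y + R) / (2 * t) * gauss t (y - x)"
      using supp
    proof eventually_elim
      case (elim x)
      have "norm (ggauss t (y - x)) = gauss t (y - x) / (2 * t) * norm (y - x)"
        using t by (simp add: ggauss_def)
      also have "\<dots> \<le> gauss t (y - x) / (2 * t) * (norm y + R)"
        using elim t norm_triangle_ineq4[of y x] by (intro mult_left_mono) auto
      finally show ?case by (simp add: mult.commute)
    qed
    then show "AE x in \<mu>. norm (ggauss t (y - x)) \<le> (norm y + R) / (2 * t) * gauss t (y - x)" .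
  qed
  also have "\<dots> = (norm y + R) / (2 * t) * p t y" by (simp add: p_def)
  finally have "norm (gp t y) \<le> (norm y + R) / (2 * t) * p t y" .
  moreover have "norm (score t y) = norm (gp t y) / p t y"
    using p_pos[OF t, of y] by (simp add: score_def divide_inverse_commute)
  ultimately show ?thesis using p_pos[OF t, of y] by (simp only: divide_le_eq if_True)
qed

text \<open>From \<open>|y|^2 <= 2 |y - x|^2 + 2 R^2\<close> on the support: half of the Gaussian
  exponent survives, whence \<open>8 b\<close> instead of \<open>4 b\<close>. The bound is uniform
  over times in \<open>[a, b]\<close>.\<close>

lemma p_upper:
  assumes a: "a > 0" "a \<le> t" "t \<le> b"
  shows "p t y \<le> (4 * pi * a) powr (- real CARD('n) / 2) * exp (R\<^sup>2 / (4 * a)) * exp (- (norm y)\<^sup>2 / (8 * b))"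
proof -
  let ?c = "(4 * pi * a) powr (- real CARD('n) / 2)"
  have t: "t > 0" using a by simp
  have "p t y \<le> (\<integral>x. ?c * exp (R\<^sup>2 / (4 * a)) * exp (- (norm y)\<^sup>2 / (8 * b)) \<partial>\<mu>)"
    unfolding p_def
  proof (rule integral_mono_AE)
    show "AE x in \<mu>. gauss t (y - x) \<le> ?c * exp (R\<^sup>2 / (4 * a)) * exp (- (norm y)\<^sup>2 / (8 * b))"
      using supp
    proof eventually_elim
      case (elim x)
      have "(norm y)\<^sup>2 \<le> (norm (y - x) + norm x)\<^sup>2" using norm_triangle_sub[of y x] by (intro power_mono) auto
      also have "\<dots> \<le> 2 * (norm (y - x))\<^sup>2 + 2 * (norm x)\<^sup>2"
        using zero_le_power2[of "norm (y - x) - norm x"] by (simp add: power2_sum power2_diff)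
      finally have "(norm y)\<^sup>2 - 2 * (norm x)\<^sup>2 \<le> 2 * (norm (y - x))\<^sup>2" by simp
      moreover have "(norm x)\<^sup>2 \<le> R\<^sup>2" using elim by (intro power_mono) auto
      ultimately have "(norm y)\<^sup>2 / 2 - R\<^sup>2 \<le> (norm (y - x))\<^sup>2" by simp
      then have "((norm y)\<^sup>2 / 2 - R\<^sup>2) / (4 * t) \<le> (norm (y - x))\<^sup>2 / (4 * t)" using t by (intro divide_right_mono) auto
      moreover have "(norm y)\<^sup>2 / (8 * b) \<le> (norm y)\<^sup>2 / (8 * t)" using a t by (intro divide_left_mono) auto
      moreover have "R\<^sup>2 / (4 * t) \<le> R\<^sup>2 / (4 * a)" using a t by (intro divide_left_mono) auto
      ultimately have "- (norm (y - x))\<^sup>2 / (4 * t) \<le> R\<^sup>2 / (4 * a) + - (norm y)\<^sup>2 / (8 * b)"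
        using t by (simp add: diff_divide_distrib)
      then have "exp (- (norm (y - x))\<^sup>2 / (4 * t)) \<le> exp (R\<^sup>2 / (4 * a)) * exp (- (norm y)\<^sup>2 / (8 * b))"
        by (simp only: exp_add[symmetric] exp_le_cancel_iff)
      moreover have "(4 * pi * t) powr (- real CARD('n) / 2) \<le> ?c" using a by (intro powr_mono2') auto
      ultimately show ?case unfolding gauss_def mult.assoc by (intro mult_mono) auto
    qed
  qed (use t in auto)
  also have "\<dots> = ?c * exp (R\<^sup>2 / (4 * a)) * exp (- (norm y)\<^sup>2 / (8 * b))" using prob_space by simp
  finally show ?thesis .
qed

end

section \<open>The interpolating flow\<close>

lemma continuous_on_transpose[continuous_intros]:
  fixes B :: "'a::topological_space \<Rightarrow> real^'n^'m"
  assumes "continuous_on S B" shows "continuous_on S (\<lambda>x. transpose (B x))"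
  unfolding transpose_def using assms by (intro continuous_on_vec_lambda continuous_intros) auto

lemma gradient_growth_imp_quadratic:
  fixes F :: "'a::euclidean_space \<Rightarrow> real"
  assumes d: "\<And>x. (F has_derivative (\<lambda>h. v x \<bullet> h)) (at x)" and g: "\<And>x. norm (v x) \<le> K * (1 + norm x)" and K: "K \<ge> 0"
  shows "\<bar>F x\<bar> \<le> (\<bar>F 0\<bar> + K) * (1 + norm x)\<^sup>2"
proof -
  have "norm (F x - F 0) \<le> (K * (1 + norm x)) * norm (x - 0)"
  proof (rule differentiable_bound[of "cball 0 (norm x)"])
    fix u :: 'a assume u: "u \<in> cball 0 (norm x)"
    show "(F has_derivative (\<lambda>h. v u \<bullet> h)) (at u within cball 0 (norm x))"
      by (rule has_derivative_at_withinI[OF d])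
    show "onorm (\<lambda>h. v u \<bullet> h) \<le> K * (1 + norm x)"
    proof (rule onorm_le)
      fix h :: 'a
      have "norm (v u \<bullet> h) \<le> norm (v u) * norm h" by (simp add: Cauchy_Schwarz_ineq2)
      also have "\<dots> \<le> (K * (1 + norm u)) * norm h" by (intro mult_right_mono g) auto
      also have "\<dots> \<le> (K * (1 + norm x)) * norm h" using u K by (intro mult_right_mono mult_left_mono) auto
      finally show "norm (v u \<bullet> h) \<le> K * (1 + norm x) * norm h" .
    qed
  qed auto
  then have "\<bar>F x\<bar> \<le> \<bar>F 0\<bar> + K * ((1 + norm x) * norm x)" by simp
  also have "\<dots> \<le> \<bar>F 0\<bar> * (1 + norm x)\<^sup>2 + K * (1 + norm x)\<^sup>2"
  proof (intro add_mono mult_left_mono K)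
    show "\<bar>F 0\<bar> \<le> \<bar>F 0\<bar> * (1 + norm x)\<^sup>2" 
      using mult_left_mono[OF one_le_power[of "1 + norm x" 2] abs_ge_zero[of "F 0"]] by simp
    show "(1 + norm x) * norm x \<le> (1 + norm x)\<^sup>2" by (simp add: power2_eq_square mult_left_mono)
  qed
  finally show ?thesis by (simp add: distrib_right)
qed

context LM
begin

lemma X_curve_cont:
  fixes y :: "real \<Rightarrow> real^'n"
  assumes "\<And>r. r \<in> S \<Longrightarrow> small r" and "continuous_on S y"
  shows "continuous_on S (\<lambda>r. X r (y r))"
  using assms unfolding continuous_on_def by (blast intro: X_curve_tendsto)

definition "Binv r x = matrix_inv (Bm r x)"

lemma Binv_bound: "small r \<Longrightarrow> norm (Binv r x *v h) \<le> 8 / 7 * norm h"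
  unfolding Binv_def by (intro near_id_inverse_bound Bm_near)

lemma Binv_T_bound: "small r \<Longrightarrow> norm (transpose (Binv r x) *v h) \<le> 8 / 7 * norm h"
  using Binv_bound by (intro transpose_bound) auto

lemma Binv_vec_meas: "small r \<Longrightarrow> (\<lambda>x. Binv r x *v b) \<in> borel_measurable borel"
  unfolding Binv_def
  by (intro borel_measurable_continuous_onI continuous_on_matrix_inv_vec continuous_intros Bm_near)

text \<open>Testing against a fixed vector moves the transpose over to \<open>Binv\<close>, which is
  continuous.\<close>

lemma Binv_T_meas:
  assumes r: "small r" and w[measurable]: "w \<in> borel_measurable borel"
  shows "(\<lambda>x. transpose (Binv r x) *v w x) \<in> borel_measurable borel"
proof (subst borel_measurable_euclidean_space, rule ballI)
  fix b :: "real^'n"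
  have "(transpose (Binv r x) *v w x) \<bullet> b = w x \<bullet> (Binv r x *v b)" for x
    by (simp only: inner_matrix_vec_transpose)
  then show "(\<lambda>x. (transpose (Binv r x) *v w x) \<bullet> b) \<in> borel_measurable borel"
    using Binv_vec_meas[OF r, of b] by simp
qed

end

locale flow = LM f L M + heat_compact \<mu> R
  for f :: "real^'n \<Rightarrow> real" and L M :: real and \<mu> :: "(real^'n) measure" and R :: real
begin

definition "rho s x = p s (T s x) * D s x"
definition "Psi s x = ln (p s (T s x)) + ln (D s x) + f x"
text \<open>The gradient of \<open>Psi s\<close>, the log-ratio of \<open>rho s\<close> to the
  target: chain rule through \<open>T s\<close>, log-determinant, and \<open>f\<close>. Only
  \<open>lam\<close> may be discontinuous in \<open>x\<close>.\<close>

definition "W s x = transpose (Bm s x) *v score s (T s x) + lam s x + G x"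
definition "Y s w = fst w + sqrt (2 * s) *\<^sub>R snd w" for w :: "(real^'n) \<times> (real^'n)"

lemma Y_meas[measurable]: "Y s \<in> borel_measurable (borel \<Otimes>\<^sub>M borel)"
  unfolding Y_def[abs_def] by measurable

lemma sets_P[measurable_cong]: "sets P = sets (borel \<Otimes>\<^sub>M borel)"
  by (intro sets_pair_measure_cong) auto

lemma rho_pos: "s > 0 \<Longrightarrow> small s \<Longrightarrow> rho s x > 0"
  unfolding rho_def by (simp add: p_pos D_pos)

lemma rho_eq_exp: "s > 0 \<Longrightarrow> small s \<Longrightarrow> rho s x = exp (Psi s x - f x)"
  by (simp add: rho_def Psi_def exp_add p_pos D_pos)

lemma rho_meas[measurable]: "s > 0 \<Longrightarrow> rho s \<in> borel_measurable borel"
  unfolding rho_def[abs_def] by measurable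

lemma Psi_deriv: assumes "s > 0" "small s" shows "(Psi s has_derivative (\<lambda>h. W s x \<bullet> h)) (at x)"
proof -
  have "((\<lambda>x. ln (p s (T s x))) has_derivative (\<lambda>h. score s (T s x) \<bullet> (Bm s x *v h))) (at x)"
    by (rule has_derivative_compose[OF T_deriv lnp_deriv[OF assms(1)]])
  from has_derivative_add[OF has_derivative_add[OF this lnD_deriv[OF assms(2)]] f_deriv]
  show ?thesis
    unfolding Psi_def[abs_def] W_def by (simp only: inner_matrix_vec_transpose inner_add_left)
qed

lemma Psi_meas[measurable]: "s > 0 \<Longrightarrow> small s \<Longrightarrow> Psi s \<in> borel_measurable borel"
  by (rule has_derivative_borel_measurable[OF Psi_deriv])

lemma W_meas[measurable]: "s > 0 \<Longrightarrow> small s \<Longrightarrow> W s \<in> borel_measurable borel"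
  by (rule measurable_gradient[OF Psi_deriv])

lemma T_bounds:
  assumes "0 < s" "s \<le> b" "small b"
  shows "norm (T s x) \<le> 9 / 8 * norm x + b * norm (G 0)" "7 / 8 * norm x - b * norm (G 0) \<le> norm (T s x)"
proof -
  have s: "small s" using assms by (auto intro: small_le[of b])
  have "s * L \<le> 1 / 8" using s assms by (simp add: small_def)
  then have "s * L * norm x \<le> 1 / 8 * norm x" by (intro mult_right_mono) auto
  moreover have "s * norm (G x) \<le> s * (norm (G 0) + L * norm x)" using assms by (intro mult_left_mono G_growth) auto
  moreover have "s * norm (G 0) \<le> b * norm (G 0)" using assms by (intro mult_right_mono) auto
  ultimately have *: "norm (s *\<^sub>R G x) \<le> 1 / 8 * norm x + b * norm (G 0)"
    using assms by (simp add: distrib_left mult.assoc)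
  then show "norm (T s x) \<le> 9 / 8 * norm x + b * norm (G 0)"
    unfolding T_def using norm_triangle_ineq[of x "s *\<^sub>R G x"] by linarith
  show "7 / 8 * norm x - b * norm (G 0) \<le> norm (T s x)"
    unfolding T_def using * norm_triangle_ineq4[of "x + s *\<^sub>R G x" "s *\<^sub>R G x"] by simp
qed

lemma G_growth': "norm (G x) \<le> (norm (G 0) + L) * (1 + norm x)"
proof -
  have "norm (G 0) * 1 \<le> norm (G 0) * (1 + norm x)" by (intro mult_left_mono) auto
  moreover have "L * norm x \<le> L * (1 + norm x)" using L_nonneg by (intro mult_left_mono) auto
  ultimately show ?thesis using G_growth[of x] unfolding distrib_right[of "norm (G 0)"] by linarith
qed

text \<open>All growth bounds used for domination, with constants uniform over times in
  \<open>[a, b]\<close>: gradients grow linearly and the density decays like a Gaussian. The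
  constants degenerate as \<open>a\<close> tends to 0 through the factor \<open>1 / (2 a)\<close> in
  the score.\<close>

lemma growth:
  assumes a: "0 < a" and b: "small b"
  obtains K \<kappa> where "K \<ge> 1" "\<kappa> > 0"
    "\<And>s x. a \<le> s \<Longrightarrow> s \<le> b \<Longrightarrow> norm (W s x) \<le> K * (1 + norm x)"
    "\<And>s x. a \<le> s \<Longrightarrow> s \<le> b \<Longrightarrow> norm (score s (T s x)) \<le> K * (1 + norm x)"
    "\<And>x. norm (G x) \<le> K * (1 + norm x)"
    "\<And>s x. a \<le> s \<Longrightarrow> s \<le> b \<Longrightarrow> rho s x \<le> K * exp (- \<kappa> * (norm x)\<^sup>2)"
    "\<And>s y. a \<le> s \<Longrightarrow> s \<le> b \<Longrightarrow> norm (X s y) \<le> K * (1 + norm y)"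
proof (cases "a \<le> b")
  case False
  have "norm (G x) \<le> (1 + norm (G 0) + L) * (1 + norm x)" for x
    by (rule order_trans[OF G_growth' mult_right_mono]) auto
  then show ?thesis using False L_nonneg by (intro that[of "1 + norm (G 0) + L" 1]) auto
next
  case True
  define g where "g = b * norm (G 0)"
  have b0: "b > 0" and g0: "g \<ge> 0" using True a by (auto simp: g_def)
  define K1 where "K1 = (2 + g + R) / (2 * a)"
  define l where "l = 8 / 7 * real CARD('n) * b * M"
  \<comment> \<open>The decay rate \<open>1 / (8 b)\<close> of \<open>p\<close> in
    \<open>T s x\<close>, times the factor \<open>1/4\<close> lost in
    \<open>|x|^2 / 4 - g^2 <= |T s x|^2\<close>.\<close>
  define \<kappa> where "\<kappa> = 1 / (32 * b)"
  define C where "C = (4 * pi * a) powr (- real CARD('n) / 2) * exp (R\<^sup>2 / (4 * a)) * exp (g\<^sup>2 / (8 * b)) * (9/8) ^ CARD('n)"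
  define K where "K = 1 + 2 * K1 + l + norm (G 0) + L + C + 2 * (1 + g)"
  have pos: "K1 \<ge> 0" "l \<ge> 0" "C \<ge> 0" using a b0 g0 R0 M_nonneg by (auto simp: K1_def l_def C_def)
  have Gb: "norm (G x) \<le> (norm (G 0) + L) * (1 + norm x)" for x
    by (rule G_growth')
  have sc: "norm (score s (T s x)) \<le> K1 * (1 + norm x)" if s: "a \<le> s" "s \<le> b" for s x
  proof -
    have s0: "s > 0" using s a by simp
    have "norm (score s (T s x)) \<le> (norm (T s x) + R) / (2 * s)" by (rule score_bound[OF s0])
    also have "\<dots> \<le> (norm (T s x) + R) / (2 * a)" using s a R0 by (intro divide_left_mono) auto
    also have "\<dots> \<le> ((2 + g + R) * (1 + norm x)) / (2 * a)"
    proof (rule divide_right_mono)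
      have "norm (T s x) + R \<le> 9 / 8 * norm x + g + R" using T_bounds(1)[OF s0 s(2) b, of x] by (simp add: g_def)
      also have "\<dots> \<le> (2 + g + R) * (1 + norm x)" using g0 R0
        by (simp add: distrib_left distrib_right add_increasing2 add_mono)
      finally show "norm (T s x) + R \<le> (2 + g + R) * (1 + norm x)" .
    qed (use a in auto)
    finally show ?thesis by (simp add: K1_def)
  qed
  have le: "c * (1 + norm x) \<le> K * (1 + norm x)" if "c \<le> K" for c and x :: "real^'n" using that by (intro mult_right_mono) auto
  show ?thesis
  proof (rule that[of K \<kappa>])
    show "K \<ge> 1" using pos L_nonneg g0 by (simp add: K_def)
    show "\<kappa> > 0" using b0 by (simp add: \<kappa>_def)
    fix s x assume s: "a \<le> s" "s \<le> b"
    have s0: "s > 0" and ss: "small s" using s a b by (auto intro: small_le[of b])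
    show "norm (score s (T s x)) \<le> K * (1 + norm x)"
      using sc[OF s, of x] le[of K1 x] pos L_nonneg g0 by (simp add: K_def)
    show "norm (W s x) \<le> K * (1 + norm x)"
    proof -
      have "norm (transpose (Bm s x) *v score s (T s x)) \<le> 9 / 8 * (K1 * (1 + norm x))"
        by (rule order_trans[OF near_id_bounds(1)[OF near_id_transpose[OF Bm_near[OF ss]]] mult_left_mono[OF sc[OF s]]]) simp
      also have "\<dots> \<le> 2 * K1 * (1 + norm x)" using pos by simp
      finally have 1: "norm (transpose (Bm s x) *v score s (T s x)) \<le> 2 * K1 * (1 + norm x)" .
      have "norm (lam s x) \<le> 8 / 7 * real CARD('n) * \<bar>s\<bar> * M" by (rule lam_bound[OF ss])
      also have "\<dots> \<le> l" unfolding l_def using s s0 M_nonneg by (intro mult_right_mono mult_left_mono) auto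
      also have "\<dots> \<le> l * (1 + norm x)" using pos by (simp add: distrib_left)
      finally have 2: "norm (lam s x) \<le> l * (1 + norm x)" .
      have "norm (W s x) \<le> norm (transpose (Bm s x) *v score s (T s x)) + norm (lam s x) + norm (G x)"
        unfolding W_def by (rule order_trans[OF norm_triangle_ineq add_right_mono[OF norm_triangle_ineq]])
      also have "\<dots> \<le> (2 * K1 + l + (norm (G 0) + L)) * (1 + norm x)"
        unfolding distrib_right[of _ _ "1 + norm x"] using 1 2 Gb[of x] by (intro add_mono) (auto simp: distrib_right)
      also have "\<dots> \<le> K * (1 + norm x)" using pos g0 by (intro le) (simp add: K_def)
      finally show ?thesis .
    qed
    show "rho s x \<le> K * exp (- \<kappa> * (norm x)\<^sup>2)"
    proof -
      have "(7 / 8 * norm x)\<^sup>2 \<le> (norm (T s x) + g)\<^sup>2"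
        using T_bounds(2)[OF s0 s(2) b, of x] by (intro power_mono) (auto simp: g_def)
      also have "\<dots> \<le> 2 * (norm (T s x))\<^sup>2 + 2 * g\<^sup>2"
        using zero_le_power2[of "norm (T s x) - g"] by (simp add: power2_sum power2_diff)
      finally have "(7 / 8 * norm x)\<^sup>2 \<le> 2 * (norm (T s x))\<^sup>2 + 2 * g\<^sup>2" .
      moreover have "(7 / 8 * norm x)\<^sup>2 = 49 / 64 * (norm x)\<^sup>2" by (simp add: power_mult_distrib power_divide)
      \<comment> \<open>Halving gives the coefficient \<open>49/128\<close>, rounded down to
        \<open>1/4\<close>.\<close>
      ultimately have "(norm x)\<^sup>2 / 4 - g\<^sup>2 \<le> (norm (T s x))\<^sup>2"
        using zero_le_power2[of "norm x"] by linarith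
      then have "((norm x)\<^sup>2 / 4 - g\<^sup>2) / (8 * b) \<le> (norm (T s x))\<^sup>2 / (8 * b)" using b0 by (intro divide_right_mono) auto
      then have e: "- (norm (T s x))\<^sup>2 / (8 * b) \<le> g\<^sup>2 / (8 * b) + - \<kappa> * (norm x)\<^sup>2"
        by (simp add: \<kappa>_def diff_divide_distrib)
      have "p s (T s x) \<le> (4 * pi * a) powr (- real CARD('n) / 2) * exp (R\<^sup>2 / (4 * a)) * exp (- (norm (T s x))\<^sup>2 / (8 * b))"
        by (rule p_upper[OF a s])
      also have "\<dots> \<le> (4 * pi * a) powr (- real CARD('n) / 2) * exp (R\<^sup>2 / (4 * a)) * (exp (g\<^sup>2 / (8 * b)) * exp (- \<kappa> * (norm x)\<^sup>2))"
        using e by (intro mult_left_mono) (auto simp: exp_add[symmetric])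
      finally have "p s (T s x) * D s x \<le> (4 * pi * a) powr (- real CARD('n) / 2) * exp (R\<^sup>2 / (4 * a)) * (exp (g\<^sup>2 / (8 * b)) * exp (- \<kappa> * (norm x)\<^sup>2)) * (9/8) ^ CARD('n)"
        using D_upper[OF ss, of x] D_pos[OF ss, of x] by (intro mult_mono) auto
      also have "\<dots> = C * exp (- \<kappa> * (norm x)\<^sup>2)" by (simp add: C_def)
      also have "\<dots> \<le> K * exp (- \<kappa> * (norm x)\<^sup>2)" using pos L_nonneg g0 by (intro mult_right_mono) (auto simp: K_def)
      finally show ?thesis by (simp add: rho_def)
    qed
    show "norm (X s y) \<le> K * (1 + norm y)" for y
    proof -
      have "norm (X s y) \<le> 8 / 7 * (norm y + \<bar>s\<bar> * norm (G 0))" by (rule X_growth[OF ss])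
      also have "\<dots> \<le> 8 / 7 * (norm y + g)" using s s0 unfolding g_def by (intro mult_left_mono add_left_mono mult_right_mono) auto
      also have "\<dots> \<le> 2 * (1 + g) * (1 + norm y)" using g0 by (simp add: algebra_simps add_increasing2)
      also have "\<dots> \<le> K * (1 + norm y)" using pos L_nonneg by (intro le) (simp add: K_def)
      finally show ?thesis .
    qed
  next
    show "norm (G x) \<le> K * (1 + norm x)" for x
      using Gb[of x] le[of "norm (G 0) + L" x] pos g0 by (simp add: K_def)
  qed
qed

section \<open>The law of the interpolated point and expectations under it\<close>

lemma distr_XY: assumes s: "s > 0" "small s"
  shows "distr P borel (\<lambda>w. X s (Y s w)) = density lborel (\<lambda>x. ennreal (rho s x))"
proof -
  note [measurable] = X_meas[OF s(2)]
  have "distr P borel (\<lambda>w. X s (Y s w)) = distr (distr P borel (Y s)) borel (X s)"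
    by (subst distr_distr) (auto simp: o_def)
  also have "distr P borel (Y s) = density lborel (\<lambda>y. ennreal (p s y))"
    using distr_Y[OF s(1)] by (simp add: Y_def[abs_def])
  also have "distr \<dots> borel (X s) = density lborel (\<lambda>x. ennreal (rho s x))"
    unfolding rho_def using s by (intro distr_X integrable_p) auto
  finally show ?thesis .
qed

lemma nn_integral_rho: assumes s: "s > 0" "small s" shows "(\<integral>\<^sup>+x. ennreal (rho s x) \<partial>lborel) = 1"
  unfolding rho_def using nn_integral_pushforward[OF s(2) p_meas[OF s(1)] p_nonneg integrable_p[OF s(1)]] nn_integral_p[OF s(1)] by simp

lemma integrable_rho: assumes s: "s > 0" "small s" shows "integrable lborel (rho s)"
  by (rule integrableI_nonneg) (use s in \<open>auto simp: nn_integral_rho intro!: AE_I2 less_imp_le rho_pos\<close>)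

lemma integral_rho: assumes s: "s > 0" "small s" shows "(\<integral>x. rho s x \<partial>lborel) = 1"
  using nn_integral_eq_integral[OF integrable_rho[OF s]] nn_integral_rho[OF s] rho_pos[OF s]
  by (auto simp: less_imp_le ennreal_eq_1)

lemma integral_XY:
  fixes F :: "real^'n \<Rightarrow> real"
  assumes s: "s > 0" "small s" and F[measurable]: "F \<in> borel_measurable borel"
  shows "(\<integral>w. F (X s (Y s w)) \<partial>P) = (\<integral>x. rho s x * F x \<partial>lborel)"
    and "integrable P (\<lambda>w. F (X s (Y s w))) \<longleftrightarrow> integrable lborel (\<lambda>x. rho s x * F x)"
proof -
  note [measurable] = X_meas[OF s(2)] rho_meas[OF s(1)]
  have "(\<integral>w. F (X s (Y s w)) \<partial>P) = (\<integral>x. F x \<partial>distr P borel (\<lambda>w. X s (Y s w)))"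
    by (rule integral_distr[symmetric]) measurable
  also have "\<dots> = (\<integral>x. rho s x * F x \<partial>lborel)"
    unfolding distr_XY[OF s] by (subst integral_density) (auto intro!: AE_I2 less_imp_le rho_pos[OF s])
  finally show "(\<integral>w. F (X s (Y s w)) \<partial>P) = (\<integral>x. rho s x * F x \<partial>lborel)" .
  have "integrable P (\<lambda>w. F (X s (Y s w))) \<longleftrightarrow> integrable (distr P borel (\<lambda>w. X s (Y s w))) F"
    by (rule integrable_distr_eq[symmetric]) measurable
  also have "\<dots> \<longleftrightarrow> integrable lborel (\<lambda>x. rho s x * F x)"
    unfolding distr_XY[OF s] by (subst integrable_density) (auto intro!: AE_I2 less_imp_le rho_pos[OF s])
  finally show "integrable P (\<lambda>w. F (X s (Y s w))) \<longleftrightarrow> integrable lborel (\<lambda>x. rho s x * F x)" .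
qed

lemma integrable_rho_poly:
  fixes F :: "real^'n \<Rightarrow> 'b::{banach,second_countable_topology,real_normed_field}"
  assumes s: "s > 0" "small s" and F[measurable]: "F \<in> borel_measurable borel"
    and b: "\<And>x. norm (F x) \<le> C * (1 + norm x) ^ 4"
  shows "integrable lborel (\<lambda>x. rho s x *\<^sub>R F x)"
proof -
  obtain K \<kappa> where K: "K \<ge> 1" "\<kappa> > 0"
    and rb: "\<And>s' x. s \<le> s' \<Longrightarrow> s' \<le> s \<Longrightarrow> rho s' x \<le> K * exp (- \<kappa> * (norm x)\<^sup>2)"
    using growth[OF s] by metis
  have "integrable lborel (\<lambda>x::real^'n. K * C * ((1 + norm x) ^ 4 * exp (- \<kappa> * (norm x)\<^sup>2)))"
    by (intro integrable_mult_right integrable_poly_exp_norm K)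
  then show ?thesis
  proof (rule Bochner_Integration.integrable_bound)
    show "(\<lambda>x. rho s x *\<^sub>R F x) \<in> borel_measurable lborel" using rho_meas[OF s(1)] by measurable
    show "AE x in lborel. norm (rho s x *\<^sub>R F x) \<le> norm (K * C * ((1 + norm x) ^ 4 * exp (- \<kappa> * (norm x)\<^sup>2)))"
    proof (rule AE_I2)
      fix x :: "real^'n"
      have "norm (rho s x *\<^sub>R F x) = rho s x * norm (F x)" using rho_pos[OF s, of x] by simp
      also have "\<dots> \<le> (K * exp (- \<kappa> * (norm x)\<^sup>2)) * (C * (1 + norm x) ^ 4)"
        using K rb[of s x] b[of x] rho_pos[OF s, of x] by (intro mult_mono) auto
      finally show "norm (rho s x *\<^sub>R F x) \<le> norm (K * C * ((1 + norm x) ^ 4 * exp (- \<kappa> * (norm x)\<^sup>2)))"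
        by (simp add: mult_ac)
    qed
  qed
qed

end

lemma pow_le_4: "1 \<le> u \<Longrightarrow> k \<le> 4 \<Longrightarrow> u ^ k \<le> u ^ 4" for u :: real
  by (rule power_increasing)

section \<open>Entropy along the flow and its increments\<close>

context flow
begin

definition "H s = (\<integral>x. rho s x * Psi s x \<partial>lborel)"
text \<open>The observable is frozen at time \<open>s\<close> while the law moves with
  \<open>r\<close>; on the diagonal this is the entropy \<open>H s\<close>.\<close>

definition "m s r = (\<integral>w. Psi s (X r (Y r w)) \<partial>P)"
text \<open>The velocity of the curve at time \<open>r\<close> is \<open>Binv r x\<close> applied to
  the noise minus \<open>G x\<close>. Its conditional mean given the noisy point is minus the second
  factor here, so \<open>Phi s r\<close> is the \<open>r\<close>-derivative of
  \<open>m s r\<close>.\<close>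

definition "kern s r x = W s x \<bullet> (Binv r x *v (score r (T r x) + G x))"
definition "Phi s r = - (\<integral>x. rho r x * kern s r x \<partial>lborel)"

lemma Psi_growth:
  assumes "s > 0" "small s" obtains C where "C \<ge> 0" "\<And>x. \<bar>Psi s x\<bar> \<le> C * (1 + norm x)\<^sup>2"
proof -
  obtain K \<kappa> where K: "K \<ge> 1" "\<And>s' x. s \<le> s' \<Longrightarrow> s' \<le> s \<Longrightarrow> norm (W s' x) \<le> K * (1 + norm x)"
    using growth[OF assms] by metis
  have "\<bar>Psi s x\<bar> \<le> (\<bar>Psi s 0\<bar> + K) * (1 + norm x)\<^sup>2" for x
    by (rule gradient_growth_imp_quadratic[OF Psi_deriv[OF assms]]) (use K in auto)
  then show ?thesis using K by (intro that[of "\<bar>Psi s 0\<bar> + K"]) auto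
qed

lemma integrable_rho_le:
  fixes F :: "real^'n \<Rightarrow> real"
  assumes s: "s > 0" "small s" and F: "F \<in> borel_measurable borel"
    and b: "\<And>x. \<bar>F x\<bar> \<le> C * (1 + norm x)\<^sup>2" and C: "C \<ge> 0"
  shows "integrable lborel (\<lambda>x. rho s x * F x)"
proof -
  have "norm (F x) \<le> C * (1 + norm x) ^ 4" for x
    using b[of x] mult_left_mono[OF pow_le_4[of "1 + norm x" 2] C] by simp
  from integrable_rho_poly[OF s F this] show ?thesis by simp
qed

lemma integrable_rho_Psi:
  assumes "s > 0" "small s" "t > 0" "small t"
  shows "integrable lborel (\<lambda>x. rho t x * Psi s x)"
proof -
  obtain C where "C \<ge> 0" "\<And>x. \<bar>Psi s x\<bar> \<le> C * (1 + norm x)\<^sup>2" using Psi_growth[OF assms(1,2)] by metis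
  then show ?thesis using assms by (intro integrable_rho_le) auto
qed

lemma m_eq: "s > 0 \<Longrightarrow> small s \<Longrightarrow> t > 0 \<Longrightarrow> small t \<Longrightarrow> m s t = (\<integral>x. rho t x * Psi s x \<partial>lborel)"
  unfolding m_def using integral_XY(1)[OF _ _ Psi_meas] by simp

text \<open>Gibbs' inequality \<open>m s t <= H t\<close>, from \<open>exp u >= 1 + u\<close> with
  \<open>u = Psi s x - Psi t x\<close> and equal masses. Together with \<open>H s = m s s\<close> it
  bounds the increment of \<open>H\<close> although \<open>H\<close> is not known to be
  differentiable.\<close>

lemma H_diff_le:
  assumes s: "s > 0" "small s" and t: "t > 0" "small t"
  shows "H s - H t \<le> m s s - m s t"
proof -
  have "0 = (\<integral>x. rho t x - rho s x \<partial>lborel)"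
    using assms by (simp add: integrable_rho integral_rho)
  also have "\<dots> \<le> (\<integral>x. rho t x * Psi t x - rho t x * Psi s x \<partial>lborel)"
  proof (rule integral_mono)
    fix x
    have "rho s x = rho t x * exp (Psi s x - Psi t x)"
      using assms by (simp add: rho_eq_exp exp_add[symmetric])
    also have "\<dots> \<ge> rho t x * (1 + (Psi s x - Psi t x))"
      using rho_pos[OF t, of x] exp_ge_add_one_self by (intro mult_left_mono) auto
    finally show "rho t x - rho s x \<le> rho t x * Psi t x - rho t x * Psi s x" by (simp add: algebra_simps)
  qed (use assms in \<open>auto intro: integrable_rho integrable_rho_Psi\<close>)
  also have "\<dots> = H t - m s t"
    using assms by (simp add: m_eq H_def integrable_rho_Psi)
  finally show ?thesis using assms by (simp add: m_eq H_def)
qed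

interpretation GG: prob_space "std_gauss :: (real^'n) measure" by (rule prob_space_std_gauss)
interpretation PP: pair_prob_space \<mu> "std_gauss :: (real^'n) measure" ..

lemma integrable_moment_P: "integrable P (\<lambda>w. (1 + norm (snd w)) ^ 4)"
  by (rule PP.Fubini_integrable) (auto simp: integrable_std_gauss_poly)

lemma supp_P: "AE w in P. norm (fst w) \<le> R"
proof -
  have "AE x in distr P \<mu> fst. norm x \<le> R" unfolding GG.distr_pair_fst by (rule supp)
  then show ?thesis by (subst (asm) AE_distr_iff) auto
qed

text \<open>Domination of the whole random path over times in \<open>[a, b]\<close> by the norm of
  one Gaussian vector; the bounded starting point is absorbed into \<open>C\<close>.\<close>

lemma XY_bound:
  assumes a: "0 < a" and b: "small b" "a \<le> b"
  obtains C where "C \<ge> 1" "\<And>r w. a \<le> r \<Longrightarrow> r \<le> b \<Longrightarrow> norm (fst w) \<le> R \<Longrightarrow> 1 + norm (X r (Y r w)) \<le> C * (1 + norm (snd w))"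
proof -
  obtain K \<kappa> where K: "K \<ge> 1" "\<And>s y. a \<le> s \<Longrightarrow> s \<le> b \<Longrightarrow> norm (X s y) \<le> K * (1 + norm y)"
    using growth[OF a b(1)] by metis
  define c where "c = 1 + R + sqrt (2 * b)"
  have c: "c \<ge> 1" using R0 a b by (simp add: c_def)
  have "1 + norm (X r (Y r w)) \<le> (1 + 2 * K * c) * (1 + norm (snd w))" if r: "a \<le> r" "r \<le> b" and w: "norm (fst w) \<le> R" for r w
  proof -
    have "norm (Y r w) \<le> norm (fst w) + norm (sqrt (2 * r) *\<^sub>R snd w)" unfolding Y_def by (rule norm_triangle_ineq)
    also have "\<dots> \<le> R + sqrt (2 * b) * norm (snd w)" using r w a by (intro add_mono) (auto intro!: mult_right_mono)
    also have "\<dots> \<le> c * (1 + norm (snd w))"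
      using R0 a b unfolding c_def by (simp add: distrib_right distrib_left add_increasing2)
    finally have "1 + norm (Y r w) \<le> 2 * c * (1 + norm (snd w))"
      using mult_mono[OF c, of 1 "1 + norm (snd w)"] c by (simp add: algebra_simps)
    then have "K * (1 + norm (Y r w)) \<le> K * (2 * c * (1 + norm (snd w)))" using K by (intro mult_left_mono) auto
    then have "norm (X r (Y r w)) \<le> 2 * K * c * (1 + norm (snd w))" using K(2)[OF r, of "Y r w"] by (simp add: mult_ac)
    moreover have "(1 + 2 * K * c) * (1 + norm (snd w)) = 1 + norm (snd w) + 2 * K * c * (1 + norm (snd w))"
      by (simp only: distrib_right mult_1_left)
    ultimately show ?thesis using norm_ge_zero[of "snd w"] by linarith
  qed
  then show ?thesis using K c by (intro that[of "1 + 2 * K * c"]) auto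
qed

lemma Y_deriv: "r > 0 \<Longrightarrow> ((\<lambda>r. Y r w) has_vector_derivative (snd w /\<^sub>R sqrt (2 * r))) (at r)"
proof -
  assume r: "r > 0"
  have "((\<lambda>r. sqrt (2 * r)) has_real_derivative inverse (sqrt (2 * r))) (at r)"
    using r by (auto intro!: derivative_eq_intros)
  from has_vector_derivative_add[OF has_vector_derivative_const has_vector_derivative_scaleR[OF this has_vector_derivative_const]]
  show ?thesis unfolding Y_def[abs_def] by simp
qed

lemma Y_cont: "continuous_on S (\<lambda>r. Y r w)"
  unfolding Y_def by (intro continuous_intros)

lemma XY_meas[measurable]: "small r \<Longrightarrow> (\<lambda>w. X r (Y r w)) \<in> borel_measurable (borel \<Otimes>\<^sub>M borel)"
  using X_meas[of r] by measurable

lemma meas_P: "F \<in> borel_measurable (borel \<Otimes>\<^sub>M borel) \<Longrightarrow> F \<in> borel_measurable P"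
  by measurable

lemma integrable_P_le:
  fixes F :: "_ \<Rightarrow> 'b::{banach,second_countable_topology}"
  assumes F: "F \<in> borel_measurable (borel \<Otimes>\<^sub>M borel)"
    and b: "\<And>w. norm (fst w) \<le> R \<Longrightarrow> norm (F w) \<le> C * (1 + norm (snd w))\<^sup>2" and C: "C \<ge> 0"
  shows "integrable P F"
proof (rule Bochner_Integration.integrable_bound[OF integrable_mult_right[OF integrable_moment_P, of C]])
  show "F \<in> borel_measurable P" by (rule meas_P[OF F])
  show "AE w in P. norm (F w) \<le> norm (C * (1 + norm (snd w)) ^ 4)"
    using supp_P
  proof eventually_elim
    case (elim w)
    have "norm (F w) \<le> C * (1 + norm (snd w))\<^sup>2" by (rule b[OF elim])
    also have "\<dots> \<le> C * (1 + norm (snd w)) ^ 4" using C by (intro mult_left_mono pow_le_4) auto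
    finally show ?case by simp
  qed
qed

lemma m_cont:
  assumes s: "s > 0" "small s" and a: "0 < a" and b: "small b"
  shows "continuous_on {a..b} (m s)"
proof (cases "a \<le> b")
  case True
  obtain C1 where C1: "C1 \<ge> 0" "\<And>x. \<bar>Psi s x\<bar> \<le> C1 * (1 + norm x)\<^sup>2" using Psi_growth[OF s] by metis
  obtain C2 where C2: "C2 \<ge> 1" "\<And>r w. a \<le> r \<Longrightarrow> r \<le> b \<Longrightarrow> norm (fst w) \<le> R \<Longrightarrow> 1 + norm (X r (Y r w)) \<le> C2 * (1 + norm (snd w))"
    using XY_bound[OF a b True] by metis
  have smr: "small r" if "r \<in> {a..b}" for r using that a b by (auto intro: small_le[of b])
  show ?thesis
    unfolding m_def[abs_def]
  proof (rule continuous_on_integral_dominated[where g="\<lambda>w. C1 * C2\<^sup>2 * (1 + norm (snd w)) ^ 4"])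
    have Pc: "continuous_on UNIV (Psi s)"
      by (intro continuous_at_imp_continuous_on ballI has_derivative_continuous[OF Psi_deriv[OF s]])
    show "AE w in P. continuous_on {a..b} (\<lambda>r. Psi s (X r (Y r w)))"
      by (rule AE_I2, rule continuous_on_compose2[OF Pc X_curve_cont[OF smr Y_cont]]) auto
    show "AE w in P. norm (Psi s (X r (Y r w))) \<le> C1 * C2\<^sup>2 * (1 + norm (snd w)) ^ 4" if r: "r \<in> {a..b}" for r
      using supp_P
    proof eventually_elim
      case (elim w)
      have "\<bar>Psi s (X r (Y r w))\<bar> \<le> C1 * (1 + norm (X r (Y r w)))\<^sup>2" by (rule C1)
      also have "\<dots> \<le> C1 * (C2 * (1 + norm (snd w)))\<^sup>2"
        using C1 C2 elim r by (intro mult_left_mono power_mono) auto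
      also have "\<dots> = C1 * C2\<^sup>2 * (1 + norm (snd w))\<^sup>2" by (simp add: power_mult_distrib)
      also have "\<dots> \<le> C1 * C2\<^sup>2 * (1 + norm (snd w)) ^ 4" using C1 by (intro mult_left_mono pow_le_4) auto
      finally show ?case by simp
    qed
    show "integrable P (\<lambda>w. C1 * C2\<^sup>2 * (1 + norm (snd w)) ^ 4)"
      by (intro integrable_mult_right integrable_moment_P)
    show "(\<lambda>w. Psi s (X r (Y r w))) \<in> borel_measurable P" if "r \<in> {a..b}" for r
      using XY_meas[OF smr[OF that]] Psi_meas[OF s] by measurable
  qed
qed auto

lemma inner_le_norm: "\<bar>x \<bullet> y\<bar> \<le> a * b" if "norm x \<le> a" "norm y \<le> b" for x y :: "'z::real_inner"
proof -
  have "\<bar>x \<bullet> y\<bar> \<le> norm x * norm y" by (rule Cauchy_Schwarz_ineq2)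
  also have "\<dots> \<le> a * b" using that order_trans[OF norm_ge_zero that(1)] by (intro mult_mono) auto
  finally show ?thesis .
qed

text \<open>Conditioning on \<open>Y r\<close> replaces the noise \<open>z / sqrt (2 r)\<close> by \<open>- score r (Y r)\<close>.\<close>

lemma m_deriv:
  assumes s: "s > 0" "small s" and r: "0 < a" "a < r" "r < b" and b: "small b"
  shows "(m s has_real_derivative Phi s r) (at r)"
proof -
  have ab: "a \<le> b" using r by simp
  have r0: "r > 0" and sr: "small r" using r b by (auto intro: small_le[of b])
  have smr: "small r" if "r \<in> {a<..<b}" for r using that r b by (auto intro: small_le[of b])
  obtain K \<kappa> where K: "K \<ge> 1" "\<And>x. norm (W s x) \<le> K * (1 + norm x)" "\<And>x. norm (G x) \<le> K * (1 + norm x)"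
    using growth[OF s] by (metis order.refl)
  obtain C1 where C1: "C1 \<ge> 0" "\<And>x. \<bar>Psi s x\<bar> \<le> C1 * (1 + norm x)\<^sup>2" using Psi_growth[OF s] by metis
  obtain C where C: "C \<ge> 1" "\<And>r w. a \<le> r \<Longrightarrow> r \<le> b \<Longrightarrow> norm (fst w) \<le> R \<Longrightarrow> 1 + norm (X r (Y r w)) \<le> C * (1 + norm (snd w))"
    using XY_bound[OF r(1) b ab] by metis
  define v where "v q w = Binv q (X q (Y q w)) *v (snd w /\<^sub>R sqrt (2 * q) - G (X q (Y q w)))" for q w
  define F' where "F' q w = W s (X q (Y q w)) \<bullet> v q w" for q w
  \<comment> \<open>The gradient with the inverse Jacobian moved over to it by transposition. It
    depends on the noisy point only, as \<open>conditional_score\<close> requires.\<close>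
  define h where "h y = transpose (Binv r (X r y)) *v W s (X r y)" for y
  have KX: "K * (1 + norm (X q (Y q w))) \<le> K * C * (1 + norm (snd w))" if "a \<le> q" "q \<le> b" "norm (fst w) \<le> R" for q w
    using mult_left_mono[OF C(2)[OF that], of K] K by (simp add: mult.assoc)
  have WX: "norm (W s (X q (Y q w))) \<le> K * C * (1 + norm (snd w))" if "a \<le> q" "q \<le> b" "norm (fst w) \<le> R" for q w
    using K(2)[of "X q (Y q w)"] KX[OF that] by linarith
  have GX: "norm (G (X q (Y q w))) \<le> K * C * (1 + norm (snd w))" if "a \<le> q" "q \<le> b" "norm (fst w) \<le> R" for q w
    using K(3)[of "X q (Y q w)"] KX[OF that] by linarith
  define C3 where "C3 = 8 / 7 * (1 / sqrt (2 * a) + K * C)"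
  have C3: "C3 \<ge> 0" using r K C by (simp add: C3_def)
  have vb: "norm (v q w) \<le> C3 * (1 + norm (snd w))" if q: "a < q" "q < b" "norm (fst w) \<le> R" for q w
  proof -
    have "norm (snd w /\<^sub>R sqrt (2 * q)) = norm (snd w) / sqrt (2 * q)" using q r by (simp add: divide_inverse_commute)
    also have "\<dots> \<le> (1 + norm (snd w)) / sqrt (2 * a)" using q r by (intro frac_le) auto
    finally have 1: "norm (snd w /\<^sub>R sqrt (2 * q)) \<le> 1 / sqrt (2 * a) * (1 + norm (snd w))" by simp
    have "norm (v q w) \<le> 8 / 7 * norm (snd w /\<^sub>R sqrt (2 * q) - G (X q (Y q w)))"
      unfolding v_def using q by (intro Binv_bound smr) auto
    also have "\<dots> \<le> 8 / 7 * (norm (snd w /\<^sub>R sqrt (2 * q)) + norm (G (X q (Y q w))))"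
      by (intro mult_left_mono norm_triangle_ineq4) auto
    also have "\<dots> \<le> 8 / 7 * (1 / sqrt (2 * a) * (1 + norm (snd w)) + K * C * (1 + norm (snd w)))"
      using 1 GX[of q w] q by (intro mult_left_mono add_mono) auto
    finally show ?thesis by (simp add: C3_def distrib_right distrib_left mult.assoc)
  qed
  have F'b: "\<bar>F' q w\<bar> \<le> K * C * C3 * (1 + norm (snd w))\<^sup>2" if q: "a < q" "q < b" "norm (fst w) \<le> R" for q w
    using inner_le_norm[OF WX[of q w] vb[OF q]] q by (simp add: F'_def power2_eq_square mult_ac)
  have F'b4: "\<bar>F' q w\<bar> \<le> K * C * C3 * (1 + norm (snd w)) ^ 4" if q: "a < q" "q < b" "norm (fst w) \<le> R" for q w
  proof -
    have "0 \<le> K * C * C3" using K C C3 by simp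
    then have "K * C * C3 * (1 + norm (snd w))\<^sup>2 \<le> K * C * C3 * (1 + norm (snd w)) ^ 4"
      by (intro mult_left_mono pow_le_4) auto
    with F'b[OF q] show ?thesis by linarith
  qed
  have h_meas[measurable]: "h \<in> borel_measurable borel"
    unfolding h_def using measurable_compose[OF X_meas[OF sr] Binv_T_meas[OF sr W_meas[OF s]]] by simp
  have F'_h: "F' r w = h (Y r w) \<bullet> (snd w /\<^sub>R sqrt (2 * r)) - h (Y r w) \<bullet> G (X r (Y r w))" for w
    unfolding F'_def v_def h_def inner_matrix_vec_transpose by (simp only: inner_diff_right)
  have [measurable]: "(\<lambda>w. F' r w) \<in> borel_measurable (borel \<Otimes>\<^sub>M borel)"
    unfolding F'_h using XY_meas[OF sr] by measurable
  have der: "((\<lambda>q. \<integral>w. Psi s (X q (Y q w)) \<partial>P) has_derivative (\<lambda>d. (\<integral>w. F' r w \<partial>P) \<bullet> d)) (at r)"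
  proof (rule has_derivative_integral_dominated[of "{a<..<b}"])
    show "AE w in P. \<forall>q\<in>{a<..<b}. ((\<lambda>q. Psi s (X q (Y q w))) has_derivative (\<bullet>) (F' q w)) (at q) \<and>
      norm (F' q w) \<le> K * C * C3 * (1 + norm (snd w)) ^ 4"
      using supp_P
    proof eventually_elim
      case (elim w)
      show ?case
      proof (intro ballI conjI)
        fix q assume q: "q \<in> {a<..<b}"
        have "((\<lambda>q. X q (Y q w)) has_vector_derivative v q w) (at q)"
          unfolding v_def Binv_def by (rule X_curve_deriv[of "{a<..<b}"]) (use q r smr in \<open>auto intro!: Y_deriv\<close>)
        from has_derivative_compose[OF this[unfolded has_vector_derivative_def] Psi_deriv[OF s]]
        show "((\<lambda>q. Psi s (X q (Y q w))) has_derivative (\<bullet>) (F' q w)) (at q)"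
          by (simp add: F'_def mult.commute[of _ "_ \<bullet> _"])
        show "norm (F' q w) \<le> K * C * C3 * (1 + norm (snd w)) ^ 4" using F'b4[of q w] q elim by simp
      qed
    qed
    show "integrable P (\<lambda>w. K * C * C3 * (1 + norm (snd w)) ^ 4)"
      by (intro integrable_mult_right integrable_moment_P)
    show "integrable P (\<lambda>w. Psi s (X q (Y q w)))" if "q \<in> {a<..<b}" for q
    proof -
      have q: "q > 0" "small q" using that r smr by auto
      show ?thesis using integral_XY(2)[OF q Psi_meas[OF s]] integrable_rho_Psi[OF s q] by simp
    qed
    show "(\<lambda>w. F' r w) \<in> borel_measurable P" by (rule meas_P) measurable
  qed (use r in auto)
  have hb: "norm (h (Y r w)) \<le> 8 / 7 * (K * C) * (1 + norm (snd w))" if w: "norm (fst w) \<le> R" for w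
    using Binv_T_bound[OF sr, of "X r (Y r w)" "W s (X r (Y r w))"] WX[of r w] w r by (simp add: h_def)
  have KC: "8 / 7 * (K * C) \<ge> 0" using K C by simp
  have i1: "integrable P (\<lambda>w. norm (h (Y r w)) * norm (snd w))"
  proof (rule integrable_P_le[where C="8 / 7 * (K * C)"])
    fix w :: "(real^'n) \<times> (real^'n)" assume w: "norm (fst w) \<le> R"
    have "norm (h (Y r w)) * norm (snd w) \<le> (8 / 7 * (K * C) * (1 + norm (snd w))) * (1 + norm (snd w))"
      using hb[OF w] KC by (intro mult_mono) auto
    then show "norm (norm (h (Y r w)) * norm (snd w)) \<le> 8 / 7 * (K * C) * (1 + norm (snd w))\<^sup>2"
      by (simp add: power2_eq_square mult.assoc)
  qed (use KC in measurable)
  note cs = conditional_score[OF r0 h_meas i1[unfolded Y_def]]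
  have Gm: "(\<lambda>w. h (Y r w) \<bullet> G (X r (Y r w))) \<in> borel_measurable (borel \<Otimes>\<^sub>M borel)"
    using XY_meas[OF sr] by measurable
  have i2: "integrable P (\<lambda>w. h (Y r w) \<bullet> G (X r (Y r w)))"
  proof (rule integrable_P_le[OF Gm, where C="8 / 7 * (K * C) * (K * C)"])
    fix w :: "(real^'n) \<times> (real^'n)" assume w: "norm (fst w) \<le> R"
    show "norm (h (Y r w) \<bullet> G (X r (Y r w))) \<le> 8 / 7 * (K * C) * (K * C) * (1 + norm (snd w))\<^sup>2"
      using inner_le_norm[OF hb[OF w] GX[of r w]] w r by (simp add: power2_eq_square mult_ac)
  qed (use K C in simp)
  have i3: "integrable P (\<lambda>w. h (Y r w) \<bullet> (snd w /\<^sub>R sqrt (2 * r)))"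
  proof (rule integrable_P_le[where C="8 / 7 * (K * C) * inverse (sqrt (2 * r))"])
    fix w :: "(real^'n) \<times> (real^'n)" assume w: "norm (fst w) \<le> R"
    have "norm (snd w /\<^sub>R sqrt (2 * r)) \<le> inverse (sqrt (2 * r)) * (1 + norm (snd w))"
      using r0 by (simp add: mult_left_mono)
    from inner_le_norm[OF hb[OF w] this]
    show "norm (h (Y r w) \<bullet> (snd w /\<^sub>R sqrt (2 * r))) \<le> 8 / 7 * (K * C) * inverse (sqrt (2 * r)) * (1 + norm (snd w))\<^sup>2"
      by (simp only: power2_eq_square mult_ac real_norm_def)
  qed (use K C r0 in \<open>auto\<close>)
  have dY: "distr P borel (Y r) = density lborel (\<lambda>y. ennreal (p r y))"
    using distr_Y[OF r0] by (simp add: Y_def[abs_def])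
  have sc_meas[measurable]: "(\<lambda>y. h y \<bullet> score r y) \<in> borel_measurable borel" using r0 by measurable
  have gp_eq: "h y \<bullet> gp r y = p r y * (h y \<bullet> score r y)" for y
    using p_pos[OF r0, of y] by (simp add: score_def)
  have i4: "integrable P (\<lambda>w. h (Y r w) \<bullet> score r (Y r w))"
  proof -
    have "integrable (density lborel (\<lambda>y. ennreal (p r y))) (\<lambda>y. h y \<bullet> score r y)"
      by (subst integrable_density) (use cs(1) r0 in \<open>auto simp: gp_eq[symmetric]\<close>)
    then show ?thesis unfolding dY[symmetric] by (subst (asm) integrable_distr_eq) auto
  qed
  have "(\<integral>w. h (Y r w) \<bullet> score r (Y r w) \<partial>P) = (\<integral>y. h y \<bullet> score r y \<partial>distr P borel (Y r))"
    by (rule integral_distr[symmetric]) measurable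
  also have "\<dots> = (\<integral>y. h y \<bullet> gp r y \<partial>lborel)"
    unfolding dY by (subst integral_density) (use r0 in \<open>auto simp: gp_eq\<close>)
  finally have e1: "(\<integral>w. h (Y r w) \<bullet> score r (Y r w) \<partial>P) = (\<integral>y. h y \<bullet> gp r y \<partial>lborel)" .
  have "(\<integral>w. F' r w \<partial>P) = (\<integral>w. h (Y r w) \<bullet> (snd w /\<^sub>R sqrt (2 * r)) \<partial>P) - (\<integral>w. h (Y r w) \<bullet> G (X r (Y r w)) \<partial>P)"
    unfolding F'_h by (rule Bochner_Integration.integral_diff[OF i3 i2])
  also have "(\<integral>w. h (Y r w) \<bullet> (snd w /\<^sub>R sqrt (2 * r)) \<partial>P) = - (\<integral>w. h (Y r w) \<bullet> score r (Y r w) \<partial>P)"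
    unfolding e1 using cs(2) by (simp add: Y_def)
  also have "- (\<integral>w. h (Y r w) \<bullet> score r (Y r w) \<partial>P) - (\<integral>w. h (Y r w) \<bullet> G (X r (Y r w)) \<partial>P)
     = - (\<integral>w. h (Y r w) \<bullet> score r (Y r w) + h (Y r w) \<bullet> G (X r (Y r w)) \<partial>P)"
    by (subst Bochner_Integration.integral_add[OF i4 i2]) simp
  also have "\<dots> = - (\<integral>w. kern s r (X r (Y r w)) \<partial>P)"
  proof -
    have "h (Y r w) \<bullet> score r (Y r w) + h (Y r w) \<bullet> G (X r (Y r w)) = kern s r (X r (Y r w))" for w
      unfolding kern_def T_X[OF sr] inner_matrix_vec_transpose h_def by (simp only: inner_add_right)
    then show ?thesis by simp
  qed
  also have "(\<integral>w. kern s r (X r (Y r w)) \<partial>P) = (\<integral>x. rho r x * kern s r x \<partial>lborel)"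
  proof (rule integral_XY(1)[OF r0 sr])
    have "kern s r = (\<lambda>x. (transpose (Binv r x) *v W s x) \<bullet> (score r (T r x) + G x))"
      unfolding kern_def inner_matrix_vec_transpose by (rule refl)
    then show "kern s r \<in> borel_measurable borel"
      using Binv_T_meas[OF sr W_meas[OF s]] r0 by simp
  qed
  finally have "(\<integral>w. F' r w \<partial>P) = Phi s r" by (simp add: Phi_def)
  with der show ?thesis unfolding m_def[abs_def] has_field_derivative_def by simp
qed

text \<open>The mean value theorem is applied to \<open>m s\<close>, which is differentiable in its
  second time argument; the intermediate time \<open>r\<close> is later replaced by \<open>s\<close>
  through uniform continuity of \<open>Phi\<close>.\<close>

lemma H_mvt:
  assumes a: "0 < a" and b: "small b" and ts: "a \<le> t" "t < s" "s \<le> b"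
  shows "\<exists>r. t < r \<and> r < s \<and> H s - H t \<le> (s - t) * Phi s r"
proof -
  have s: "s > 0" "small s" and t: "t > 0" "small t" using assms by (auto intro: small_le[of b])
  have der: "(m s has_derivative (\<lambda>h. Phi s r * h)) (at r)" if "t < r" "r < s" for r
    using m_deriv[OF s, of "t/2" r s] that t s by (simp add: has_field_derivative_def)
  obtain r where r: "t < r" "r < s" and eq: "m s s - m s t = Phi s r * (s - t)"
  proof (rule mvt[OF ts(2) m_cont[OF s t(1) s(2)]])
    fix r assume "t < r" "r < s"
    then show "(m s has_derivative (\<lambda>h. Phi s r * h)) (at r)" by (rule der)
  qed (rule that)
  have "H s - H t \<le> (s - t) * Phi s r"
    using H_diff_le[OF s t] unfolding eq by (simp only: mult.commute)
  with r show ?thesis by blast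
qed

lemma kern_meas: assumes s: "s > 0" "small s" and r: "r > 0" "small r" shows "kern s r \<in> borel_measurable borel"
proof -
  have "kern s r = (\<lambda>x. (transpose (Binv r x) *v W s x) \<bullet> (score r (T r x) + G x))"
    unfolding kern_def inner_matrix_vec_transpose by (rule refl)
  then show ?thesis using Binv_T_meas[OF r(2) W_meas[OF s]] r by simp
qed

text \<open>The \<open>r\<close>-dependence sits in \<open>rho r\<close> and \<open>Binv r\<close>, as \<open>W s\<close> need not be continuous in space.\<close>

lemma Phi_cont:
  assumes a: "0 < a" and b: "small b"
  shows "continuous_on ({a..b} \<times> {a..b}) (\<lambda>q. Phi (fst q) (snd q))"
proof -
  let ?S = "{a..b} \<times> {a..b}"
  have small: "small (fst q)" "small (snd q)" "fst q > 0" "snd q > 0" if "q \<in> ?S" for q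
    using that a b by (auto intro: small_le[of b])
  obtain K \<kappa> where K: "K \<ge> 1" "\<kappa> > 0"
    and Wb: "\<And>s x. a \<le> s \<Longrightarrow> s \<le> b \<Longrightarrow> norm (W s x) \<le> K * (1 + norm x)"
    and scb: "\<And>s x. a \<le> s \<Longrightarrow> s \<le> b \<Longrightarrow> norm (score s (T s x)) \<le> K * (1 + norm x)"
    and Gb: "\<And>x. norm (G x) \<le> K * (1 + norm x)"
    and rb: "\<And>s x. a \<le> s \<Longrightarrow> s \<le> b \<Longrightarrow> rho s x \<le> K * exp (- \<kappa> * (norm x)\<^sup>2)"
    using growth[OF a b] by metis
  have "continuous_on ?S (\<lambda>q. \<integral>x. rho (snd q) x * kern (fst q) (snd q) x \<partial>lborel)"
  proof (rule continuous_on_integral_dominated[where g="\<lambda>x. K * (16 / 7 * K\<^sup>2) * ((1 + norm x) ^ 4 * exp (- \<kappa> * (norm x)\<^sup>2))"])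
    show "AE x in lborel. continuous_on ?S (\<lambda>q. rho (snd q) x * kern (fst q) (snd q) x)"
    proof (rule AE_I2)
      fix x :: "real^'n"
      have cf: "continuous_on ?S (\<lambda>q. fst q)" and cs: "continuous_on ?S (\<lambda>q. snd q)" by (auto intro: continuous_intros)
      have fa: "\<And>q. q \<in> ?S \<Longrightarrow> fst q \<ge> a" and sa: "\<And>q. q \<in> ?S \<Longrightarrow> snd q \<ge> a" by auto
      have 1: "continuous_on ?S (\<lambda>q. rho (snd q) x)"
        unfolding rho_def by (intro continuous_on_mult p_cont[OF cs _ a sa] D_cont T_cont cs continuous_on_const)
      have lam: "continuous_on ?S (\<lambda>q. lam (fst q) x)"
        by (rule continuous_on_compose2[of "{a..b}" "\<lambda>s. lam s x"])
           (use a b in \<open>auto intro!: lam_cont continuous_intros intro: small_le[of b]\<close>)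
      have 2: "continuous_on ?S (\<lambda>q. W (fst q) x)"
        unfolding W_def
        by (intro continuous_on_add lam continuous_on_matrix_vec continuous_on_transpose Bm_cont cf
            score_cont[OF cf _ a fa] T_cont continuous_on_const)
      have 3: "continuous_on ?S (\<lambda>q. Binv (snd q) x *v (score (snd q) (T (snd q) x) + G x))"
        unfolding Binv_def
        by (intro continuous_on_matrix_inv_vec continuous_on_add Bm_cont cs score_cont[OF cs _ a sa] T_cont
            continuous_on_const Bm_near small)
      show "continuous_on ?S (\<lambda>q. rho (snd q) x * kern (fst q) (snd q) x)"
        unfolding kern_def by (intro continuous_on_mult continuous_on_inner 1 2 3)
    qed
    show "integrable lborel (\<lambda>x::real^'n. K * (16 / 7 * K\<^sup>2) * ((1 + norm x) ^ 4 * exp (- \<kappa> * (norm x)\<^sup>2)))"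
      by (intro integrable_mult_right integrable_poly_exp_norm K)
    fix q assume q: "q \<in> ?S"
    note qs = small[OF q]
    show "(\<lambda>x. rho (snd q) x * kern (fst q) (snd q) x) \<in> borel_measurable lborel"
      using rho_meas[OF qs(4)] kern_meas[OF qs(3,1,4,2)] by measurable
    show "AE x in lborel. norm (rho (snd q) x * kern (fst q) (snd q) x) \<le> K * (16 / 7 * K\<^sup>2) * ((1 + norm x) ^ 4 * exp (- \<kappa> * (norm x)\<^sup>2))"
    proof (rule AE_I2)
      fix x :: "real^'n"
      have "norm (score (snd q) (T (snd q) x) + G x) \<le> 2 * K * (1 + norm x)"
        using scb[of "snd q" x] Gb[of x] q norm_triangle_ineq[of "score (snd q) (T (snd q) x)" "G x"] by auto
      then have "norm (Binv (snd q) x *v (score (snd q) (T (snd q) x) + G x)) \<le> 8 / 7 * (2 * K * (1 + norm x))"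
        using Binv_bound[OF qs(2), of x "score (snd q) (T (snd q) x) + G x"] by linarith
      from inner_le_norm[OF Wb[of "fst q" x] this]
      have "\<bar>kern (fst q) (snd q) x\<bar> \<le> 16 / 7 * K\<^sup>2 * (1 + norm x)\<^sup>2"
        using q by (auto simp: kern_def power2_eq_square mult_ac)
      also have "\<dots> \<le> 16 / 7 * K\<^sup>2 * (1 + norm x) ^ 4" by (intro mult_left_mono pow_le_4) auto
      finally have kb: "\<bar>kern (fst q) (snd q) x\<bar> \<le> 16 / 7 * K\<^sup>2 * (1 + norm x) ^ 4" .
      have "norm (rho (snd q) x * kern (fst q) (snd q) x) = rho (snd q) x * \<bar>kern (fst q) (snd q) x\<bar>"
        using rho_pos[OF qs(4,2), of x] by (simp add: abs_mult)
      also have "\<dots> \<le> (K * exp (- \<kappa> * (norm x)\<^sup>2)) * (16 / 7 * K\<^sup>2 * (1 + norm x) ^ 4)"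
        using rb[of "snd q" x] kb q K by (intro mult_mono) auto
      finally show "norm (rho (snd q) x * kern (fst q) (snd q) x) \<le> K * (16 / 7 * K\<^sup>2) * ((1 + norm x) ^ 4 * exp (- \<kappa> * (norm x)\<^sup>2))"
        by (simp add: mult_ac)
    qed
  qed
  then show ?thesis unfolding Phi_def by (rule continuous_on_minus)
qed

end

section \<open>Dissipation: the bound for \<open>Phi\<close> on the diagonal\<close>

context flow
begin

text \<open>The relative Fisher information of \<open>rho s\<close>, as a real integral with the
  explicit gradient \<open>W\<close>.\<close>

definition "J s = (\<integral>x. rho s x * (norm (W s x))\<^sup>2 \<partial>lborel)"

lemma integrable_W2: assumes s: "s > 0" "small s" shows "integrable lborel (\<lambda>x. rho s x * (norm (W s x))\<^sup>2)"
proof -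
  obtain K \<kappa> where K: "K \<ge> 1" "\<And>x. norm (W s x) \<le> K * (1 + norm x)" using growth[OF s] by (metis order.refl)
  show ?thesis
  proof (rule integrable_rho_le[OF s, where C="K\<^sup>2"])
    show "\<bar>(norm (W s x))\<^sup>2\<bar> \<le> K\<^sup>2 * (1 + norm x)\<^sup>2" for x
      using power_mono[OF K(2)[of x] norm_ge_zero, of 2] by (simp add: power_mult_distrib)
  qed (use W_meas[OF s] in auto)
qed

lemma integrable_G2: assumes s: "s > 0" "small s" shows "integrable lborel (\<lambda>x. rho s x * (norm (G x))\<^sup>2)"
proof (rule integrable_rho_le[OF s, where C="(norm (G 0) + L)\<^sup>2"])
  show "\<bar>(norm (G x))\<^sup>2\<bar> \<le> (norm (G 0) + L)\<^sup>2 * (1 + norm x)\<^sup>2" for x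
    using power_mono[OF G_growth'[of x] norm_ge_zero, of 2] by (simp add: power_mult_distrib)
qed auto

lemma integrable_GW: assumes s: "s > 0" "small s" shows "integrable lborel (\<lambda>x. rho s x * (G x \<bullet> W s x))"
proof -
  obtain K \<kappa> where K: "K \<ge> 1" "\<And>x. norm (W s x) \<le> K * (1 + norm x)" using growth[OF s] by (metis order.refl)
  show ?thesis
  proof (rule integrable_rho_le[OF s, where C="(norm (G 0) + L) * K"])
    show "\<bar>G x \<bullet> W s x\<bar> \<le> (norm (G 0) + L) * K * (1 + norm x)\<^sup>2" for x
      using inner_le_norm[OF G_growth' K(2), of x x] by (simp add: power2_eq_square mult_ac)
  qed (use W_meas[OF s] K L_nonneg in auto)
qed

text \<open>Gibbs' inequality for the pushforward of \<open>rho s\<close> under \<open>x \<mapsto> x - \<sigma> G x\<close>, differentiated at \<open>\<sigma> = 0\<close>, replaces an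
  integration by parts with the Laplacian of \<open>f\<close> (at most \<open>n L\<close>) and its boundary terms.\<close>

lemma integration_by_parts:
  assumes s: "s > 0" "small s"
  shows "(\<integral>x. rho s x * ((G x - W s x) \<bullet> G x) \<partial>lborel) \<le> real CARD('n) * L"
proof -
  obtain K \<kappa> where K: "K \<ge> 1" "\<And>x. norm (W s x) \<le> K * (1 + norm x)" "\<And>x. norm (G x) \<le> K * (1 + norm x)"
    using growth[OF s] by (metis order.refl)
  \<comment> \<open>The log-density \<open>ln (rho s)\<close>, with gradient \<open>W s - G\<close>.
    Formally the claim is that minus the integral of
    \<open>\<nabla> rho \<bullet> \<nabla> f\<close>, which is the mean of the Laplacian of
    \<open>f\<close>, is at most \<open>n L\<close>.\<close>
  define \<psi> where "\<psi> x = Psi s x - f x" for x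
  have \<psi>_deriv: "(\<psi> has_derivative (\<lambda>h. (W s x - G x) \<bullet> h)) (at x)" for x
    unfolding \<psi>_def inner_diff_left by (intro has_derivative_diff Psi_deriv[OF s] f_deriv)
  have \<psi>_meas[measurable]: "\<psi> \<in> borel_measurable borel" by (rule has_derivative_borel_measurable[OF \<psi>_deriv])
  have WG: "norm (W s x - G x) \<le> 2 * K * (1 + norm x)" for x
    using norm_triangle_ineq4[of "W s x" "G x"] K(2)[of x] K(3)[of x] by linarith
  have T1: "1 + norm (T \<sigma> x) \<le> (1 + s * K) * (1 + norm x)" if "\<bar>\<sigma>\<bar> \<le> s" for \<sigma> x
  proof -
    have "norm (T \<sigma> x) \<le> norm x + \<bar>\<sigma>\<bar> * norm (G x)" unfolding T_def using norm_triangle_ineq[of x "\<sigma> *\<^sub>R G x"] by simp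
    also have "\<bar>\<sigma>\<bar> * norm (G x) \<le> s * (K * (1 + norm x))" using that K(3)[of x] s by (intro mult_mono) auto
    finally show ?thesis by (simp add: distrib_right mult.assoc)
  qed
  have sK: "0 \<le> 1 + s * K" "0 \<le> s * K" using s K by auto
  have \<psi>_growth: "\<bar>\<psi> x\<bar> \<le> (\<bar>\<psi> 0\<bar> + 2 * K) * (1 + norm x)\<^sup>2" for x
    by (rule gradient_growth_imp_quadratic[OF \<psi>_deriv WG]) (use K in auto)
  define C1 where "C1 = (\<bar>\<psi> 0\<bar> + 2 * K) * (1 + s * K)\<^sup>2"
  have C1: "C1 \<ge> 0" using K by (simp add: C1_def)
  have \<psi>T: "\<bar>\<psi> (T \<sigma> x)\<bar> \<le> C1 * (1 + norm x)\<^sup>2" if "\<bar>\<sigma>\<bar> \<le> s" for \<sigma> x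
  proof -
    have "\<bar>\<psi> (T \<sigma> x)\<bar> \<le> (\<bar>\<psi> 0\<bar> + 2 * K) * (1 + norm (T \<sigma> x))\<^sup>2" by (rule \<psi>_growth)
    also have "\<dots> \<le> (\<bar>\<psi> 0\<bar> + 2 * K) * ((1 + s * K) * (1 + norm x))\<^sup>2"
      using K by (intro mult_left_mono power_mono T1[OF that]) auto
    finally show ?thesis by (simp add: C1_def power_mult_distrib mult.assoc)
  qed
  have int\<psi>T: "integrable lborel (\<lambda>x. rho s x * \<psi> (T \<sigma> x))" if "\<bar>\<sigma>\<bar> \<le> s" for \<sigma>
    by (rule integrable_rho_le[OF s _ \<psi>T[OF that] C1]) measurable
  define \<phi> where "\<phi> \<sigma> = (\<integral>x. rho s x * \<psi> (T \<sigma> x) \<partial>lborel)" for \<sigma>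
  define C2 where "C2 = 2 * K * (1 + s * K) * K"
  have \<phi>_deriv: "(\<phi> has_derivative (\<lambda>h. (\<integral>x. rho s x * ((W s (T 0 x) - G (T 0 x)) \<bullet> G x) \<partial>lborel) \<bullet> h)) (at 0)"
    unfolding \<phi>_def
  proof (rule has_derivative_integral_dominated[where U="{-s<..<s}" and F="\<lambda>\<sigma> x. rho s x * \<psi> (T \<sigma> x)"
        and F'="\<lambda>\<sigma> x. rho s x * ((W s (T \<sigma> x) - G (T \<sigma> x)) \<bullet> G x)" and g="\<lambda>x. rho s x * (C2 * (1 + norm x)\<^sup>2)"])
    show "integrable lborel (\<lambda>x. rho s x * (C2 * (1 + norm x)\<^sup>2))"
      by (rule integrable_rho_le[OF s, where C=C2]) (use K sK in \<open>auto simp: C2_def\<close>)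
    show "AE x in lborel. \<forall>\<sigma>\<in>{- s<..<s}.
        ((\<lambda>\<sigma>. rho s x * \<psi> (T \<sigma> x)) has_derivative (\<bullet>) (rho s x * ((W s (T \<sigma> x) - G (T \<sigma> x)) \<bullet> G x))) (at \<sigma>) \<and>
        norm (rho s x * ((W s (T \<sigma> x) - G (T \<sigma> x)) \<bullet> G x)) \<le> rho s x * (C2 * (1 + norm x)\<^sup>2)"
    proof (intro AE_I2 ballI conjI)
      fix x :: "real^'n" and \<sigma> assume \<sigma>: "\<sigma> \<in> {- s<..<s}"
      have "((\<lambda>\<sigma>. T \<sigma> x) has_derivative (\<lambda>h. h *\<^sub>R G x)) (at \<sigma>)"
        unfolding T_def by (auto intro!: derivative_eq_intros)
      from has_derivative_mult_right[OF has_derivative_compose[OF this \<psi>_deriv], of "rho s x"]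
      show "((\<lambda>\<sigma>. rho s x * \<psi> (T \<sigma> x)) has_derivative (\<bullet>) (rho s x * ((W s (T \<sigma> x) - G (T \<sigma> x)) \<bullet> G x))) (at \<sigma>)"
        by (rule has_derivative_eq_rhs) (auto simp: fun_eq_iff)
      have "norm (W s (T \<sigma> x) - G (T \<sigma> x)) \<le> 2 * K * (1 + norm (T \<sigma> x))" by (rule WG)
      also have "\<dots> \<le> 2 * K * ((1 + s * K) * (1 + norm x))" using \<sigma> K by (intro mult_left_mono T1) auto
      finally have "\<bar>(W s (T \<sigma> x) - G (T \<sigma> x)) \<bullet> G x\<bar> \<le> 2 * K * ((1 + s * K) * (1 + norm x)) * (K * (1 + norm x))"
        by (rule inner_le_norm[OF _ K(3)])
      also have "\<dots> = C2 * (1 + norm x)\<^sup>2" by (simp add: C2_def power2_eq_square mult_ac)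
      finally show "norm (rho s x * ((W s (T \<sigma> x) - G (T \<sigma> x)) \<bullet> G x)) \<le> rho s x * (C2 * (1 + norm x)\<^sup>2)"
        using rho_pos[OF s, of x] by (simp add: abs_mult)
    qed
    show "integrable lborel (\<lambda>x. rho s x * \<psi> (T \<sigma> x))" if "\<sigma> \<in> {- s<..<s}" for \<sigma>
      using that by (intro int\<psi>T) auto
    show "(\<lambda>x. rho s x * ((W s (T 0 x) - G (T 0 x)) \<bullet> G x)) \<in> borel_measurable lborel"
      using W_meas[OF s] rho_meas[OF s(1)] by measurable
  qed (use s in auto)
  have T0: "T 0 x = x" for x by (simp add: T_def)
  define I where "I = (\<integral>x. rho s x * ((W s x - G x) \<bullet> G x) \<partial>lborel)"
  have \<phi>_d: "(\<phi> has_real_derivative I) (at 0)"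
    using \<phi>_deriv by (simp add: T0 I_def has_field_derivative_def)
  \<comment> \<open>The function \<open>rho s (T (- \<sigma>) x) * D (- \<sigma>) x\<close> has mass
    1 and equals \<open>rho s x * exp u\<close> with \<open>u = \<psi> (T (- \<sigma>) x) + ln (D (-
    \<sigma>) x) - \<psi> x\<close>. Then \<open>exp u >= 1 + u\<close> makes the mean of
    \<open>u\<close> nonpositive, and \<open>D_lower\<close> bounds the log-determinant from
    below.\<close>
  have gibbs: "\<phi> (- \<sigma>) + real CARD('n) * ln (1 - \<sigma> * L) \<le> \<phi> 0" if \<sigma>: "0 < \<sigma>" "\<sigma> \<le> s" for \<sigma>
  proof -
    have small: "small (- \<sigma>)" using small_le[OF s(2), of \<sigma>] \<sigma> by (simp add: small_def)
    have sL: "\<sigma> * L \<le> 1 / 8" using small \<sigma> by (simp add: small_def)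
    define l where "l = real CARD('n) * ln (1 - \<sigma> * L)"
    have lnD: "l \<le> ln (D (- \<sigma>) x)" for x
    proof -
      have "l = ln ((1 - \<sigma> * L) ^ CARD('n))" using sL by (simp add: l_def ln_realpow)
      also have "\<dots> \<le> ln (D (- \<sigma>) x)" using D_lower[OF small, of x] \<sigma> sL by (intro ln_mono) auto
      finally show ?thesis .
    qed
    have push: "(\<integral>\<^sup>+x. ennreal (rho s (T (- \<sigma>) x) * D (- \<sigma>) x) \<partial>lborel) = 1"
      using nn_integral_pushforward[OF small rho_meas[OF s(1)] _ integrable_rho[OF s]] rho_pos[OF s] nn_integral_rho[OF s]
      by (simp add: less_imp_le)
    have ip: "integrable lborel (\<lambda>x. rho s (T (- \<sigma>) x) * D (- \<sigma>) x)"
      by (rule integrableI_nonneg)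
         (use push rho_meas[OF s(1)] rho_pos[OF s] D_pos[OF small] in \<open>auto simp: less_imp_le\<close>)
    have "ennreal (\<integral>x. rho s (T (- \<sigma>) x) * D (- \<sigma>) x \<partial>lborel) = 1"
      using nn_integral_eq_integral[OF ip] push rho_pos[OF s] D_pos[OF small] by (simp add: less_imp_le)
    then have i1: "(\<integral>x. rho s (T (- \<sigma>) x) * D (- \<sigma>) x \<partial>lborel) = 1"
      by (simp add: ennreal_eq_1)
    have ia: "integrable lborel (\<lambda>x. rho s x * \<psi> (T (- \<sigma>) x) + l * rho s x - rho s x * \<psi> (T 0 x))"
      using \<sigma> s by (intro Bochner_Integration.integrable_diff Bochner_Integration.integrable_add int\<psi>T integrable_mult_right integrable_rho) auto
    have "(\<integral>x. rho s x * \<psi> (T (- \<sigma>) x) + l * rho s x - rho s x * \<psi> (T 0 x) \<partial>lborel)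
        \<le> (\<integral>x. rho s (T (- \<sigma>) x) * D (- \<sigma>) x - rho s x \<partial>lborel)"
    proof (rule integral_mono[OF ia Bochner_Integration.integrable_diff[OF ip integrable_rho[OF s]]])
      fix x
      have "rho s (T (- \<sigma>) x) * D (- \<sigma>) x = rho s x * exp (\<psi> (T (- \<sigma>) x) + ln (D (- \<sigma>) x) - \<psi> x)"
        unfolding rho_eq_exp[OF s] \<psi>_def[symmetric] using D_pos[OF small, of x] by (simp add: exp_add exp_diff)
      also have "\<dots> \<ge> rho s x * (1 + (\<psi> (T (- \<sigma>) x) + l - \<psi> x))"
      proof (rule mult_left_mono)
        have "1 + (\<psi> (T (- \<sigma>) x) + ln (D (- \<sigma>) x) - \<psi> x) \<le> exp (\<psi> (T (- \<sigma>) x) + ln (D (- \<sigma>) x) - \<psi> x)"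
          by (rule exp_ge_add_one_self)
        then show "1 + (\<psi> (T (- \<sigma>) x) + l - \<psi> x) \<le> exp (\<psi> (T (- \<sigma>) x) + ln (D (- \<sigma>) x) - \<psi> x)"
          using lnD[of x] by linarith
      qed (use rho_pos[OF s, of x] in simp)
      finally show "rho s x * \<psi> (T (- \<sigma>) x) + l * rho s x - rho s x * \<psi> (T 0 x) \<le> rho s (T (- \<sigma>) x) * D (- \<sigma>) x - rho s x"
        by (simp add: T0 algebra_simps)
    qed
    also have "\<dots> = 0" by (simp add: ip integrable_rho[OF s] i1 integral_rho[OF s])
    also have "(\<integral>x. rho s x * \<psi> (T (- \<sigma>) x) + l * rho s x - rho s x * \<psi> (T 0 x) \<partial>lborel) = \<phi> (- \<sigma>) + l - \<phi> 0"
      unfolding \<phi>_def using \<sigma> s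
      by (simp add: int\<psi>T integrable_rho integral_rho)
    finally show ?thesis by (simp add: l_def)
  qed
  have d: "((\<lambda>\<sigma>. \<phi> (- \<sigma>) + real CARD('n) * ln (1 - \<sigma> * L)) has_real_derivative (- I - real CARD('n) * L)) (at 0)"
  proof -
    have 1: "((\<lambda>\<sigma>. \<phi> (- \<sigma>)) has_real_derivative - I) (at 0)"
    proof -
      have "(uminus has_real_derivative - 1) (at (0::real))" by (auto intro!: derivative_eq_intros)
      from DERIV_chain2[OF _ this, of \<phi> I] show ?thesis using \<phi>_d by simp
    qed
    have 2: "((\<lambda>\<sigma>. real CARD('n) * ln (1 - \<sigma> * L)) has_real_derivative (- (real CARD('n) * L))) (at 0)"
      by (auto intro!: derivative_eq_intros)
    from DERIV_add[OF 1 2] show ?thesis by simp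
  qed
  \<comment> \<open>At \<open>\<sigma> = 0\<close> both sides of \<open>gibbs\<close> agree, so a
    positive derivative of the left-hand side would violate it for small positive
    \<open>\<sigma>\<close>.\<close>
  have "\<not> (- I - real CARD('n) * L > 0)"
  proof
    assume "- I - real CARD('n) * L > 0"
    from DERIV_pos_inc_right[OF d this] obtain \<delta> where "\<delta> > 0"
      and inc: "\<And>h. h > 0 \<Longrightarrow> h < \<delta> \<Longrightarrow> \<phi> (- 0) + real CARD('n) * ln (1 - 0 * L) < \<phi> (- (0 + h)) + real CARD('n) * ln (1 - (0 + h) * L)"
      by auto
    define h where "h = min s (\<delta> / 2)"
    have "h > 0" "h < \<delta>" "h \<le> s" using \<open>\<delta> > 0\<close> s by (auto simp: h_def)
    then show False using inc[of h] gibbs[of h] by simp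
  qed
  moreover have "(\<integral>x. rho s x * ((G x - W s x) \<bullet> G x) \<partial>lborel) = - I"
  proof -
    have "rho s x * ((G x - W s x) \<bullet> G x) = - (rho s x * ((W s x - G x) \<bullet> G x))" for x
      by (simp add: inner_diff_left algebra_simps)
    then show ?thesis by (simp add: I_def)
  qed
  ultimately show ?thesis by simp
qed

text \<open>By \<open>integration_by_parts\<close> the second moment of \<open>G\<close> is at most
  the mean of \<open>G \<bullet> W\<close> plus \<open>n L\<close>; Young's inequality bounds the
  former by half of the moment plus half of \<open>J s\<close>, and the half moment is
  absorbed.\<close>

lemma gradient_moment:
  assumes s: "s > 0" "small s"
  shows "(\<integral>x. rho s x * (norm (G x))\<^sup>2 \<partial>lborel) \<le> J s + 2 * real CARD('n) * L"
proof -
  let ?E = "\<integral>x. rho s x * (norm (G x))\<^sup>2 \<partial>lborel"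
  note ints = integrable_W2[OF s] integrable_G2[OF s] integrable_GW[OF s]
  have "?E - (\<integral>x. rho s x * (G x \<bullet> W s x) \<partial>lborel) = (\<integral>x. rho s x * (norm (G x))\<^sup>2 - rho s x * (G x \<bullet> W s x) \<partial>lborel)"
    using ints by simp
  also have "\<dots> = (\<integral>x. rho s x * ((G x - W s x) \<bullet> G x) \<partial>lborel)"
    by (intro Bochner_Integration.integral_cong) (auto simp: power2_norm_eq_inner inner_diff_left inner_diff_right inner_commute algebra_simps)
  also have "\<dots> \<le> real CARD('n) * L" by (rule integration_by_parts[OF s])
  finally have 1: "?E - (\<integral>x. rho s x * (G x \<bullet> W s x) \<partial>lborel) \<le> real CARD('n) * L" .
  have "(\<integral>x. rho s x * (G x \<bullet> W s x) \<partial>lborel) \<le> (\<integral>x. 1/2 * (rho s x * (norm (G x))\<^sup>2) + 1/2 * (rho s x * (norm (W s x))\<^sup>2) \<partial>lborel)"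
  proof (rule integral_mono)
    fix x
    have "0 \<le> (norm (G x - W s x))\<^sup>2" by simp
    also have "\<dots> = (norm (G x))\<^sup>2 + (norm (W s x))\<^sup>2 - 2 * (G x \<bullet> W s x)"
      by (simp add: power2_norm_eq_inner inner_diff_left inner_diff_right inner_commute)
    finally have "rho s x * (2 * (G x \<bullet> W s x)) \<le> rho s x * ((norm (G x))\<^sup>2 + (norm (W s x))\<^sup>2)"
      using rho_pos[OF s, of x] by (intro mult_left_mono) auto
    then show "rho s x * (G x \<bullet> W s x) \<le> 1/2 * (rho s x * (norm (G x))\<^sup>2) + 1/2 * (rho s x * (norm (W s x))\<^sup>2)"
      by (simp add: distrib_left)
  qed (use ints in auto)
  also have "\<dots> = 1/2 * ?E + 1/2 * J s" unfolding J_def using ints by simp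
  finally show ?thesis using 1 by linarith
qed

text \<open>With \<open>g = B\<^sup>-\<^sup>T W\<close> for \<open>B = Bm s x\<close>, the kernel is \<open>\<langle>g, g + e\<rangle>\<close> with an error \<open>e\<close> of order \<open>s\<close>, and \<open>16/27 = 3/4 (8/9)\<^sup>2\<close>.\<close>

lemma kern_lower:
  assumes s: "s > 0" "small s"
  shows "16/27 * (norm (W s x))\<^sup>2 - 128/49 * (s * L)\<^sup>2 * (norm (G x))\<^sup>2 - 8192/2401 * (real CARD('n) * s * M)\<^sup>2 \<le> kern s s x"
proof -
  define N where "N = transpose (Binv s x)"
  define B where "B = transpose (Bm s x)"
  have NB: "N *v (B *v h) = h" and BN: "B *v (N *v h) = h" for h
    unfolding N_def B_def Binv_def by (rule transpose_inverse_vec[OF Bm_near[OF s(2)]])+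
  define g where "g = N *v W s x"
  define u where "u = score s (T s x)"
  define e where "e = N *v (s *\<^sub>R (transpose (A x) *v G x) - lam s x)"
  have Bv: "B *v h = h + s *\<^sub>R (transpose (A x) *v h)" for h
  proof -
    have "B = mat 1 + s *\<^sub>R transpose (A x)"
      by (simp add: B_def Bm_def transpose_def vec_eq_iff mat_def)
    then show ?thesis by (simp add: matrix_vector_mult_add_rdistrib scaleR_matrix_vector_assoc[symmetric])
  qed
  have u: "u + G x = g + e"
  proof -
    have "W s x = B *v u + lam s x + G x" by (simp only: W_def B_def u_def)
    then have "g + e = N *v (B *v u + lam s x + G x + (s *\<^sub>R (transpose (A x) *v G x) - lam s x))"
      unfolding g_def e_def by (simp only: matrix_vector_right_distrib)
    also have "B *v u + lam s x + G x + (s *\<^sub>R (transpose (A x) *v G x) - lam s x) = B *v u + B *v G x"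
      by (simp add: Bv)
    also have "N *v \<dots> = u + G x" by (simp only: matrix_vector_right_distrib NB)
    finally show ?thesis ..
  qed
  have "kern s s x = g \<bullet> (u + G x)"
    by (simp only: kern_def inner_matrix_vec_transpose g_def N_def u_def)
  then have k: "kern s s x = g \<bullet> (g + e)" by (simp only: u)
  have Wg: "(norm (W s x))\<^sup>2 \<le> 81/64 * (norm g)\<^sup>2"
  proof -
    have "norm (W s x) \<le> 9/8 * norm g"
      using near_id_bounds(1)[OF near_id_transpose[OF Bm_near[OF s(2)]], of x g] BN[of "W s x"] by (simp add: g_def B_def)
    from power_mono[OF this norm_ge_zero, of 2] show ?thesis by (simp add: power_mult_distrib power_divide)
  qed
  have "norm e \<le> 8/7 * (s * L * norm (G x) + 8/7 * real CARD('n) * s * M)"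
  proof -
    have "norm (transpose (A x) *v G x) \<le> L * norm (G x)" by (rule transpose_bound[OF A_bound])
    then have "norm (s *\<^sub>R (transpose (A x) *v G x)) \<le> s * L * norm (G x)"
      using s mult_left_mono[of _ "L * norm (G x)" s] by (simp add: mult.assoc)
    moreover have "norm (lam s x) \<le> 8/7 * real CARD('n) * s * M" using lam_bound[OF s(2), of x] s by simp
    ultimately have "norm (s *\<^sub>R (transpose (A x) *v G x) - lam s x) \<le> s * L * norm (G x) + 8/7 * real CARD('n) * s * M"
      using norm_triangle_ineq4[of "s *\<^sub>R (transpose (A x) *v G x)" "lam s x"] by linarith
    then show ?thesis
      unfolding e_def N_def by (rule order_trans[OF Binv_T_bound[OF s(2)] mult_left_mono]) simp
  qed
  from power_mono[OF this norm_ge_zero, of 2]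
  \<comment> \<open>With \<open>(a + b)^2 <= 2 a^2 + 2 b^2\<close> the constants become
    \<open>128/49 = 2 (8/7)^2\<close> and \<open>8192/2401 = 2 (8/7)^4\<close>; the second pair of
    factors \<open>8/7\<close> is that of \<open>lam_bound\<close>.\<close>
  have "(norm e)\<^sup>2 \<le> (8/7)\<^sup>2 * (s * L * norm (G x) + 8/7 * real CARD('n) * s * M)\<^sup>2"
    by (simp only: power_mult_distrib)
  also have "(8/7)\<^sup>2 = (64/49 :: real)" by (simp add: power_divide)
  also have "(s * L * norm (G x) + 8/7 * real CARD('n) * s * M)\<^sup>2 \<le> 2 * (s * L * norm (G x))\<^sup>2 + 2 * (8/7 * real CARD('n) * s * M)\<^sup>2"
    using zero_le_power2[of "s * L * norm (G x) - 8/7 * real CARD('n) * s * M"] by (simp only: power2_sum power2_diff)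
  also have "64/49 * (2 * (s * L * norm (G x))\<^sup>2 + 2 * (8/7 * real CARD('n) * s * M)\<^sup>2)
     = 128/49 * (s * L)\<^sup>2 * (norm (G x))\<^sup>2 + 8192/2401 * (real CARD('n) * s * M)\<^sup>2"
    by (simp add: power_mult_distrib power_divide)
  finally have e2: "(norm e)\<^sup>2 \<le> 128/49 * (s * L)\<^sup>2 * (norm (G x))\<^sup>2 + 8192/2401 * (real CARD('n) * s * M)\<^sup>2" by simp
  \<comment> \<open>Completing the square: \<open>g \<bullet> e >= - |g|^2 / 4 - |e|^2\<close>,
    which leaves \<open>3/4\<close> of \<open>|g|^2\<close>.\<close>
  have "0 \<le> (norm ((1/2) *\<^sub>R g + e))\<^sup>2" by simp
  also have "\<dots> = 1/4 * (norm g)\<^sup>2 + g \<bullet> e + (norm e)\<^sup>2"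
    by (simp add: power2_norm_eq_inner inner_add_left inner_add_right inner_commute algebra_simps)
  finally have "kern s s x \<ge> 3/4 * (norm g)\<^sup>2 - (norm e)\<^sup>2"
    unfolding k by (simp add: inner_add_right power2_norm_eq_inner)
  then show ?thesis using Wg e2 by linarith
qed

text \<open>The second moment of \<open>G\<close> in \<open>kern_lower\<close> is replaced by
  \<open>J s + 2 n L\<close>. Since \<open>(s L)^2 <= 1/64\<close>, its \<open>J\<close> part costs
  \<open>128/49 / 64 = 2/49\<close>, and \<open>16/27 - 2/49\<close> still exceeds
  \<open>1/2\<close>; the other part gives \<open>256/49 n L^3\<close>.\<close>

lemma Phi_diag:
  assumes s: "s > 0" "small s"
  shows "Phi s s \<le> - J s / 2 + s\<^sup>2 * (256/49 * real CARD('n) * L ^ 3 + 8192/2401 * (real CARD('n) * M)\<^sup>2)"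
proof -
  let ?EG = "\<integral>x. rho s x * (norm (G x))\<^sup>2 \<partial>lborel"
  let ?c = "8192/2401 * (real CARD('n) * s * M)\<^sup>2"
  let ?d = "128/49 * (s * L)\<^sup>2"
  note ints = integrable_W2[OF s] integrable_G2[OF s] integrable_rho[OF s]
  obtain K \<kappa> where K: "K \<ge> 1" and Wb: "\<And>x. norm (W s x) \<le> K * (1 + norm x)"
    and scb: "\<And>x. norm (score s (T s x)) \<le> K * (1 + norm x)" and Gb: "\<And>x. norm (G x) \<le> K * (1 + norm x)"
    using growth[OF s] by (metis order.refl)
  have ik: "integrable lborel (\<lambda>x. rho s x * kern s s x)"
  proof (rule integrable_rho_le[OF s kern_meas[OF s s], where C="16/7 * K\<^sup>2"])
    fix x
    have "norm (score s (T s x) + G x) \<le> 2 * K * (1 + norm x)"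
      using scb[of x] Gb[of x] norm_triangle_ineq[of "score s (T s x)" "G x"] by linarith
    then have "norm (Binv s x *v (score s (T s x) + G x)) \<le> 8/7 * (2 * K * (1 + norm x))"
      using Binv_bound[OF s(2), of x "score s (T s x) + G x"] by linarith
    from inner_le_norm[OF Wb this]
    show "\<bar>kern s s x\<bar> \<le> 16/7 * K\<^sup>2 * (1 + norm x)\<^sup>2"
      by (simp add: kern_def power2_eq_square mult_ac)
  qed simp
  have "16/27 * J s - ?d * ?EG - ?c = (\<integral>x. 16/27 * (rho s x * (norm (W s x))\<^sup>2) - ?d * (rho s x * (norm (G x))\<^sup>2) - ?c * rho s x \<partial>lborel)"
    unfolding J_def using ints by (simp add: integral_rho[OF s])
  also have "\<dots> \<le> (\<integral>x. rho s x * kern s s x \<partial>lborel)"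
  proof (rule integral_mono[OF _ ik])
    fix x
    have "rho s x * (16/27 * (norm (W s x))\<^sup>2 - ?d * (norm (G x))\<^sup>2 - ?c) \<le> rho s x * kern s s x"
      using rho_pos[OF s, of x] kern_lower[OF s, of x] by (intro mult_left_mono) auto
    then show "16/27 * (rho s x * (norm (W s x))\<^sup>2) - ?d * (rho s x * (norm (G x))\<^sup>2) - ?c * rho s x \<le> rho s x * kern s s x"
      by (simp only: right_diff_distrib mult_ac)
  qed (use ints in auto)
  finally have 1: "Phi s s \<le> - 16/27 * J s + ?d * ?EG + ?c" by (simp add: Phi_def)
  have J0: "J s \<ge> 0" unfolding J_def by (intro integral_nonneg_AE AE_I2) (use rho_pos[OF s] in \<open>auto simp: less_imp_le\<close>)
  have sL: "s * L \<le> 1/8" "0 \<le> s * L" using s L_nonneg by (auto simp: small_def)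
  have "(s * L)\<^sup>2 \<le> (1/8)\<^sup>2" using sL by (intro power_mono) auto
  then have "(s * L)\<^sup>2 * J s \<le> 1/64 * J s" using J0 by (intro mult_right_mono) (auto simp: power2_eq_square)
  moreover have "?d * ?EG \<le> ?d * (J s + 2 * real CARD('n) * L)" by (intro mult_left_mono gradient_moment[OF s]) auto
  moreover have "?d * (J s + 2 * real CARD('n) * L) = 128/49 * ((s * L)\<^sup>2 * J s) + s\<^sup>2 * (256/49 * real CARD('n) * L ^ 3)"
    by (simp add: power2_eq_square power3_eq_cube algebra_simps)
  moreover have "?c = s\<^sup>2 * (8192/2401 * (real CARD('n) * M)\<^sup>2)" by (simp add: power_mult_distrib)
  moreover have "s\<^sup>2 * (256/49 * real CARD('n) * L ^ 3 + 8192/2401 * (real CARD('n) * M)\<^sup>2) =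
     s\<^sup>2 * (256/49 * real CARD('n) * L ^ 3) + s\<^sup>2 * (8192/2401 * (real CARD('n) * M)\<^sup>2)" by (rule distrib_left)
  ultimately show ?thesis using 1 J0 by linarith
qed

end

section \<open>Relative entropy\<close>

text \<open>This is \<open>\<nu> (u ln u - u + 1)\<close> with \<open>u = \<rho> / \<nu>\<close>,
  nonnegative by convexity; the two added terms cancel on integration.\<close>

definition kl_integrand :: "('a \<Rightarrow> real) \<Rightarrow> ('a \<Rightarrow> real) \<Rightarrow> 'a \<Rightarrow> real" where
  "kl_integrand \<nu> \<rho> x = \<rho> x * ln (\<rho> x / \<nu> x) - \<rho> x + \<nu> x"

text \<open>For probability densities this is the relative entropy, written with a nonnegative integrand so that Fatou's lemma applies.\<close>

definition Kd :: "('a::euclidean_space \<Rightarrow> real) \<Rightarrow> ('a \<Rightarrow> real) \<Rightarrow> ennreal" where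
  "Kd \<nu> \<rho> = (\<integral>\<^sup>+x. ennreal (kl_integrand \<nu> \<rho> x) \<partial>lborel)"

lemma kl_integrand_nonneg:
  assumes "\<nu> x > 0" "\<rho> x \<ge> 0" shows "kl_integrand \<nu> \<rho> x \<ge> 0"
proof (cases "\<rho> x = 0")
  case False
  then have r: "\<rho> x > 0" using assms by simp
  have "ln (\<nu> x / \<rho> x) \<le> \<nu> x / \<rho> x - 1" using r assms by (intro ln_le_minus_one) auto
  then have "\<rho> x * ln (\<nu> x / \<rho> x) \<le> \<rho> x * (\<nu> x / \<rho> x - 1)" using r by (intro mult_left_mono) auto
  also have "\<dots> = \<nu> x - \<rho> x" using r by (simp add: field_simps)
  finally show ?thesis using r assms by (simp add: kl_integrand_def ln_div algebra_simps)
qed (use assms in \<open>simp add: kl_integrand_def\<close>)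

lemma kl_integrand_meas[measurable]:
  assumes [measurable]: "\<nu> \<in> borel_measurable M" "\<rho> \<in> borel_measurable M"
  shows "kl_integrand \<nu> \<rho> \<in> borel_measurable M"
  unfolding kl_integrand_def[abs_def] by measurable

text \<open>The pointwise identity is arranged so that only nonnegative terms occur, with the
  negative part moved to the other side. Its integral is finite, so it may be subtracted again even
  when the entropy is infinite.\<close>

lemma KL_dens_eq:
  fixes \<nu> \<rho> :: "'a::euclidean_space \<Rightarrow> real"
  assumes [measurable]: "\<nu> \<in> borel_measurable borel" "\<rho> \<in> borel_measurable borel"
    and \<nu>: "\<And>x. \<nu> x > 0" "(\<integral>\<^sup>+x. ennreal (\<nu> x) \<partial>lborel) = 1"
    and \<rho>: "\<And>x. \<rho> x \<ge> 0" "(\<integral>\<^sup>+x. ennreal (\<rho> x) \<partial>lborel) = 1"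
  shows "KL_dens \<nu> \<rho> = enn2ereal (Kd \<nu> \<rho>)"
proof -
  let ?u = "\<lambda>x. \<rho> x * ln (\<rho> x / \<nu> x)"
  let ?P = "\<integral>\<^sup>+x. ennreal (?u x) \<partial>lborel" and ?N = "\<integral>\<^sup>+x. ennreal (- ?u x) \<partial>lborel"
  have nn: "0 \<le> ?u x - \<rho> x + \<nu> x" for x using kl_integrand_nonneg[of \<nu> x \<rho>] \<nu>(1) \<rho>(1) by (simp add: kl_integrand_def)
  have "ennreal (kl_integrand \<nu> \<rho> x) + (ennreal (\<rho> x) + ennreal (- ?u x)) = ennreal (?u x) + ennreal (\<nu> x)" for x
  proof (cases "?u x \<ge> 0")
    case True
    then have "ennreal (- ?u x) = 0" by (simp add: ennreal_neg)
    then show ?thesis using True nn[of x] \<rho>(1)[of x] \<nu>(1)[of x]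
      by (simp add: kl_integrand_def ennreal_plus[symmetric] less_imp_le del: ennreal_plus)
  next
    case False
    then have "ennreal (?u x) = 0" by (simp add: ennreal_neg)
    then show ?thesis using False nn[of x] \<rho>(1)[of x] \<nu>(1)[of x]
      by (simp add: kl_integrand_def ennreal_plus[symmetric] less_imp_le del: ennreal_plus)
  qed
  then have "(\<integral>\<^sup>+x. ennreal (kl_integrand \<nu> \<rho> x) + (ennreal (\<rho> x) + ennreal (- ?u x)) \<partial>lborel) = (\<integral>\<^sup>+x. ennreal (?u x) + ennreal (\<nu> x) \<partial>lborel)"
    by simp
  then have eq: "Kd \<nu> \<rho> + (1 + ?N) = ?P + 1"
    by (simp add: nn_integral_add \<nu> \<rho> Kd_def)
  \<comment> \<open>Nonnegativity of the integrand bounds the negative part of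
    \<open>\<rho> ln (\<rho> / \<nu>)\<close> by \<open>\<nu> - \<rho>\<close>, hence by
    \<open>\<nu>\<close>.\<close>
  have "?N \<le> (\<integral>\<^sup>+x. ennreal (\<nu> x) \<partial>lborel)"
    using nn \<rho>(1) by (intro nn_integral_mono ennreal_leI) (smt (verit))
  then have N: "?N < \<infinity>" using \<nu>(2) by (simp add: le_less_trans[OF _ ennreal_one_less_top])
  then have eq2: "Kd \<nu> \<rho> + ?N = ?P"
  proof -
    have "(Kd \<nu> \<rho> + ?N) + 1 = ?P + 1" using eq by (simp add: add_ac)
    then show ?thesis using ennreal_add_diff_cancel_right[of 1 "Kd \<nu> \<rho> + ?N"] ennreal_add_diff_cancel_right[of 1 ?P] by simp
  qed
  obtain n where n: "?N = ennreal n" "n \<ge> 0" using N by (cases ?N) auto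
  have "enn2ereal ?P = enn2ereal (Kd \<nu> \<rho>) + ereal n"
    using n unfolding eq2[symmetric] by (simp add: plus_ennreal.rep_eq enn2ereal_ennreal)
  then show ?thesis unfolding KL_dens_def using n
    by (simp add: enn2ereal_ennreal) (cases "enn2ereal (Kd \<nu> \<rho>)"; simp)
qed

lemma Kd_integrable:
  fixes \<nu> \<rho> :: "'a::euclidean_space \<Rightarrow> real"
  assumes m[measurable]: "\<nu> \<in> borel_measurable borel" "\<rho> \<in> borel_measurable borel"
    and \<nu>: "\<And>x. \<nu> x > 0" "integrable lborel \<nu>" and \<rho>: "\<And>x. \<rho> x \<ge> 0" "integrable lborel \<rho>"
    and fin: "Kd \<nu> \<rho> < \<infinity>"
  shows "integrable lborel (\<lambda>x. \<rho> x * ln (\<rho> x / \<nu> x))"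
proof -
  have "integrable lborel (kl_integrand \<nu> \<rho>)"
    by (rule integrableI_nonneg) (use fin kl_integrand_nonneg[of \<nu> _ \<rho>] \<nu> \<rho> in \<open>auto simp: Kd_def\<close>)
  then have "integrable lborel (\<lambda>x. kl_integrand \<nu> \<rho> x + \<rho> x - \<nu> x)" using \<nu> \<rho> by auto
  then show ?thesis by (simp add: kl_integrand_def)
qed

lemma Kd_eq_integral:
  fixes \<nu> \<rho> :: "'a::euclidean_space \<Rightarrow> real"
  assumes \<nu>: "\<And>x. \<nu> x > 0" "integrable lborel \<nu>" "(\<integral>x. \<nu> x \<partial>lborel) = 1"
    and \<rho>: "\<And>x. \<rho> x \<ge> 0" "integrable lborel \<rho>" "(\<integral>x. \<rho> x \<partial>lborel) = 1"
    and i: "integrable lborel (\<lambda>x. \<rho> x * ln (\<rho> x / \<nu> x))"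
  shows "Kd \<nu> \<rho> = ennreal (\<integral>x. \<rho> x * ln (\<rho> x / \<nu> x) \<partial>lborel)" "0 \<le> (\<integral>x. \<rho> x * ln (\<rho> x / \<nu> x) \<partial>lborel)"
proof -
  have ii: "integrable lborel (kl_integrand \<nu> \<rho>)"
    unfolding kl_integrand_def[abs_def] using i \<nu> \<rho> by auto
  have eq: "(\<integral>x. kl_integrand \<nu> \<rho> x \<partial>lborel) = (\<integral>x. \<rho> x * ln (\<rho> x / \<nu> x) \<partial>lborel)"
    unfolding kl_integrand_def using i \<nu> \<rho> by simp
  have nn: "kl_integrand \<nu> \<rho> x \<ge> 0" for x by (intro kl_integrand_nonneg \<nu> \<rho>)
  show "Kd \<nu> \<rho> = ennreal (\<integral>x. \<rho> x * ln (\<rho> x / \<nu> x) \<partial>lborel)"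
    unfolding Kd_def eq[symmetric] by (rule nn_integral_eq_integral[OF ii]) (simp add: nn)
  show "0 \<le> (\<integral>x. \<rho> x * ln (\<rho> x / \<nu> x) \<partial>lborel)"
    unfolding eq[symmetric] by (rule integral_nonneg_AE) (simp add: nn)
qed

text \<open>Lower semicontinuity of relative entropy along pointwise convergent densities, by Fatou.
  Positivity of the limit makes the logarithm continuous there.\<close>

lemma Kd_le_liminf:
  fixes \<nu> \<rho> :: "'a::euclidean_space \<Rightarrow> real" and r :: "nat \<Rightarrow> 'a \<Rightarrow> real"
  assumes [measurable]: "\<nu> \<in> borel_measurable borel" "\<And>j. r j \<in> borel_measurable borel"
    and \<nu>: "\<And>x. \<nu> x > 0" and \<rho>: "\<And>x. \<rho> x > 0"
    and lim: "\<And>x. (\<lambda>j. r j x) \<longlonglongrightarrow> \<rho> x" and c: "\<And>j. Kd \<nu> (r j) \<le> ennreal (c j)" and cl: "c \<longlonglongrightarrow> C"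
  shows "Kd \<nu> \<rho> \<le> ennreal C"
proof -
  have "(\<lambda>j. ennreal (kl_integrand \<nu> (r j) x)) \<longlonglongrightarrow> ennreal (kl_integrand \<nu> \<rho> x)" for x
    unfolding kl_integrand_def using \<nu>[of x] \<rho>[of x]
    by (intro tendsto_ennrealI tendsto_intros lim) auto
  then have "Kd \<nu> \<rho> = (\<integral>\<^sup>+x. liminf (\<lambda>j. ennreal (kl_integrand \<nu> (r j) x)) \<partial>lborel)"
    unfolding Kd_def by (intro nn_integral_cong) (metis lim_imp_Liminf trivial_limit_sequentially)
  also have "\<dots> \<le> liminf (\<lambda>j. Kd \<nu> (r j))"
    unfolding Kd_def by (rule nn_integral_liminf) measurable
  also have "\<dots> \<le> liminf (\<lambda>j. ennreal (c j))" by (intro Liminf_mono always_eventually allI c)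
  also have "\<dots> = ennreal C" by (intro lim_imp_Liminf tendsto_ennrealI cl) simp
  finally show ?thesis .
qed

section \<open>Tools for Gaussian mollification\<close>

lemma nn_integral_translate:
  fixes h :: "'a::euclidean_space \<Rightarrow> ennreal"
  assumes [measurable]: "h \<in> borel_measurable borel"
  shows "(\<integral>\<^sup>+x. h (x + c) \<partial>lborel) = (\<integral>\<^sup>+x. h x \<partial>lborel)"
proof -
  have "(\<integral>\<^sup>+x. h x \<partial>lborel) = (\<integral>\<^sup>+x. h x \<partial>distr lborel borel ((+) c))"
    by (simp add: lborel_distr_plus)
  also have "\<dots> = (\<integral>\<^sup>+x. h (x + c) \<partial>lborel)"
    by (simp add: nn_integral_distr add.commute)
  finally show ?thesis ..
qed

text \<open>For each fixed \<open>z\<close> the shift by \<open>\<tau> z\<close> disappears by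
  translation invariance of Lebesgue measure.\<close>

lemma nn_integral_gauss_shift_swap:
  fixes h :: "(real^'n) \<times> (real^'n) \<Rightarrow> ennreal"
  assumes [measurable]: "h \<in> borel_measurable (borel \<Otimes>\<^sub>M borel)"
  shows "(\<integral>\<^sup>+y. \<integral>\<^sup>+z. h (y + \<tau> *\<^sub>R z, z) \<partial>std_gauss \<partial>lborel) = (\<integral>\<^sup>+z. \<integral>\<^sup>+y. h (y, z) \<partial>lborel \<partial>std_gauss)"
proof -
  interpret G: prob_space "std_gauss :: (real^'n) measure" by (rule prob_space_std_gauss)
  interpret PS: pair_sigma_finite "lborel :: (real^'n) measure" "std_gauss :: (real^'n) measure" ..
  have "(\<integral>\<^sup>+y. \<integral>\<^sup>+z. h (y + \<tau> *\<^sub>R z, z) \<partial>std_gauss \<partial>lborel) = (\<integral>\<^sup>+z. \<integral>\<^sup>+y. h (y + \<tau> *\<^sub>R z, z) \<partial>lborel \<partial>std_gauss)"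
    by (rule PS.Fubini'[symmetric]) measurable
  also have "\<dots> = (\<integral>\<^sup>+z. \<integral>\<^sup>+y. h (y, z) \<partial>lborel \<partial>std_gauss)"
    by (intro nn_integral_cong nn_integral_translate[of "\<lambda>y. h (y, _)"]) measurable
  finally show ?thesis .
qed

lemma ennreal_le_plus_mult:
  "a \<le> b + c * d \<Longrightarrow> 0 \<le> b \<Longrightarrow> 0 \<le> c \<Longrightarrow> 0 \<le> d \<Longrightarrow> ennreal a \<le> ennreal b + ennreal c * ennreal d"
  by (simp add: ennreal_mult[symmetric] ennreal_plus[symmetric] ennreal_leI del: ennreal_plus)

text \<open>The variance of \<open>k\<close> under the weight \<open>q\<close> is nonnegative;
  \<open>c\<close> is its mean.\<close>

lemma weighted_Cauchy_Schwarz: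
  fixes q k :: "'a \<Rightarrow> real"
  assumes i: "integrable M q" "integrable M (\<lambda>x. q x * k x)" "integrable M (\<lambda>x. q x * (k x)\<^sup>2)"
    and q: "\<And>x. q x \<ge> 0" and pos: "(\<integral>x. q x \<partial>M) > 0"
  shows "(\<integral>x. q x * k x \<partial>M)\<^sup>2 \<le> (\<integral>x. q x \<partial>M) * (\<integral>x. q x * (k x)\<^sup>2 \<partial>M)"
proof -
  define c where "c = (\<integral>x. q x * k x \<partial>M) / (\<integral>x. q x \<partial>M)"
  have "0 \<le> (\<integral>x. q x * (k x - c)\<^sup>2 \<partial>M)" using q by (intro integral_nonneg_AE) auto
  also have "\<dots> = (\<integral>x. q x * (k x)\<^sup>2 - 2 * c * (q x * k x) + c\<^sup>2 * q x \<partial>M)"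
    by (simp add: power2_diff algebra_simps)
  also have "\<dots> = (\<integral>x. q x * (k x)\<^sup>2 \<partial>M) - 2 * c * (\<integral>x. q x * k x \<partial>M) + c\<^sup>2 * (\<integral>x. q x \<partial>M)"
    using i by simp
  also have "\<dots> = (\<integral>x. q x * (k x)\<^sup>2 \<partial>M) - (\<integral>x. q x * k x \<partial>M)\<^sup>2 / (\<integral>x. q x \<partial>M)"
    using pos by (simp add: c_def power2_eq_square field_simps)
  finally show ?thesis using pos by (simp add: field_simps)
qed

section \<open>The log-Sobolev inequality along the flow\<close>

locale lsi_target = LM f L M for f :: "real^'n \<Rightarrow> real" and L M :: real +
  fixes \<alpha> :: real
  assumes prob: "(\<integral>\<^sup>+x. ennreal (exp (- f x)) \<partial>lborel) = 1"
    and alpha: "\<alpha> > 0" and lsi: "LSI (\<lambda>x. exp (- f x)) \<alpha>"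
begin

abbreviation "\<nu> \<equiv> \<lambda>x. exp (- f x)"

lemma \<nu>_int: "integrable lborel \<nu>" and \<nu>_one: "(\<integral>x. \<nu> x \<partial>lborel) = 1"
proof -
  show i: "integrable lborel \<nu>" by (rule integrableI_nonneg) (auto simp: prob)
  have "ennreal (\<integral>x. \<nu> x \<partial>lborel) = 1" using nn_integral_eq_integral[OF i] prob by simp
  then show "(\<integral>x. \<nu> x \<partial>lborel) = 1" by (simp add: ennreal_eq_1)
qed

text \<open>The error term of \<open>Phi_diag\<close> at the largest time \<open>b\<close>. Divided
  by \<open>\<alpha>\<close> it becomes \<open>bias b\<close>, the fixed point of the affine
  one-step map for the entropy.\<close>

definition "Cst b = b\<^sup>2 * (256/49 * real CARD('n) * L ^ 3 + 8192/2401 * (real CARD('n) * M)\<^sup>2)"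
definition "bias b = Cst b / \<alpha>"

end

locale flow_lsi = flow f L M \<mu> R + lsi_target f L M \<alpha>
  for f :: "real^'n \<Rightarrow> real" and L M :: real and \<mu> :: "(real^'n) measure" and R \<alpha> :: real
begin

lemma Kd_rho:
  assumes s: "s > 0" "small s" shows "Kd \<nu> (rho s) = ennreal (H s)" "H s \<ge> 0"
proof -
  have eq: "rho s x * ln (rho s x / \<nu> x) = rho s x * Psi s x" for x
    by (simp add: rho_eq_exp[OF s] exp_diff[symmetric])
  have i: "integrable lborel (\<lambda>x. rho s x * ln (rho s x / \<nu> x))"
    unfolding eq by (rule integrable_rho_Psi[OF s s])
  have r: "rho s x \<ge> 0" for x using rho_pos[OF s, of x] by simp
  show "Kd \<nu> (rho s) = ennreal (H s)" "H s \<ge> 0"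
    using Kd_eq_integral[OF _ \<nu>_int \<nu>_one r integrable_rho[OF s] integral_rho[OF s] i]
    unfolding eq H_def by auto
qed

text \<open>\<open>rho s\<close> need not be an admissible density: the Hessian is only differentiable, so the gradient of its determinant may be
  discontinuous. The inequality is applied to the convolution of \<open>rho s\<close> with a Gaussian of variance \<open>2t\<close>, whose Fisher information
  is controlled by the Cauchy-Schwarz inequality, and \<open>t\<close> tends to 0.\<close>

lemma lsi_rho:
  assumes s: "s > 0" "small s" shows "\<alpha> * H s \<le> J s / 2"
proof -
  define q where "q = rho s"
  define v where "v x = W s x - G x" for x
  have q0: "q x > 0" and qn: "q x \<ge> 0" for x using rho_pos[OF s, of x] by (auto simp: q_def)
  have qm[measurable]: "q \<in> borel_measurable borel" unfolding q_def by (rule rho_meas[OF s(1)])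
  have Wm[measurable]: "W s \<in> borel_measurable borel" by (rule W_meas[OF s])
  have vm[measurable]: "v \<in> borel_measurable borel" unfolding v_def by measurable
  have qi: "integrable lborel q" unfolding q_def by (rule integrable_rho[OF s])
  have q1: "(\<integral>\<^sup>+x. ennreal (q x) \<partial>lborel) = 1" unfolding q_def by (rule nn_integral_rho[OF s])
  have qd: "(q has_derivative (\<lambda>h. (q x *\<^sub>R v x) \<bullet> h)) (at x)" for x
  proof -
    have "((\<lambda>x. Psi s x - f x) has_derivative (\<lambda>h. v x \<bullet> h)) (at x)"
      unfolding v_def inner_diff_left by (intro has_derivative_diff Psi_deriv[OF s] f_deriv)
    from has_derivative_exp[OF this]
    have "((\<lambda>x. exp (Psi s x - f x)) has_derivative (\<lambda>h. (exp (Psi s x - f x) *\<^sub>R v x) \<bullet> h)) (at x)"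
      by (rule has_derivative_eq_rhs) (simp add: fun_eq_iff)
    moreover have "q = (\<lambda>x. exp (Psi s x - f x))" by (rule ext) (simp add: q_def rho_eq_exp[OF s])
    ultimately show ?thesis by simp
  qed
  have qc: "continuous_on UNIV q"
    by (intro continuous_at_imp_continuous_on ballI has_derivative_continuous[OF qd])
  obtain K \<kappa> where K12: "K \<ge> 1" "\<kappa> > 0" and K3: "\<And>s' x. s \<le> s' \<Longrightarrow> s' \<le> s \<Longrightarrow> norm (W s' x) \<le> K * (1 + norm x)"
    and K4: "\<And>x. norm (G x) \<le> K * (1 + norm x)"
    and K5: "\<And>s' x. s \<le> s' \<Longrightarrow> s' \<le> s \<Longrightarrow> rho s' x \<le> K * exp (- \<kappa> * (norm x)\<^sup>2)"
    using growth[OF s] by metis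
  have K: "K \<ge> 1" "\<kappa> > 0" "\<And>x. norm (W s x) \<le> K * (1 + norm x)" "\<And>x. norm (G x) \<le> K * (1 + norm x)"
    "\<And>x. q x \<le> K * exp (- \<kappa> * (norm x)\<^sup>2)"
    using K12 K3[OF order.refl order.refl] K4 K5[OF order.refl order.refl] by (auto simp: q_def)
  \<comment> \<open>One bound for \<open>q\<close>, for \<open>q |W|^2\<close> and for
    \<open>|q v|\<close>: each is at most \<open>q\<close> times a quartic polynomial.
    \<open>poly_le_exp\<close> is used with rate \<open>2 * \<kappa>\<close>, so that its
    exponential cancels the decay of \<open>q\<close> exactly.\<close>
  define C where "C = K * (4 * K\<^sup>2) * (8 + 64 / (2 * \<kappa>)\<^sup>2)"
  have qpoly: "q x * (4 * K\<^sup>2 * (1 + norm x) ^ 4) \<le> C" for x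
  proof -
    have "(1 + norm x) ^ 4 \<le> (8 + 64 / (2 * \<kappa>)\<^sup>2) * exp (2 * \<kappa> * (norm x)\<^sup>2 / 2)" using K by (intro poly_le_exp) auto
    then have "q x * (4 * K\<^sup>2 * (1 + norm x) ^ 4) \<le> (K * exp (- \<kappa> * (norm x)\<^sup>2)) * (4 * K\<^sup>2 * ((8 + 64 / (2 * \<kappa>)\<^sup>2) * exp (2 * \<kappa> * (norm x)\<^sup>2 / 2)))"
      using K(1) K(5)[of x] qn by (intro mult_mono mult_left_mono) auto
    also have "\<dots> = C * (exp (- \<kappa> * (norm x)\<^sup>2) * exp (\<kappa> * (norm x)\<^sup>2))" by (simp add: C_def)
    also have "\<dots> = C" by (simp add: exp_add[symmetric])
    finally show ?thesis .
  qed
  have K2: "1 \<le> 4 * K\<^sup>2" using one_le_power[OF K(1), of 2] by simp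
  have one4: "1 \<le> (1 + norm x) ^ 4" for x :: "real^'n" by (rule one_le_power) simp
  have qC: "q x \<le> C" for x
  proof -
    have "q x * 1 \<le> q x * (4 * K\<^sup>2 * (1 + norm x) ^ 4)"
      using mult_mono[OF K2 one4[of x]] qn K2 by (intro mult_left_mono) auto
    then show ?thesis using qpoly[of x] by simp
  qed
  have C0: "C \<ge> 0" using qC[of 0] qn[of 0] by linarith
  have qW2: "q x * (norm (W s x))\<^sup>2 \<le> C" for x
  proof -
    have "(norm (W s x))\<^sup>2 \<le> (K * (1 + norm x))\<^sup>2" using K(3) by (intro power_mono) auto
    also have "\<dots> = K\<^sup>2 * (1 + norm x)\<^sup>2" by (simp add: power_mult_distrib)
    also have "\<dots> \<le> K\<^sup>2 * (1 + norm x) ^ 4" by (intro mult_left_mono pow_le_4) auto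
    also have "\<dots> \<le> 4 * K\<^sup>2 * (1 + norm x) ^ 4" by simp
    finally have "q x * (norm (W s x))\<^sup>2 \<le> q x * (4 * K\<^sup>2 * (1 + norm x) ^ 4)" using qn by (intro mult_left_mono) auto
    then show ?thesis using qpoly[of x] by simp
  qed
  have qvC: "norm (q x *\<^sub>R v x) \<le> C" for x
  proof -
    have "norm (v x) \<le> 2 * K * (1 + norm x)" using norm_triangle_ineq4[of "W s x" "G x"] K(3)[of x] K(4)[of x] unfolding v_def by linarith
    also have "\<dots> \<le> (2 * K * (1 + norm x))\<^sup>2"
      using K(1) by (intro self_le_power) (auto simp: mult_ge1_I)
    also have "\<dots> = 4 * K\<^sup>2 * (1 + norm x)\<^sup>2" by (simp add: power_mult_distrib)
    also have "\<dots> \<le> 4 * K\<^sup>2 * (1 + norm x) ^ 4" by (intro mult_left_mono pow_le_4) auto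
    finally have "q x * norm (v x) \<le> q x * (4 * K\<^sup>2 * (1 + norm x) ^ 4)" using qn by (intro mult_left_mono) auto
    then show ?thesis using qpoly[of x] qn[of x] by simp
  qed
  interpret GG: prob_space "std_gauss :: (real^'n) measure" by (rule prob_space_std_gauss)
  \<comment> \<open>The law with density \<open>rho s\<close>; running the heat flow from it
    produces the mollification \<open>Q.p t\<close>, whose gradient is continuous for
    \<open>t > 0\<close>.\<close>
  define \<mu>' where "\<mu>' = density lborel (\<lambda>x. ennreal (q x))"
  have ps: "prob_space \<mu>'" by (rule prob_spaceI) (simp add: \<mu>'_def emeasure_density q1)
  interpret Q: heat \<mu>' by (intro heat.intro ps heat_axioms.intro) (simp add: \<mu>'_def)
  \<comment> \<open>By symmetry of the kernel the convolution is an average of translates of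
    \<open>q\<close>, so the gradient can fall on \<open>q\<close> instead of on the kernel.\<close>
  have p_shift: "Q.p t y = (\<integral>z. q (y + sqrt (2 * t) *\<^sub>R z) \<partial>std_gauss)" if t: "t > 0" for t y
  proof -
    have "ennreal (Q.p t y) = (\<integral>\<^sup>+x. ennreal (gauss t (y - x)) \<partial>\<mu>')" by (rule Q.nn_integral_gauss_p[OF t, symmetric])
    also have "\<dots> = (\<integral>\<^sup>+x. ennreal (q x) * ennreal (gauss t (y - x)) \<partial>lborel)"
      unfolding \<mu>'_def by (rule nn_integral_density) measurable
    also have "\<dots> = (\<integral>\<^sup>+x. ennreal (gauss t (x - y)) * ennreal (q x) \<partial>lborel)"
      by (simp add: gauss_def norm_minus_commute mult.commute)
    also have "\<dots> = (\<integral>\<^sup>+z. ennreal (q (y + sqrt (2 * t) *\<^sub>R z)) \<partial>std_gauss)"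
      by (rule nn_integral_shift_gauss[OF t, symmetric]) measurable
    also have "\<dots> = ennreal (\<integral>z. q (y + sqrt (2 * t) *\<^sub>R z) \<partial>std_gauss)"
      using qn qC by (intro nn_integral_eq_integral GG.integrable_const_bound[where B=C]) auto
    finally show ?thesis using qn by (subst (asm) ennreal_inj) (auto intro!: integral_nonneg_AE)
  qed
  \<comment> \<open>Differentiating the averaged form gives a second expression for the gradient,
    equal to \<open>Q.gp\<close> by uniqueness of derivatives.\<close>
  have gp_shift: "Q.gp t y = (\<integral>z. q (y + sqrt (2 * t) *\<^sub>R z) *\<^sub>R v (y + sqrt (2 * t) *\<^sub>R z) \<partial>std_gauss)" if t: "t > 0" for t y
  proof -
    have "((\<lambda>y. \<integral>z. q (y + sqrt (2 * t) *\<^sub>R z) \<partial>std_gauss) has_derivative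
      (\<lambda>h. (\<integral>z. q (y + sqrt (2 * t) *\<^sub>R z) *\<^sub>R v (y + sqrt (2 * t) *\<^sub>R z) \<partial>std_gauss) \<bullet> h)) (at y)"
    proof (rule has_derivative_integral_dominated[where U=UNIV and g="\<lambda>_. C"])
      show "AE w in std_gauss. \<forall>x\<in>UNIV. ((\<lambda>x. q (x + sqrt (2 * t) *\<^sub>R w)) has_derivative
          (\<bullet>) (q (x + sqrt (2 * t) *\<^sub>R w) *\<^sub>R v (x + sqrt (2 * t) *\<^sub>R w))) (at x) \<and>
          norm (q (x + sqrt (2 * t) *\<^sub>R w) *\<^sub>R v (x + sqrt (2 * t) *\<^sub>R w)) \<le> C"
      proof (intro AE_I2 ballI conjI qvC)
        fix w x :: "real^'n"
        have "((\<lambda>x. x + sqrt (2 * t) *\<^sub>R w) has_derivative (\<lambda>h. h)) (at x)" by (auto intro!: derivative_eq_intros)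
        from has_derivative_compose[OF this qd]
        show "((\<lambda>x. q (x + sqrt (2 * t) *\<^sub>R w)) has_derivative (\<bullet>) (q (x + sqrt (2 * t) *\<^sub>R w) *\<^sub>R v (x + sqrt (2 * t) *\<^sub>R w))) (at x)" .
      qed
      show "integrable std_gauss (\<lambda>w. q (x + sqrt (2 * t) *\<^sub>R w))" for x
        using qn qC by (intro GG.integrable_const_bound[where B=C]) auto
    qed auto
    then have "(Q.p t has_derivative (\<lambda>h. (\<integral>z. q (y + sqrt (2 * t) *\<^sub>R z) *\<^sub>R v (y + sqrt (2 * t) *\<^sub>R z) \<partial>std_gauss) \<bullet> h)) (at y)"
      unfolding p_shift[OF t, abs_def, symmetric] by (simp add: p_shift[OF t, abs_def, symmetric])
    from grad_eq[OF this] grad_eq[OF Q.p_deriv[OF t, of y]] show ?thesis by simp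
  qed
  define E2 where "E2 = (\<integral>z. (norm (z::real^'n))\<^sup>2 \<partial>std_gauss)"
  have iz2: "integrable std_gauss (\<lambda>z::real^'n. (norm z)\<^sup>2)"
  proof (rule Bochner_Integration.integrable_bound[OF integrable_std_gauss_poly])
    show "AE z in std_gauss. norm ((norm (z::real^'n))\<^sup>2) \<le> norm ((1 + norm z) ^ 4)"
    proof (rule AE_I2)
      fix z :: "real^'n"
      have "(norm z)\<^sup>2 \<le> (1 + norm z)\<^sup>2" by (intro power_mono) auto
      also have "\<dots> \<le> (1 + norm z) ^ 4" by (rule pow_le_4) auto
      finally show "norm ((norm (z::real^'n))\<^sup>2) \<le> norm ((1 + norm z) ^ 4)" by simp
    qed
  qed auto
  have iJ: "integrable lborel (\<lambda>x. q x * (norm (W s x))\<^sup>2)" unfolding q_def by (rule integrable_W2[OF s])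
  have nJ: "(\<integral>\<^sup>+x. ennreal (q x * (norm (W s x))\<^sup>2) \<partial>lborel) = ennreal (J s)"
    unfolding J_def using iJ qn by (subst nn_integral_eq_integral) (auto simp: q_def)
  have nE: "(\<integral>\<^sup>+z. ennreal ((norm (z::real^'n))\<^sup>2) \<partial>std_gauss) = ennreal E2"
    unfolding E2_def using iz2 by (intro nn_integral_eq_integral) auto
  have J0: "J s \<ge> 0" unfolding J_def using qn by (intro integral_nonneg_AE) (auto simp: q_def)
  have E0: "E2 \<ge> 0" unfolding E2_def by (intro integral_nonneg_AE) auto
  \<comment> \<open>From \<open>(a + \<tau> b)^2 <= (1 + \<tau>) a^2 + (\<tau> + \<tau>^2)
    b^2\<close> with \<open>a = |W|\<close> and \<open>b = L |z|\<close>. The weights are chosen so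
    that \<open>c \<tau>\<close> tends to \<open>J s\<close> as \<open>\<tau>\<close> tends to
    0.\<close>
  define c where "c \<tau> = (1 + \<tau>) * J s + (\<tau> + \<tau>\<^sup>2) * L\<^sup>2 * E2" for \<tau>
  have fisher: "Fisher \<nu> (Q.p t) \<le> ennreal (c (sqrt (2 * t)))" if t: "t > 0" for t
  proof -
    define \<tau> where "\<tau> = sqrt (2 * t)"
    have \<tau>: "\<tau> > 0" using t by (simp add: \<tau>_def)
    define h where "h = (\<lambda>(y, z :: real^'n). ennreal ((1 + \<tau>) * (q y * (norm (W s y))\<^sup>2)) + ennreal ((\<tau> + \<tau>\<^sup>2) * L\<^sup>2 * (norm z)\<^sup>2) * ennreal (q y))"
    have hm[measurable]: "h \<in> borel_measurable (borel \<Otimes>\<^sub>M borel)" unfolding h_def by measurable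
    have pt: "ennreal (if Q.p t y > 0 then Q.p t y * (norm (grad (\<lambda>y. ln (Q.p t y / \<nu> y)) y))\<^sup>2 else 0)
      \<le> (\<integral>\<^sup>+z. h (y + \<tau> *\<^sub>R z, z) \<partial>std_gauss)" for y
    proof -
      have pp: "Q.p t y > 0" by (rule Q.p_pos[OF t])
      have "((\<lambda>y. ln (Q.p t y) + f y) has_derivative (\<lambda>h. (Q.score t y + G y) \<bullet> h)) (at y)"
        unfolding inner_add_left by (intro has_derivative_add Q.lnp_deriv t f_deriv)
      moreover have "(\<lambda>y. ln (Q.p t y / \<nu> y)) = (\<lambda>y. ln (Q.p t y) + f y)"
      proof
        show "ln (Q.p t y / \<nu> y) = ln (Q.p t y) + f y" for y using Q.p_pos[OF t, of y] by (simp add: ln_div)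
      qed
      ultimately have gr: "grad (\<lambda>y. ln (Q.p t y / \<nu> y)) y = Q.score t y + G y" by (simp add: grad_eq)
      let ?y = "\<lambda>z. y + \<tau> *\<^sub>R z"
      \<comment> \<open>Bounds \<open>|v + G y|\<close> with \<open>v\<close> taken at the shifted
        point: there \<open>v\<close> is \<open>W - G\<close>, and the two values of
        \<open>G\<close> differ by at most \<open>L \<tau> |z|\<close>.\<close>
      define k where "k z = norm (W s (?y z)) + L * \<tau> * norm z" for z
      have k0: "k z \<ge> 0" for z using L_nonneg \<tau> by (simp add: k_def)
      have km[measurable]: "k \<in> borel_measurable borel" unfolding k_def by measurable
      have k2: "(k z)\<^sup>2 \<le> (1 + \<tau>) * (norm (W s (?y z)))\<^sup>2 + (\<tau> + \<tau>\<^sup>2) * L\<^sup>2 * (norm z)\<^sup>2" for z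
      proof -
        have "0 \<le> \<tau> * (norm (W s (?y z)) - L * norm z)\<^sup>2" using \<tau> by simp
        then show ?thesis by (simp add: k_def power2_eq_square algebra_simps)
      qed
      have qk2: "q (?y z) * (k z)\<^sup>2 \<le> (1 + \<tau>) * C + (\<tau> + \<tau>\<^sup>2) * L\<^sup>2 * C * (norm z)\<^sup>2" for z
      proof -
        have "q (?y z) * (k z)\<^sup>2 \<le> q (?y z) * ((1 + \<tau>) * (norm (W s (?y z)))\<^sup>2 + (\<tau> + \<tau>\<^sup>2) * L\<^sup>2 * (norm z)\<^sup>2)"
          by (intro mult_left_mono k2 qn)
        also have "\<dots> = (1 + \<tau>) * (q (?y z) * (norm (W s (?y z)))\<^sup>2) + (\<tau> + \<tau>\<^sup>2) * L\<^sup>2 * q (?y z) * (norm z)\<^sup>2"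
          by (simp add: algebra_simps)
        also have "\<dots> \<le> (1 + \<tau>) * C + (\<tau> + \<tau>\<^sup>2) * L\<^sup>2 * C * (norm z)\<^sup>2"
          using \<tau> by (intro add_mono mult_left_mono mult_right_mono qW2 qC) auto
        finally show ?thesis .
      qed
      have i0: "integrable std_gauss (\<lambda>z. q (?y z))"
        using qn qC by (intro GG.integrable_const_bound[where B=C]) auto
      have i2: "integrable std_gauss (\<lambda>z. q (?y z) * (k z)\<^sup>2)"
      proof (rule Bochner_Integration.integrable_bound)
        show "integrable std_gauss (\<lambda>z::real^'n. (1 + \<tau>) * C + (\<tau> + \<tau>\<^sup>2) * L\<^sup>2 * C * (norm z)\<^sup>2)"
          by (intro Bochner_Integration.integrable_add integrable_mult_right iz2) simp
        show "AE z in std_gauss. norm (q (?y z) * (k z)\<^sup>2) \<le> norm ((1 + \<tau>) * C + (\<tau> + \<tau>\<^sup>2) * L\<^sup>2 * C * (norm z)\<^sup>2)"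
        proof (rule AE_I2)
          fix z
          have "norm (q (?y z) * (k z)\<^sup>2) = q (?y z) * (k z)\<^sup>2" using qn by simp
          then show "norm (q (?y z) * (k z)\<^sup>2) \<le> norm ((1 + \<tau>) * C + (\<tau> + \<tau>\<^sup>2) * L\<^sup>2 * C * (norm z)\<^sup>2)"
            using qk2[of z] by (simp only: real_norm_def)
        qed
      qed measurable
      have i1: "integrable std_gauss (\<lambda>z. q (?y z) * k z)"
      proof (rule Bochner_Integration.integrable_bound)
        show "integrable std_gauss (\<lambda>z. q (?y z) + q (?y z) * (k z)\<^sup>2)" using i0 i2 by auto
        show "AE z in std_gauss. norm (q (?y z) * k z) \<le> norm (q (?y z) + q (?y z) * (k z)\<^sup>2)"
        proof (rule AE_I2)
          fix z
          have "k z \<le> 1 + (k z)\<^sup>2" using zero_le_power2[of "k z - 1"] k0[of z] by (simp add: power2_diff)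
          then have "q (?y z) * k z \<le> q (?y z) * (1 + (k z)\<^sup>2)" using qn by (intro mult_left_mono)
          then show "norm (q (?y z) * k z) \<le> norm (q (?y z) + q (?y z) * (k z)\<^sup>2)"
            using qn k0 by (simp add: distrib_left)
        qed
      qed measurable
      have pe: "Q.p t y = (\<integral>z. q (?y z) \<partial>std_gauss)" using p_shift[OF t] by (simp add: \<tau>_def)
      have iqv: "integrable std_gauss (\<lambda>z. q (?y z) *\<^sub>R v (?y z))"
        using qvC by (intro GG.integrable_const_bound[where B=C]) auto
      \<comment> \<open>The relative score of the mollification, times its density, is an average of
        relative scores of \<open>q\<close> up to the displacement error; Cauchy-Schwarz then bounds
        the Fisher integrand.\<close>
      have "Q.gp t y + Q.p t y *\<^sub>R G y = (\<integral>z. q (?y z) *\<^sub>R v (?y z) + q (?y z) *\<^sub>R G y \<partial>std_gauss)"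
        using gp_shift[OF t, of y] pe i0 iqv by (simp add: \<tau>_def[symmetric])
      also have "norm \<dots> \<le> (\<integral>z. q (?y z) * k z \<partial>std_gauss)"
      proof (rule order_trans[OF integral_norm_bound integral_mono[OF _ i1]])
        show "integrable std_gauss (\<lambda>z. norm (q (?y z) *\<^sub>R v (?y z) + q (?y z) *\<^sub>R G y))"
          using i0 iqv by auto
        fix z
        have "norm (G y - G (?y z)) \<le> L * norm (y - ?y z)" by (rule G_lip)
        also have "norm (y - ?y z) = \<tau> * norm z" using \<tau> by simp
        finally have "norm (v (?y z) + G y) \<le> k z"
          using norm_triangle_ineq[of "W s (?y z)" "G y - G (?y z)"] by (simp add: v_def k_def mult.assoc algebra_simps)
        then have "q (?y z) * norm (v (?y z) + G y) \<le> q (?y z) * k z" using qn by (intro mult_left_mono)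
        then show "norm (q (?y z) *\<^sub>R v (?y z) + q (?y z) *\<^sub>R G y) \<le> q (?y z) * k z"
          using qn by (simp add: scaleR_add_right[symmetric] del: scaleR_add_right)
      qed
      finally have "(norm (Q.gp t y + Q.p t y *\<^sub>R G y))\<^sup>2 \<le> (\<integral>z. q (?y z) * k z \<partial>std_gauss)\<^sup>2" by (intro power_mono) auto
      also have "\<dots> \<le> Q.p t y * (\<integral>z. q (?y z) * (k z)\<^sup>2 \<partial>std_gauss)"
        unfolding pe by (rule weighted_Cauchy_Schwarz[OF i0 i1 i2 qn]) (use pp pe in simp)
      finally have cs: "(norm (Q.gp t y + Q.p t y *\<^sub>R G y))\<^sup>2 \<le> Q.p t y * (\<integral>z. q (?y z) * (k z)\<^sup>2 \<partial>std_gauss)" .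
      have "Q.gp t y + Q.p t y *\<^sub>R G y = Q.p t y *\<^sub>R (Q.score t y + G y)"
        using pp by (simp add: Q.score_def scaleR_add_right)
      then have "(norm (Q.gp t y + Q.p t y *\<^sub>R G y))\<^sup>2 = Q.p t y * (Q.p t y * (norm (Q.score t y + G y))\<^sup>2)"
        using pp by (simp add: power_mult_distrib power2_eq_square)
      then have "Q.p t y * (norm (Q.score t y + G y))\<^sup>2 \<le> (\<integral>z. q (?y z) * (k z)\<^sup>2 \<partial>std_gauss)"
        using cs pp by simp
      then have "ennreal (Q.p t y * (norm (Q.score t y + G y))\<^sup>2) \<le> ennreal (\<integral>z. q (?y z) * (k z)\<^sup>2 \<partial>std_gauss)"
        by (rule ennreal_leI)
      also have "\<dots> = (\<integral>\<^sup>+z. ennreal (q (?y z) * (k z)\<^sup>2) \<partial>std_gauss)"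
        using qn by (intro nn_integral_eq_integral[symmetric] i2) auto
      also have "\<dots> \<le> (\<integral>\<^sup>+z. h (?y z, z) \<partial>std_gauss)"
      proof (rule nn_integral_mono)
        fix z
        have "q (?y z) * (k z)\<^sup>2 \<le> q (?y z) * ((1 + \<tau>) * (norm (W s (?y z)))\<^sup>2 + (\<tau> + \<tau>\<^sup>2) * L\<^sup>2 * (norm z)\<^sup>2)"
          by (intro mult_left_mono k2 qn)
        also have "\<dots> = (1 + \<tau>) * (q (?y z) * (norm (W s (?y z)))\<^sup>2) + (\<tau> + \<tau>\<^sup>2) * L\<^sup>2 * (norm z)\<^sup>2 * q (?y z)"
          by (simp add: algebra_simps)
        finally show "ennreal (q (?y z) * (k z)\<^sup>2) \<le> h (?y z, z)"
          unfolding h_def prod.case using \<tau> qn by (intro ennreal_le_plus_mult) auto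
      qed
      finally show ?thesis using pp gr by simp
    qed
    have "Fisher \<nu> (Q.p t) \<le> (\<integral>\<^sup>+y. \<integral>\<^sup>+z. h (y + \<tau> *\<^sub>R z, z) \<partial>std_gauss \<partial>lborel)"
      unfolding Fisher_def by (rule nn_integral_mono) (rule pt)
    also have "\<dots> = (\<integral>\<^sup>+z. \<integral>\<^sup>+y. h (y, z) \<partial>lborel \<partial>std_gauss)" by (rule nn_integral_gauss_shift_swap) measurable
    also have "\<dots> = (\<integral>\<^sup>+(z::real^'n). ennreal ((1 + \<tau>) * J s) + ennreal ((\<tau> + \<tau>\<^sup>2) * L\<^sup>2 * (norm z)\<^sup>2) \<partial>std_gauss)"
    proof (rule nn_integral_cong)
      fix z :: "real^'n"
      have "(\<integral>\<^sup>+y. h (y, z) \<partial>lborel) = (\<integral>\<^sup>+y. ennreal ((1 + \<tau>) * (q y * (norm (W s y))\<^sup>2)) \<partial>lborel) + ennreal ((\<tau> + \<tau>\<^sup>2) * L\<^sup>2 * (norm z)\<^sup>2) * (\<integral>\<^sup>+y. ennreal (q y) \<partial>lborel)"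
        unfolding h_def prod.case by (subst nn_integral_add) (auto simp: nn_integral_cmult)
      also have "(\<integral>\<^sup>+y. ennreal ((1 + \<tau>) * (q y * (norm (W s y))\<^sup>2)) \<partial>lborel) = ennreal (1 + \<tau>) * ennreal (J s)"
        using \<tau> qn by (simp add: ennreal_mult nn_integral_cmult nJ[unfolded ennreal_mult'[OF qn]] )
      finally show "(\<integral>\<^sup>+y. h (y, z) \<partial>lborel) = ennreal ((1 + \<tau>) * J s) + ennreal ((\<tau> + \<tau>\<^sup>2) * L\<^sup>2 * (norm z)\<^sup>2)"
        using \<tau> J0 by (simp add: q1 ennreal_mult)
    qed
    also have "\<dots> = ennreal ((1 + \<tau>) * J s) + ennreal ((\<tau> + \<tau>\<^sup>2) * L\<^sup>2) * ennreal E2"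
      using \<tau> GG.emeasure_space_1 by (subst nn_integral_add) (auto simp: ennreal_mult nn_integral_cmult nE)
    also have "\<dots> = ennreal (c \<tau>)"
      using \<tau> J0 E0 by (simp add: c_def ennreal_mult ennreal_plus)
    finally show ?thesis by (simp add: \<tau>_def)
  qed
  have adm: "admissible_density (Q.p t)" if t: "t > 0" for t
    unfolding admissible_density_def
  proof (intro conjI allI)
    show "Q.p t \<in> borel_measurable borel" by (rule Q.p_meas[OF t])
    show "(\<integral>\<^sup>+x. ennreal (Q.p t x) \<partial>lborel) = 1" by (rule Q.nn_integral_p[OF t])
    show "Q.p t differentiable (at x)" for x using Q.p_deriv[OF t] by (auto simp: differentiable_def)
    have "grad (Q.p t) = Q.gp t" by (rule ext) (rule grad_eq[OF Q.p_deriv[OF t]])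
    then show "continuous_on UNIV (grad (Q.p t))"
      using Q.gp_cont[of UNIV "\<lambda>_. t" "\<lambda>x. x" t] t by simp
    define \<tau> where "\<tau> = sqrt (2 * t)"
    have i2: "integrable lborel (\<lambda>x. q x * (norm x)\<^sup>2)"
      unfolding q_def
    proof (rule integrable_rho_le[OF s, where C=1])
      show "\<bar>(norm x)\<^sup>2\<bar> \<le> 1 * (1 + norm x)\<^sup>2" for x :: "real^'n" using power_mono[of "norm x" "1 + norm x" 2] by simp
    qed auto
    define m2 where "m2 = (\<integral>x. q x * (norm x)\<^sup>2 \<partial>lborel)"
    have n2: "(\<integral>\<^sup>+x. ennreal (q x * (norm x)\<^sup>2) \<partial>lborel) = ennreal m2"
      unfolding m2_def using qn by (intro nn_integral_eq_integral i2) auto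
    have "(\<integral>\<^sup>+y. ennreal (Q.p t y * (norm y)\<^sup>2) \<partial>lborel) = (\<integral>\<^sup>+w. ennreal ((norm (fst w + \<tau> *\<^sub>R snd w))\<^sup>2) \<partial>Q.P)"
      using Q.nn_integral_Y[OF t, of "\<lambda>y. ennreal ((norm y)\<^sup>2)"] by (simp add: \<tau>_def ennreal_mult)
    also have "\<dots> \<le> (\<integral>\<^sup>+w. ennreal (2 * (norm (fst w))\<^sup>2) + ennreal (2 * \<tau>\<^sup>2 * (norm (snd w))\<^sup>2) \<partial>Q.P)"
    proof (rule nn_integral_mono)
      fix w :: "(real^'n) \<times> (real^'n)"
      have "(norm (fst w + \<tau> *\<^sub>R snd w))\<^sup>2 \<le> (norm (fst w) + \<bar>\<tau>\<bar> * norm (snd w))\<^sup>2"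
        using norm_triangle_ineq[of "fst w" "\<tau> *\<^sub>R snd w"] by (intro power_mono) auto
      also have "\<dots> \<le> 2 * (norm (fst w))\<^sup>2 + 2 * (\<bar>\<tau>\<bar> * norm (snd w))\<^sup>2"
        using zero_le_power2[of "norm (fst w) - \<bar>\<tau>\<bar> * norm (snd w)"] by (simp only: power2_sum power2_diff)
      finally show "ennreal ((norm (fst w + \<tau> *\<^sub>R snd w))\<^sup>2) \<le> ennreal (2 * (norm (fst w))\<^sup>2) + ennreal (2 * \<tau>\<^sup>2 * (norm (snd w))\<^sup>2)"
        by (simp add: power_mult_distrib ennreal_plus[symmetric] ennreal_leI del: ennreal_plus)
    qed
    also have "\<dots> = (\<integral>\<^sup>+x. \<integral>\<^sup>+z. ennreal (2 * (norm x)\<^sup>2) + ennreal (2 * \<tau>\<^sup>2 * (norm (z::real^'n))\<^sup>2) \<partial>std_gauss \<partial>\<mu>')"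
      by (subst GG.nn_integral_fst[symmetric]) simp_all
    also have "\<dots> = (\<integral>\<^sup>+x. ennreal (2 * (norm x)\<^sup>2) + ennreal (2 * \<tau>\<^sup>2) * ennreal E2 \<partial>\<mu>')"
      using GG.emeasure_space_1 by (simp add: nn_integral_add nn_integral_cmult ennreal_mult nE)
    also have "\<dots> = (\<integral>\<^sup>+x. ennreal (2 * (norm x)\<^sup>2) \<partial>\<mu>') + ennreal (2 * \<tau>\<^sup>2) * ennreal E2"
      using Q.emeasure_space_1 by (subst nn_integral_add) auto
    also have "(\<integral>\<^sup>+x. ennreal (2 * (norm x)\<^sup>2) \<partial>\<mu>') = 2 * ennreal m2"
      unfolding \<mu>'_def n2[symmetric] using qn
      by (subst nn_integral_density) (auto simp: nn_integral_cmult[symmetric] ennreal_mult mult_ac)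
    also have "2 * ennreal m2 + ennreal (2 * \<tau>\<^sup>2) * ennreal E2 < \<infinity>" by (simp add: ennreal_mult_less_top)
    finally show "(\<integral>\<^sup>+x. ennreal (Q.p t x * (norm x)\<^sup>2) \<partial>lborel) < \<infinity>" .
  qed simp
  have main: "Kd \<nu> (Q.p t) \<le> ennreal (1 / (2 * \<alpha>) * c (sqrt (2 * t)))" if t: "t > 0" for t
  proof -
    have c0: "c (sqrt (2 * t)) \<ge> 0" unfolding c_def using J0 E0 t by (intro add_nonneg_nonneg mult_nonneg_nonneg) auto
    have "enn2ereal (Kd \<nu> (Q.p t)) = KL_dens \<nu> (Q.p t)"
      by (rule KL_dens_eq[symmetric]) (use Q.p_meas[OF t] Q.nn_integral_p[OF t] prob in auto)
    also have "\<dots> \<le> ereal (1 / (2 * \<alpha>)) * enn2ereal (Fisher \<nu> (Q.p t))"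
      using lsi adm[OF t] by (auto simp: LSI_def)
    also have "\<dots> \<le> ereal (1 / (2 * \<alpha>)) * enn2ereal (ennreal (c (sqrt (2 * t))))"
      using alpha fisher[OF t] by (intro ereal_mult_left_mono) (auto simp: less_eq_ennreal.rep_eq)
    also have "\<dots> = enn2ereal (ennreal (1 / (2 * \<alpha>) * c (sqrt (2 * t))))"
      using alpha c0 by (simp add: enn2ereal_ennreal)
    finally show ?thesis by (simp only: less_eq_ennreal.rep_eq)
  qed
  define tn where "tn j = inverse (real (Suc j))" for j
  have tn0: "tn j > 0" for j by (simp add: tn_def)
  have tnl: "tn \<longlonglongrightarrow> 0" unfolding tn_def by (rule LIMSEQ_inverse_real_of_nat)
  have sql: "(\<lambda>j. sqrt (2 * tn j)) \<longlonglongrightarrow> 0" using tendsto_real_sqrt[OF tendsto_mult_left[OF tnl, of 2]] by simp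
  have cl: "(\<lambda>j. 1 / (2 * \<alpha>) * c (sqrt (2 * tn j))) \<longlonglongrightarrow> 1 / (2 * \<alpha>) * ((1 + 0) * J s + (0 + 0\<^sup>2) * L\<^sup>2 * E2)"
    unfolding c_def by (intro tendsto_intros sql)
  have pl: "(\<lambda>j. Q.p (tn j) y) \<longlonglongrightarrow> q y" for y
  proof -
    have "(\<lambda>j. \<integral>z. q (y + sqrt (2 * tn j) *\<^sub>R z) \<partial>std_gauss) \<longlonglongrightarrow> (\<integral>(z::real^'n). q y \<partial>std_gauss)"
    proof (rule integral_dominated_convergence[where w="\<lambda>_. C"])
      show "AE z in std_gauss. (\<lambda>j. q (y + sqrt (2 * tn j) *\<^sub>R z)) \<longlonglongrightarrow> q y"
      proof (rule AE_I2)
        fix z :: "real^'n"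
        have "(\<lambda>j. y + sqrt (2 * tn j) *\<^sub>R z) \<longlonglongrightarrow> y + 0 *\<^sub>R z" by (intro tendsto_intros sql)
        then have "(\<lambda>j. y + sqrt (2 * tn j) *\<^sub>R z) \<longlonglongrightarrow> y" by simp
        from isCont_tendsto_compose[OF has_derivative_continuous[OF qd] this]
        show "(\<lambda>j. q (y + sqrt (2 * tn j) *\<^sub>R z)) \<longlonglongrightarrow> q y" .
      qed
    qed (use qn qC in auto)
    then show ?thesis using tn0 GG.prob_space by (simp add: p_shift)
  qed
  \<comment> \<open>Lower semicontinuity on the left and convergence of the Fisher bound on the
    right carry the inequality to \<open>t = 0\<close>.\<close>
  have "Kd \<nu> q \<le> ennreal (1 / (2 * \<alpha>) * ((1 + 0) * J s + (0 + 0\<^sup>2) * L\<^sup>2 * E2))"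
    by (rule Kd_le_liminf[where r="\<lambda>j. Q.p (tn j)", OF _ _ _ q0 pl main[OF tn0] cl])
       (auto intro: Q.p_meas[OF tn0])
  then have "ennreal (H s) \<le> ennreal (1 / (2 * \<alpha>) * J s)"
    using Kd_rho[OF s] by (simp add: q_def)
  then have "H s \<le> 1 / (2 * \<alpha>) * J s" using J0 alpha by (subst (asm) ennreal_le_iff) auto
  then show ?thesis using alpha by (simp add: field_simps)
qed

end

section \<open>Exponential decay along the flow\<close>

text \<open>On a grid fine enough for uniform continuity, \<open>Phi s r\<close> may be replaced by
  \<open>Phi s s + \<eta>\<close>, and each step of length \<open>h\<close> gives
  \<open>(1 + \<alpha> h) (H s - K) <= H t - K\<close>. The product over \<open>N\<close> steps
  tends to the exponential, without any regularity of \<open>H\<close>.\<close>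

lemma implicit_euler_gronwall:
  fixes H :: "real \<Rightarrow> real" and Phi :: "real \<Rightarrow> real \<Rightarrow> real"
  assumes ab: "a < b" and \<alpha>: "\<alpha> > 0"
    and step: "\<And>t s. a \<le> t \<Longrightarrow> t < s \<Longrightarrow> s \<le> b \<Longrightarrow> \<exists>r. t < r \<and> r < s \<and> H s - H t \<le> (s - t) * Phi s r"
    and cont: "continuous_on ({a..b} \<times> {a..b}) (\<lambda>q. Phi (fst q) (snd q))"
    and diag: "\<And>s. a \<le> s \<Longrightarrow> s \<le> b \<Longrightarrow> Phi s s \<le> C - \<alpha> * H s"
  shows "H b \<le> C / \<alpha> + exp (- \<alpha> * (b - a)) * (H a - C / \<alpha>)"
proof -
  let ?E = "exp (\<alpha> * (b - a))"
  have eta: "?E * (H b - (C + \<eta>) / \<alpha>) \<le> H a - (C + \<eta>) / \<alpha>" if \<eta>: "\<eta> > 0" for \<eta>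
  proof -
    \<comment> \<open>The equilibrium of the perturbed inequality, which makes each step purely
      multiplicative.\<close>
    define K where "K = (C + \<eta>) / \<alpha>"
    have "uniformly_continuous_on ({a..b} \<times> {a..b}) (\<lambda>q. Phi (fst q) (snd q))"
      by (rule compact_uniformly_continuous[OF cont]) (intro compact_Times compact_Icc)
    then obtain \<delta> where \<delta>: "\<delta> > 0" and unif: "\<And>q q'. q \<in> {a..b} \<times> {a..b} \<Longrightarrow> q' \<in> {a..b} \<times> {a..b} \<Longrightarrow> dist q' q < \<delta> \<Longrightarrow>
        dist (Phi (fst q') (snd q')) (Phi (fst q) (snd q)) < \<eta>"
      using \<eta> unfolding uniformly_continuous_on_def by metis
    have stepK: "(1 + \<alpha> * (s - t)) * (H s - K) \<le> H t - K" if ts: "a \<le> t" "t < s" "s \<le> b" "s - t < \<delta>" for t s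
    proof -
      obtain r where r: "t < r" "r < s" and le: "H s - H t \<le> (s - t) * Phi s r" using step ts by blast
      have "dist (s, r) (s, s) < \<delta>" using r ts by (simp add: dist_Pair_Pair dist_real_def)
      then have "dist (Phi s r) (Phi s s) < \<eta>" using unif[of "(s, s)" "(s, r)"] r ts by auto
      then have "Phi s r \<le> C + \<eta> - \<alpha> * H s" using diag[of s] ts by (auto simp: dist_real_def)
      then have "(s - t) * Phi s r \<le> (s - t) * (C + \<eta> - \<alpha> * H s)" using ts by (intro mult_left_mono) auto
      also have "C + \<eta> - \<alpha> * H s = \<alpha> * (K - H s)" using \<alpha> by (simp add: K_def right_diff_distrib)
      finally show ?thesis using le by (simp add: algebra_simps)
    qed
    have N: "(1 + \<alpha> * (b - a) / real N) ^ N * (H b - K) \<le> H a - K" if N: "N > 0" "(b - a) / real N < \<delta>" for N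
    proof -
      define h where "h = (b - a) / real N"
      have h: "h > 0" "h < \<delta>" using ab N by (auto simp: h_def)
      have hN: "real N * h = b - a" using N by (simp add: h_def)
      have "i \<le> N \<Longrightarrow> (1 + \<alpha> * h) ^ i * (H (a + real i * h) - K) \<le> H a - K" for i
      proof (induction i)
        case (Suc i)
        have "real (Suc i) * h \<le> real N * h" using Suc.prems h by (intro mult_right_mono) auto
        then have le: "a + real (Suc i) * h \<le> b" using hN by simp
        have "(1 + \<alpha> * (a + real (Suc i) * h - (a + real i * h))) * (H (a + real (Suc i) * h) - K) \<le> H (a + real i * h) - K"
          by (rule stepK) (use h le in \<open>auto simp: distrib_right\<close>)
        then have "(1 + \<alpha> * h) * (H (a + real (Suc i) * h) - K) \<le> H (a + real i * h) - K"
          by (simp add: distrib_right)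
        then have "(1 + \<alpha> * h) ^ i * ((1 + \<alpha> * h) * (H (a + real (Suc i) * h) - K)) \<le> (1 + \<alpha> * h) ^ i * (H (a + real i * h) - K)"
          using \<alpha> h by (intro mult_left_mono) auto
        also have "\<dots> \<le> H a - K" using Suc by simp
        finally show ?case by (simp add: mult_ac)
      qed simp
      from this[of N] show ?thesis using hN by (simp add: h_def)
    qed
    have lim: "(\<lambda>N. (1 + \<alpha> * (b - a) / real N) ^ N * (H b - K)) \<longlonglongrightarrow> ?E * (H b - K)"
      by (intro tendsto_mult tendsto_exp_limit_sequentially tendsto_const)
    have "(\<lambda>N. (b - a) / real N) \<longlonglongrightarrow> 0" by (rule lim_const_over_n)
    then have "eventually (\<lambda>N. (b - a) / real N < \<delta>) sequentially" using \<delta> by (rule order_tendstoD)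
    then have "eventually (\<lambda>N. (1 + \<alpha> * (b - a) / real N) ^ N * (H b - K) \<le> H a - K) sequentially"
      using eventually_gt_at_top[of 0] by eventually_elim (rule N)
    with lim have "?E * (H b - K) \<le> H a - K" by (rule tendsto_upperbound) simp
    then show ?thesis by (simp add: K_def)
  qed
  have "?E * (H b - C / \<alpha>) \<le> H a - C / \<alpha>"
  proof (rule field_le_epsilon)
    fix e :: real assume e: "e > 0"
    \<comment> \<open>Chosen so that the perturbation contributes exactly \<open>e\<close> after
      multiplication by \<open>?E / \<alpha>\<close>.\<close>
    define \<eta> where "\<eta> = e * \<alpha> / ?E"
    have \<eta>: "\<eta> > 0" using e \<alpha> by (simp add: \<eta>_def)
    have "?E * (H b - C / \<alpha>) = ?E * (H b - (C + \<eta>) / \<alpha>) + ?E * (\<eta> / \<alpha>)"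
      by (simp add: add_divide_distrib algebra_simps)
    also have "?E * (\<eta> / \<alpha>) = e" using \<alpha> by (simp add: \<eta>_def)
    also have "?E * (H b - (C + \<eta>) / \<alpha>) \<le> H a - (C + \<eta>) / \<alpha>" by (rule eta[OF \<eta>])
    also have "H a - (C + \<eta>) / \<alpha> \<le> H a - C / \<alpha>" using \<eta> \<alpha> by (simp add: divide_right_mono)
    finally show "?E * (H b - C / \<alpha>) \<le> H a - C / \<alpha> + e" by simp
  qed
  then have "exp (- \<alpha> * (b - a)) * (?E * (H b - C / \<alpha>)) \<le> exp (- \<alpha> * (b - a)) * (H a - C / \<alpha>)"
    by (intro mult_left_mono) auto
  moreover have "exp (- \<alpha> * (b - a)) * (?E * (H b - C / \<alpha>)) = H b - C / \<alpha>"
    by (simp add: mult.assoc[symmetric] exp_add[symmetric])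
  ultimately show ?thesis by linarith
qed

context flow_lsi
begin

lemma H_decay:
  assumes a: "0 < a" "a < b" and b: "small b"
  shows "H b \<le> Cst b / \<alpha> + exp (- \<alpha> * (b - a)) * (H a - Cst b / \<alpha>)"
proof (rule implicit_euler_gronwall[OF a(2) alpha, where Phi=Phi])
  show "\<exists>r. t < r \<and> r < s \<and> H s - H t \<le> (s - t) * Phi s r" if "a \<le> t" "t < s" "s \<le> b" for t s
    by (rule H_mvt[OF a(1) b that])
  show "continuous_on ({a..b} \<times> {a..b}) (\<lambda>q. Phi (fst q) (snd q))" by (rule Phi_cont[OF a(1) b])
  fix s assume s: "a \<le> s" "s \<le> b"
  have s0: "s > 0" and ss: "small s" using s a b by (auto intro: small_le[of b])
  have "s\<^sup>2 \<le> b\<^sup>2" using s a by (intro power_mono) auto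
  then have "s\<^sup>2 * (256/49 * real CARD('n) * L ^ 3 + 8192/2401 * (real CARD('n) * M)\<^sup>2) \<le> Cst b"
    unfolding Cst_def using L_nonneg by (intro mult_right_mono add_nonneg_nonneg) auto
  then show "Phi s s \<le> Cst b - \<alpha> * H s" using Phi_diag[OF s0 ss] lsi_rho[OF s0 ss] by linarith
qed

end

section \<open>The limit of small times: reaching the initial entropy\<close>

locale flow_init = flow_lsi f L M "density lborel (\<lambda>x. ennreal (r0 x))" R \<alpha>
  for f :: "real^'n \<Rightarrow> real" and L M :: real and r0 :: "real^'n \<Rightarrow> real" and R \<alpha> :: real +
  assumes r0_meas[measurable]: "r0 \<in> borel_measurable borel" and r0_nonneg: "\<And>x. r0 x \<ge> 0"
    and r0_one: "(\<integral>\<^sup>+x. ennreal (r0 x) \<partial>lborel) = 1"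
    and r0_supp: "\<And>x. norm x > R \<Longrightarrow> r0 x = 0"
    and r0_ent: "integrable lborel (\<lambda>x. r0 x * ln (r0 x / \<nu> x))"
begin

interpretation GG: prob_space "std_gauss :: (real^'n) measure" by (rule prob_space_std_gauss)
interpretation PP: pair_prob_space "density lborel (\<lambda>x. ennreal (r0 x))" "std_gauss :: (real^'n) measure" ..

lemma r0_int: "integrable lborel r0"
  by (rule integrableI_nonneg) (auto simp: r0_one r0_nonneg)

lemma f_growth: obtains C where "C \<ge> 0" "\<And>x. \<bar>f x\<bar> \<le> C * (1 + norm x)\<^sup>2"
proof -
  have "\<bar>f x\<bar> \<le> (\<bar>f 0\<bar> + (norm (G 0) + L)) * (1 + norm x)\<^sup>2" for x
    by (rule gradient_growth_imp_quadratic[OF f_deriv G_growth']) (use L_nonneg in auto)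
  then show ?thesis using L_nonneg by (intro that[of "\<bar>f 0\<bar> + (norm (G 0) + L)"]) auto
qed

lemma r0_f_int: "integrable lborel (\<lambda>x. r0 x * f x)"
proof -
  obtain C where C: "C \<ge> 0" "\<And>x. \<bar>f x\<bar> \<le> C * (1 + norm x)\<^sup>2" using f_growth by metis
  show ?thesis
  proof (rule Bochner_Integration.integrable_bound[OF integrable_mult_right[OF r0_int, of "C * (1 + R)\<^sup>2"]])
    show "AE x in lborel. norm (r0 x * f x) \<le> norm (C * (1 + R)\<^sup>2 * r0 x)"
    proof (rule AE_I2)
      fix x
      show "norm (r0 x * f x) \<le> norm (C * (1 + R)\<^sup>2 * r0 x)"
      proof (cases "norm x \<le> R")
        case True
        have "\<bar>f x\<bar> \<le> C * (1 + norm x)\<^sup>2" by (rule C)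
        also have "\<dots> \<le> C * (1 + R)\<^sup>2" using C True by (intro mult_left_mono power_mono) auto
        finally have "r0 x * \<bar>f x\<bar> \<le> r0 x * (C * (1 + R)\<^sup>2)" using r0_nonneg by (intro mult_left_mono)
        then show ?thesis using r0_nonneg[of x] C(1) R0 by (simp add: abs_mult mult_ac)
      qed (simp add: r0_supp)
    qed
  qed measurable
qed

text \<open>On the bounded support \<open>f\<close> is bounded, so the entropy relative to the
  target splits into \<open>r0 ln r0\<close> and \<open>r0 f\<close>, both integrable. The first
  part decreases under the heat flow and the second passes to the limit by domination.\<close>

lemma r0_ln_int: "integrable lborel (\<lambda>x. r0 x * ln (r0 x))"
proof -
  have "r0 x * ln (r0 x) = r0 x * ln (r0 x / \<nu> x) - r0 x * f x" for x
    by (cases "r0 x = 0") (auto simp: ln_div algebra_simps)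
  then show ?thesis using r0_ent r0_f_int by simp
qed

definition "H0 = (\<integral>x. r0 x * ln (r0 x / \<nu> x) \<partial>lborel)"

lemma H0_eq: "H0 = (\<integral>x. r0 x * ln (r0 x) \<partial>lborel) + (\<integral>x. r0 x * f x \<partial>lborel)"
proof -
  have "r0 x * ln (r0 x / \<nu> x) = r0 x * ln (r0 x) + r0 x * f x" for x
    by (cases "r0 x = 0") (auto simp: ln_div algebra_simps)
  then show ?thesis unfolding H0_def using r0_ln_int r0_f_int by simp
qed

lemma integral_fst:
  fixes h :: "real^'n \<Rightarrow> real"
  assumes [measurable]: "h \<in> borel_measurable borel" and i: "integrable lborel (\<lambda>x. r0 x * h x)"
  shows "integrable P (\<lambda>w. h (fst w))" "(\<integral>w. h (fst w) \<partial>P) = (\<integral>x. r0 x * h x \<partial>lborel)"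
proof -
  have i': "integrable (density lborel (\<lambda>x. ennreal (r0 x))) h"
    using i r0_nonneg by (subst integrable_density) auto
  have d: "distr P (density lborel (\<lambda>x. ennreal (r0 x))) fst = density lborel (\<lambda>x. ennreal (r0 x))"
    by (rule GG.distr_pair_fst)
  show "integrable P (\<lambda>w. h (fst w))"
    using i' by (subst (asm) d[symmetric]) (subst (asm) integrable_distr_eq, auto)
  have "(\<integral>w. h (fst w) \<partial>P) = (\<integral>x. h x \<partial>distr P (density lborel (\<lambda>x. ennreal (r0 x))) fst)"
    by (rule integral_distr[symmetric]) auto
  also have "\<dots> = (\<integral>x. r0 x * h x \<partial>lborel)"
    unfolding d using r0_nonneg by (subst integral_density) auto
  finally show "(\<integral>w. h (fst w) \<partial>P) = (\<integral>x. r0 x * h x \<partial>lborel)" .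
qed

lemma Y_bound:
  assumes "0 < t" "t \<le> b" "norm (fst w) \<le> R"
  shows "1 + norm (Y t w) \<le> (1 + R + sqrt (2 * b)) * (1 + norm (snd w))"
proof -
  have "norm (Y t w) \<le> norm (fst w) + norm (sqrt (2 * t) *\<^sub>R snd w)" unfolding Y_def by (rule norm_triangle_ineq)
  also have "\<dots> \<le> R + sqrt (2 * b) * norm (snd w)" using assms by (intro add_mono) (auto intro!: mult_right_mono)
  finally have 1: "norm (Y t w) \<le> R + sqrt (2 * b) * norm (snd w)" .
  have "0 \<le> R * norm (snd w)" "0 \<le> sqrt (2 * b)" "0 \<le> norm (snd w)" using R0 assms by auto
  moreover have "(1 + R + sqrt (2 * b)) * (1 + norm (snd w)) = 1 + R + sqrt (2 * b) + norm (snd w) + R * norm (snd w) + sqrt (2 * b) * norm (snd w)"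
    by (simp add: algebra_simps)
  ultimately show ?thesis using 1 by linarith
qed

lemma ln_p_Y_int:
  assumes t: "t > 0" shows "integrable P (\<lambda>w. ln (p t (Y t w)))"
proof -
  define K where "K = (1 + R) / (2 * t)"
  have K: "K \<ge> 0" using R0 t by (simp add: K_def)
  have sb: "norm (score t y) \<le> K * (1 + norm y)" for y
  proof -
    have "norm (score t y) \<le> (norm y + R) / (2 * t)" by (rule score_bound[OF t])
    also have "\<dots> \<le> ((1 + R) * (1 + norm y)) / (2 * t)" using R0 t by (intro divide_right_mono) (auto simp: algebra_simps)
    finally show ?thesis by (simp add: K_def)
  qed
  define C where "C = \<bar>ln (p t 0)\<bar> + K"
  have C: "C \<ge> 0" using K by (simp add: C_def)
  have lnb: "\<bar>ln (p t y)\<bar> \<le> C * (1 + norm y)\<^sup>2" for y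
    unfolding C_def by (rule gradient_growth_imp_quadratic[OF lnp_deriv[OF t] sb K])
  show ?thesis
  proof (rule integrable_P_le[where C="C * (1 + R + sqrt (2 * t))\<^sup>2"])
    show "(\<lambda>w. ln (p t (Y t w))) \<in> borel_measurable (borel \<Otimes>\<^sub>M borel)" using p_meas[OF t] by measurable
    fix w :: "(real^'n) \<times> (real^'n)" assume w: "norm (fst w) \<le> R"
    have "\<bar>ln (p t (Y t w))\<bar> \<le> C * (1 + norm (Y t w))\<^sup>2" by (rule lnb)
    also have "\<dots> \<le> C * ((1 + R + sqrt (2 * t)) * (1 + norm (snd w)))\<^sup>2"
      using C Y_bound[OF t order.refl w] by (intro mult_left_mono power_mono) auto
    finally show "norm (ln (p t (Y t w))) \<le> C * (1 + R + sqrt (2 * t))\<^sup>2 * (1 + norm (snd w))\<^sup>2"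
      by (simp add: power_mult_distrib mult.assoc)
  qed (use C in auto)
qed

text \<open>\<open>ln u \<le> u - 1\<close> with \<open>u = p t (Y t w) / r0 (fst w)\<close>, whose expectation is at most 1.\<close>

lemma entropy_decreases:
  assumes t: "t > 0"
  shows "(\<integral>w. ln (p t (Y t w)) \<partial>P) \<le> (\<integral>x. r0 x * ln (r0 x) \<partial>lborel)"
proof -
  note [measurable] = p_meas[OF t]
  define g where "g w = p t (Y t w) / r0 (fst w)" for w
  have gm[measurable]: "g \<in> borel_measurable (borel \<Otimes>\<^sub>M borel)" unfolding g_def by measurable
  have g0: "g w \<ge> 0" for w unfolding g_def using p_nonneg r0_nonneg by simp
  have "(\<integral>\<^sup>+w. ennreal (g w) \<partial>P) = (\<integral>\<^sup>+x. \<integral>\<^sup>+z. ennreal (g (x, z)) \<partial>std_gauss \<partial>density lborel (\<lambda>x. ennreal (r0 x)))"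
    by (rule GG.nn_integral_fst[symmetric]) measurable
  also have "\<dots> = (\<integral>\<^sup>+x. ennreal (r0 x) * (\<integral>\<^sup>+z. ennreal (g (x, z)) \<partial>std_gauss) \<partial>lborel)"
    by (rule nn_integral_density) measurable
  \<comment> \<open>Where \<open>r0\<close> vanishes, division by zero gives \<open>g = 0\<close>,
    so cancelling \<open>r0\<close> yields only an inequality; translation invariance then gives
    total mass 1.\<close>
  also have "\<dots> \<le> (\<integral>\<^sup>+x. (\<integral>\<^sup>+z. ennreal (p t (x + sqrt (2 * t) *\<^sub>R z)) \<partial>std_gauss) \<partial>lborel)"
  proof (rule nn_integral_mono)
    fix x
    have "ennreal (r0 x) * (\<integral>\<^sup>+z. ennreal (g (x, z)) \<partial>std_gauss) = (\<integral>\<^sup>+z. ennreal (r0 x) * ennreal (g (x, z)) \<partial>std_gauss)"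
      by (rule nn_integral_cmult[symmetric]) measurable
    also have "\<dots> \<le> (\<integral>\<^sup>+z. ennreal (p t (x + sqrt (2 * t) *\<^sub>R z)) \<partial>std_gauss)"
      using r0_nonneg g0 by (intro nn_integral_mono) (auto simp: g_def Y_def ennreal_mult[symmetric])
    finally show "ennreal (r0 x) * (\<integral>\<^sup>+z. ennreal (g (x, z)) \<partial>std_gauss) \<le> (\<integral>\<^sup>+z. ennreal (p t (x + sqrt (2 * t) *\<^sub>R z)) \<partial>std_gauss)" .
  qed
  also have "\<dots> = (\<integral>\<^sup>+(z::real^'n). \<integral>\<^sup>+x. ennreal (p t x) \<partial>lborel \<partial>std_gauss)"
    using nn_integral_gauss_shift_swap[of "\<lambda>w. ennreal (p t (fst w))" "sqrt (2 * t)"] by simp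
  also have "\<dots> = 1" using nn_integral_p[OF t] GG.emeasure_space_1 by simp
  finally have g1: "(\<integral>\<^sup>+w. ennreal (g w) \<partial>P) \<le> 1" .
  have gi: "integrable P g"
    by (rule integrableI_nonneg[OF meas_P[OF gm]]) (use g0 g1 in \<open>auto intro: le_less_trans[OF _ ennreal_one_less_top]\<close>)
  have gI: "(\<integral>w. g w \<partial>P) \<le> 1"
  proof -
    have "ennreal (\<integral>w. g w \<partial>P) \<le> ennreal 1" using g1 g0 nn_integral_eq_integral[OF gi] by simp
    then show ?thesis by (subst (asm) ennreal_le_iff) auto
  qed
  have pos: "AE w in P. r0 (fst w) > 0"
  proof -
    have "AE x in density lborel (\<lambda>x. ennreal (r0 x)). r0 x > 0"
      by (subst AE_density) (auto simp: ennreal_less_zero_iff)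
    then have "AE x in distr P (density lborel (\<lambda>x. ennreal (r0 x))) fst. r0 x > 0"
      unfolding GG.distr_pair_fst .
    then show ?thesis by (subst (asm) AE_distr_iff) auto
  qed
  note lf = integral_fst[of "\<lambda>x. ln (r0 x)", OF _ r0_ln_int]
  have "(\<integral>w. ln (p t (Y t w)) - ln (r0 (fst w)) \<partial>P) \<le> (\<integral>w. g w - 1 \<partial>P)"
  proof (rule integral_mono_AE)
    show "AE w in P. ln (p t (Y t w)) - ln (r0 (fst w)) \<le> g w - 1"
      using pos
    proof eventually_elim
      case (elim w)
      have "ln (p t (Y t w)) - ln (r0 (fst w)) = ln (g w)" unfolding g_def using p_pos[OF t, of "Y t w"] elim by (simp add: ln_div)
      also have "\<dots> \<le> g w - 1" unfolding g_def using p_pos[OF t] elim by (intro ln_le_minus_one) auto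
      finally show ?case .
    qed
  qed (use ln_p_Y_int[OF t] lf gi in auto)
  also have "\<dots> = (\<integral>w. g w \<partial>P) - 1" using gi PP.prob_space by simp
  finally show ?thesis using gI ln_p_Y_int[OF t] lf by simp
qed

text \<open>An upper bound that tends to \<open>H0\<close> as \<open>t\<close> tends to 0, since the
  log-determinant contributes only order \<open>t\<close>. It takes the place of continuity of
  \<open>H\<close> at 0, where only one direction is required.\<close>

lemma H_le:
  assumes t: "t > 0" "small t"
  shows "H t \<le> (\<integral>x. r0 x * ln (r0 x) \<partial>lborel) + 8 / 7 * real CARD('n) * (t * L) + (\<integral>w. f (X t (Y t w)) \<partial>P)"
proof -
  note [measurable] = X_meas[OF t(2)] p_meas[OF t(1)]
  obtain C where C: "C \<ge> 0" "\<And>x. \<bar>f x\<bar> \<le> C * (1 + norm x)\<^sup>2" using f_growth by metis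
  have fi: "integrable P (\<lambda>w. f (X t (Y t w)))"
    by (subst integral_XY(2)[OF t]) (use integrable_rho_le[OF t _ C(2,1)] in auto)
  let ?l = "8 / 7 * real CARD('n) * (t * L)"
  have Di: "integrable P (\<lambda>w. ln (D t (X t (Y t w))))"
    by (rule PP.integrable_const_bound[where B="?l"]) (use lnD_bound[OF t(2)] t in auto)
  have "H t = m t t" unfolding H_def using m_eq[OF t t] by simp
  also have "\<dots> = (\<integral>w. ln (p t (Y t w)) + ln (D t (X t (Y t w))) + f (X t (Y t w)) \<partial>P)"
    unfolding m_def Psi_def using t by simp
  also have "\<dots> = (\<integral>w. ln (p t (Y t w)) \<partial>P) + (\<integral>w. ln (D t (X t (Y t w))) \<partial>P) + (\<integral>w. f (X t (Y t w)) \<partial>P)"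
    using ln_p_Y_int[OF t(1)] Di fi by simp
  also have "(\<integral>w. ln (D t (X t (Y t w))) \<partial>P) \<le> (\<integral>w. ?l \<partial>P)"
  proof (rule integral_mono[OF Di])
    show "ln (D t (X t (Y t w))) \<le> ?l" for w using lnD_bound[OF t(2), of "X t (Y t w)"] t by simp
  qed simp
  also have "\<dots> = ?l" using PP.prob_space by simp
  finally show ?thesis using entropy_decreases[OF t(1)] by linarith
qed

lemma f_XY_limit:
  assumes b: "small b" and t: "\<And>j. 0 < t j" "\<And>j. t j \<le> b" and lim: "t \<longlonglongrightarrow> 0"
  shows "(\<lambda>j. \<integral>w. f (X (t j) (Y (t j) w)) \<partial>P) \<longlonglongrightarrow> (\<integral>x. r0 x * f x \<partial>lborel)"
proof -
  have b0: "b > 0" using t[of 0] by simp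
  have smt: "small (t j)" for j using b t[of j] by (auto intro: small_le[of b])
  obtain C where C: "C \<ge> 0" "\<And>x. \<bar>f x\<bar> \<le> C * (1 + norm x)\<^sup>2" using f_growth by metis
  define c where "c = 2 * (1 + b * norm (G 0)) * (1 + R + sqrt (2 * b))"
  have ar: "1 + u \<le> 2 * (1 + g) * (1 + v)" if "u \<le> 8 / 7 * (v + g)" "0 \<le> v" "0 \<le> g" for u g v :: real
  proof -
    have "0 \<le> g * v" using that by simp
    moreover have "7 * u \<le> 8 * v + 8 * g" using that(1) by simp
    ultimately have "1 + u \<le> 2 + 2 * v + 2 * g + 2 * (g * v)" using that(2,3) by linarith
    also have "\<dots> = 2 * (1 + g) * (1 + v)" by (simp add: algebra_simps)
    finally show ?thesis .
  qed
  have Xb: "1 + norm (X (t j) (Y (t j) w)) \<le> c * (1 + norm (snd w))" if w: "norm (fst w) \<le> R" for j w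
  proof -
    have "norm (X (t j) (Y (t j) w)) \<le> 8 / 7 * (norm (Y (t j) w) + \<bar>t j\<bar> * norm (G 0))" by (rule X_growth[OF smt])
    also have "\<dots> \<le> 8 / 7 * (norm (Y (t j) w) + b * norm (G 0))"
      using t[of j] t(2)[of j] by (intro mult_left_mono add_left_mono mult_right_mono) auto
    finally have Xle: "norm (X (t j) (Y (t j) w)) \<le> 8 / 7 * (norm (Y (t j) w) + b * norm (G 0))" .
    have "1 + norm (X (t j) (Y (t j) w)) \<le> 2 * (1 + b * norm (G 0)) * (1 + norm (Y (t j) w))"
      by (rule ar[OF Xle]) (use b0 in auto)
    also have "\<dots> \<le> 2 * (1 + b * norm (G 0)) * ((1 + R + sqrt (2 * b)) * (1 + norm (snd w)))"
      using b0 by (intro mult_left_mono Y_bound[OF t w]) auto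
    finally show ?thesis by (simp add: c_def mult.assoc)
  qed
  have "(\<lambda>j. \<integral>w. f (X (t j) (Y (t j) w)) \<partial>P) \<longlonglongrightarrow> (\<integral>w. f (fst w) \<partial>P)"
  proof (rule integral_dominated_convergence[where w="\<lambda>w. C * c\<^sup>2 * (1 + norm (snd w)) ^ 4"])
    show "AE w in P. (\<lambda>j. f (X (t j) (Y (t j) w))) \<longlonglongrightarrow> f (fst w)"
    proof (rule AE_I2)
      fix w :: "(real^'n) \<times> (real^'n)"
      have sq: "(\<lambda>j. sqrt (2 * t j)) \<longlonglongrightarrow> 0" using tendsto_real_sqrt[OF tendsto_mult_left[OF lim, of 2]] by simp
      \<comment> \<open>Since \<open>fst w\<close> equals \<open>X (t j) (T (t j) (fst w))\<close>,
        the Lipschitz bound of \<open>X\<close> at one time compares \<open>Y\<close> with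
        \<open>T\<close>.\<close>
      have "(\<lambda>j. X (t j) (Y (t j) w)) \<longlonglongrightarrow> fst w"
      proof (rule Lim_null_comparison[THEN LIM_zero_cancel])
        have "(\<lambda>j. 8 / 7 * norm (sqrt (2 * t j) *\<^sub>R snd w - t j *\<^sub>R G (fst w))) \<longlonglongrightarrow> 8 / 7 * norm (0 *\<^sub>R snd w - 0 *\<^sub>R G (fst w))"
          by (intro tendsto_intros sq lim)
        then show "(\<lambda>j. 8 / 7 * norm (sqrt (2 * t j) *\<^sub>R snd w - t j *\<^sub>R G (fst w))) \<longlonglongrightarrow> 0" by simp
        show "\<forall>\<^sub>F j in sequentially. norm (X (t j) (Y (t j) w) - fst w) \<le> 8 / 7 * norm (sqrt (2 * t j) *\<^sub>R snd w - t j *\<^sub>R G (fst w))"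
        proof (rule always_eventually, rule allI)
          fix j
          have "norm (X (t j) (Y (t j) w) - X (t j) (T (t j) (fst w))) \<le> 8 / 7 * norm (Y (t j) w - T (t j) (fst w))"
            by (rule X_lip[OF smt])
          then show "norm (X (t j) (Y (t j) w) - fst w) \<le> 8 / 7 * norm (sqrt (2 * t j) *\<^sub>R snd w - t j *\<^sub>R G (fst w))"
            unfolding X_T[OF smt] by (simp add: Y_def T_def)
        qed
      qed
      from isCont_tendsto_compose[OF has_derivative_continuous[OF f_deriv] this]
      show "(\<lambda>j. f (X (t j) (Y (t j) w))) \<longlonglongrightarrow> f (fst w)" .
    qed
    show "AE w in P. norm (f (X (t j) (Y (t j) w))) \<le> C * c\<^sup>2 * (1 + norm (snd w)) ^ 4" for j
      using supp_P
    proof eventually_elim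
      case (elim w)
      have "\<bar>f (X (t j) (Y (t j) w))\<bar> \<le> C * (1 + norm (X (t j) (Y (t j) w)))\<^sup>2" by (rule C)
      also have "\<dots> \<le> C * (c * (1 + norm (snd w)))\<^sup>2" using C by (intro mult_left_mono power_mono Xb elim) auto
      also have "\<dots> = C * c\<^sup>2 * (1 + norm (snd w))\<^sup>2" by (simp add: power_mult_distrib)
      also have "\<dots> \<le> C * c\<^sup>2 * (1 + norm (snd w)) ^ 4" using C by (intro mult_left_mono pow_le_4) auto
      finally show ?case by simp
    qed
    show "integrable P (\<lambda>w. C * c\<^sup>2 * (1 + norm (snd w)) ^ 4)"
      by (intro integrable_mult_right integrable_moment_P)
    show "(\<lambda>w. f (X (t j) (Y (t j) w))) \<in> borel_measurable P" for j
      using XY_meas[OF smt[of j]] by measurable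
  qed measurable
  then show ?thesis using integral_fst(2)[OF f_G_meas(1) r0_f_int] by simp
qed

lemma H_final:
  assumes b: "0 < b" "small b"
  shows "H b \<le> Cst b / \<alpha> + exp (- \<alpha> * b) * (H0 - Cst b / \<alpha>)"
proof -
  \<comment> \<open>The denominator starts at 2, so that \<open>t j\<close> is strictly below
    \<open>b\<close>, as \<open>H_decay\<close> demands.\<close>
  define t where "t j = b / real (Suc (Suc j))" for j
  have t: "0 < t j" "t j < b" for j using b by (auto simp: t_def divide_less_eq)
  have lim: "t \<longlonglongrightarrow> 0"
    unfolding t_def using LIMSEQ_Suc[OF LIMSEQ_Suc[OF lim_const_over_n[of b]]] by simp
  define U where "U j = (\<integral>x. r0 x * ln (r0 x) \<partial>lborel) + 8 / 7 * real CARD('n) * (t j * L) + (\<integral>w. f (X (t j) (Y (t j) w)) \<partial>P)" for j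
  have "U \<longlonglongrightarrow> (\<integral>x. r0 x * ln (r0 x) \<partial>lborel) + 8 / 7 * real CARD('n) * (0 * L) + (\<integral>x. r0 x * f x \<partial>lborel)"
    unfolding U_def using t by (intro tendsto_intros lim f_XY_limit[OF b(2)]) (auto simp: less_imp_le)
  then have Ul: "U \<longlonglongrightarrow> H0" by (simp add: H0_eq)
  have le: "H b \<le> Cst b / \<alpha> + exp (- \<alpha> * (b - t j)) * (U j - Cst b / \<alpha>)" for j
  proof -
    have "small (t j)" using b t[of j] by (auto intro: small_le[of b])
    then have "H (t j) \<le> U j" unfolding U_def using t by (intro H_le) auto
    then have "exp (- \<alpha> * (b - t j)) * (H (t j) - Cst b / \<alpha>) \<le> exp (- \<alpha> * (b - t j)) * (U j - Cst b / \<alpha>)"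
      by (intro mult_left_mono) auto
    then show ?thesis using H_decay[OF t b(2), of j] by linarith
  qed
  have "(\<lambda>j. Cst b / \<alpha> + exp (- \<alpha> * (b - t j)) * (U j - Cst b / \<alpha>)) \<longlonglongrightarrow> Cst b / \<alpha> + exp (- \<alpha> * (b - 0)) * (H0 - Cst b / \<alpha>)"
    by (intro tendsto_intros lim Ul)
  then have "H b \<le> Cst b / \<alpha> + exp (- \<alpha> * (b - 0)) * (H0 - Cst b / \<alpha>)"
    by (rule tendsto_lowerbound, intro always_eventually allI le) simp
  then show ?thesis by simp
qed

end

context flow_init
begin

lemma Kd_step:
  assumes b: "0 < b" "small b"
  shows "Kd \<nu> (\<lambda>x. p b (T b x) * D b x) \<le> ennreal (Cst b / \<alpha> + exp (- \<alpha> * b) * (H0 - Cst b / \<alpha>))"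
proof -
  have "(\<lambda>x. p b (T b x) * D b x) = rho b" by (simp add: rho_def fun_eq_iff)
  then show ?thesis using Kd_rho(1)[OF b] H_final[OF b] by (simp add: ennreal_leI)
qed

end

section \<open>The iterates of the algorithm\<close>

context lsi_target
begin

lemma bias_nonneg: "bias \<epsilon> \<ge> 0"
  unfolding bias_def Cst_def using L_nonneg alpha by (intro divide_nonneg_nonneg mult_nonneg_nonneg add_nonneg_nonneg) auto

lemma heat_density:
  assumes "r \<in> borel_measurable borel" "(\<integral>\<^sup>+x. ennreal (r x) \<partial>lborel) = 1"
  shows "heat (density lborel (\<lambda>x::real^'n. ennreal (r x)))"
  by (intro heat.intro prob_spaceI heat_axioms.intro) (use assms in \<open>simp_all add: emeasure_density\<close>)

lemma heat_p_density:
  assumes [measurable]: "r \<in> borel_measurable borel" and r: "\<And>x. r x \<ge> 0" "(\<integral>\<^sup>+x. ennreal (r x) \<partial>lborel) = 1"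
  shows "heat.p (density lborel (\<lambda>x::real^'n. ennreal (r x))) t y = (\<integral>x. r x * gauss t (y - x) \<partial>lborel)"
  unfolding heat.p_def[OF heat_density[OF assms(1,3)]]
  using r(1) by (subst integral_density) auto

text \<open>The conclusion of \<open>flow_init\<close> with the heat flow written as an explicit
  integral, so that it can be used for a whole sequence of truncated densities.\<close>

lemma Kd_step_compact:
  assumes b: "0 < b" "small b" and R: "0 \<le> R" and m[measurable]: "r \<in> borel_measurable borel"
    and r: "\<And>x. r x \<ge> 0" "(\<integral>\<^sup>+x. ennreal (r x) \<partial>lborel) = 1" "\<And>x. norm x > R \<Longrightarrow> r x = 0"
    and i: "integrable lborel (\<lambda>x. r x * ln (r x / \<nu> x))"
  shows "Kd \<nu> (\<lambda>x. (\<integral>u. r u * gauss b (T b x - u) \<partial>lborel) * D b x)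
    \<le> ennreal (bias b + exp (- \<alpha> * b) * ((\<integral>x. r x * ln (r x / \<nu> x) \<partial>lborel) - bias b))"
proof -
  interpret hd: heat "density lborel (\<lambda>x. ennreal (r x))" by (rule heat_density[OF m r(2)])
  interpret fi: flow_init f L M r R \<alpha>
  proof
    show "AE x in density lborel (\<lambda>x. ennreal (r x)). norm x \<le> R"
      by (subst AE_density) (auto intro!: AE_I2 simp: r(3) not_le[symmetric] dest: r(3) elim: contrapos_np)
  qed (use R prob alpha lsi r i in auto)
  have "hd.p t y = (\<integral>x. r x * gauss t (y - x) \<partial>lborel)" for t y by (rule heat_p_density[OF m r(1,2)])
  then show ?thesis
    using fi.Kd_step[OF b] unfolding fi.H0_def bias_def by (simp add: mult.commute)
qed

text \<open>Restrict \<open>r\<close> to balls, renormalise, apply \<open>Kd_step_compact\<close>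
  and let the radius grow. The hypothesis asks for an upper bound \<open>h\<close> of the entropy,
  not its value, so that the bound obtained here can be fed into the next step.\<close>

lemma one_step:
  assumes e: "\<epsilon> > 0" "8 * L * \<epsilon> \<le> 1" and m[measurable]: "r \<in> borel_measurable borel"
    and r: "\<And>x. r x \<ge> 0" "(\<integral>\<^sup>+x. ennreal (r x) \<partial>lborel) = 1" and h: "h \<ge> 0" "Kd \<nu> r \<le> ennreal h"
  shows "\<exists>r'. r' \<in> borel_measurable borel \<and> (\<forall>x. r' x \<ge> 0) \<and> (\<integral>\<^sup>+x. ennreal (r' x) \<partial>lborel) = 1 \<and>
     distr (density lborel (\<lambda>x. ennreal (r x)) \<Otimes>\<^sub>M std_gauss) borel (\<lambda>(x, z). prox \<epsilon> f (x + sqrt (2 * \<epsilon>) *\<^sub>R z))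
       = density lborel (\<lambda>x. ennreal (r' x)) \<and>
     Kd \<nu> r' \<le> ennreal (bias \<epsilon> + exp (- \<alpha> * \<epsilon>) * (h - bias \<epsilon>))"
proof -
  have s: "small \<epsilon>" using e by (simp add: small_def mult_ac)
  define \<mu> where "\<mu> = density lborel (\<lambda>x. ennreal (r x))"
  interpret Q: heat \<mu> unfolding \<mu>_def by (rule heat_density[OF m r(2)])
  define r' where "r' x = Q.p \<epsilon> (T \<epsilon> x) * D \<epsilon> x" for x
  note [measurable] = Q.p_meas[OF e(1)] X_meas[OF s]
  have r'm[measurable]: "r' \<in> borel_measurable borel" unfolding r'_def by measurable
  have r'0: "r' x > 0" for x unfolding r'_def using Q.p_pos[OF e(1)] D_pos[OF s] by simp
  have r'1: "(\<integral>\<^sup>+x. ennreal (r' x) \<partial>lborel) = 1"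
    unfolding r'_def using nn_integral_pushforward[OF s Q.p_meas[OF e(1)] Q.p_nonneg Q.integrable_p[OF e(1)]] Q.nn_integral_p[OF e(1)] by simp
  have law: "distr (\<mu> \<Otimes>\<^sub>M std_gauss) borel (\<lambda>(x, z). prox \<epsilon> f (x + sqrt (2 * \<epsilon>) *\<^sub>R z)) = density lborel (\<lambda>x. ennreal (r' x))"
  proof -
    have "distr (\<mu> \<Otimes>\<^sub>M std_gauss) borel (\<lambda>(x, z). prox \<epsilon> f (x + sqrt (2 * \<epsilon>) *\<^sub>R z))
       = distr (distr (\<mu> \<Otimes>\<^sub>M std_gauss) borel (\<lambda>w. fst w + sqrt (2 * \<epsilon>) *\<^sub>R snd w)) borel (X \<epsilon>)"
      by (subst distr_distr) (auto simp: o_def prox_eq_X[OF e] case_prod_beta')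
    also have "\<dots> = density lborel (\<lambda>x. ennreal (r' x))"
      unfolding Q.distr_Y[OF e(1)] r'_def using s e by (intro distr_X Q.integrable_p) auto
    finally show ?thesis .
  qed
  have r_int: "integrable lborel r" by (rule integrableI_nonneg) (auto simp: r)
  have r_one: "(\<integral>x. r x \<partial>lborel) = 1"
  proof -
    have "ennreal (\<integral>x. r x \<partial>lborel) = 1" using nn_integral_eq_integral[OF r_int] r by simp
    then show ?thesis by (simp add: ennreal_eq_1)
  qed
  have Kfin: "Kd \<nu> r < \<infinity>" using h(2) by (simp add: le_less_trans[OF _ ennreal_less_top])
  have ent: "integrable lborel (\<lambda>x. r x * ln (r x / \<nu> x))"
    by (rule Kd_integrable[OF _ m _ \<nu>_int r(1) r_int Kfin]) auto
  define h' where "h' = (\<integral>x. r x * ln (r x / \<nu> x) \<partial>lborel)"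
  have h': "Kd \<nu> r = ennreal h'" "0 \<le> h'"
    unfolding h'_def by (rule Kd_eq_integral[OF _ \<nu>_int \<nu>_one r(1) r_int r_one ent], simp)+
  then have h'h: "h' \<le> h" using h by (simp add: ennreal_le_iff)
  define S where "S j = cball (0::real^'n) (real j)" for j
  have Sm[measurable]: "S j \<in> sets borel" for j unfolding S_def by simp
  have Sl: "(\<lambda>j. indicat_real (S j) x) \<longlonglongrightarrow> 1" for x
  proof -
    obtain N where N: "norm x \<le> real N" using real_arch_simple by blast
    have "\<forall>\<^sub>F j in sequentially. indicat_real (S j) x = 1"
      using eventually_ge_at_top[of N] by eventually_elim (use N in \<open>auto simp: S_def indicator_def\<close>)
    then show ?thesis by (rule tendsto_eventually)
  qed
  have lim_S: "(\<lambda>j. \<integral>x. g x * indicat_real (S j) x \<partial>lborel) \<longlonglongrightarrow> (\<integral>x. g x \<partial>lborel)"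
    and int_S: "integrable lborel (\<lambda>x. g x * indicat_real (S j) x)"
    if g: "integrable lborel g" for g :: "real^'n \<Rightarrow> real" and j
  proof -
    have gm[measurable]: "g \<in> borel_measurable borel" using borel_measurable_integrable[OF g] by simp
    show "(\<lambda>j. \<integral>x. g x * indicat_real (S j) x \<partial>lborel) \<longlonglongrightarrow> (\<integral>x. g x \<partial>lborel)"
    proof (rule integral_dominated_convergence[where w="\<lambda>x. norm (g x)"])
      show "AE x in lborel. (\<lambda>j. g x * indicat_real (S j) x) \<longlonglongrightarrow> g x"
      proof (rule AE_I2)
        fix x show "(\<lambda>j. g x * indicat_real (S j) x) \<longlonglongrightarrow> g x"
          using tendsto_mult[OF tendsto_const[of "g x"] Sl[of x]] by simp
      qed
    qed (use g in \<open>auto simp: indicator_def\<close>)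
    show "integrable lborel (\<lambda>x. g x * indicat_real (S j) x)"
      by (rule Bochner_Integration.integrable_bound[OF g]) (auto simp: indicator_def)
  qed
  define mj where "mj j = (\<integral>x. r x * indicat_real (S j) x \<partial>lborel)" for j
  have ml: "mj \<longlonglongrightarrow> 1" unfolding mj_def using lim_S[OF r_int] r_one by simp
  have "\<forall>\<^sub>F j in sequentially. mj j > 0" using ml by (rule order_tendstoD) simp
  then obtain N where N: "\<And>j. j \<ge> N \<Longrightarrow> mj j > 0" by (auto simp: eventually_sequentially)
  \<comment> \<open>Starts the sequence of radii where the truncated masses are positive.\<close>
  define k where "k j = j + N" for j
  have mk: "mj (k j) > 0" for j using N by (simp add: k_def)
  define rr where "rr j x = r x * indicat_real (S (k j)) x / mj (k j)" for j x
  have rrm[measurable]: "rr j \<in> borel_measurable borel" for j unfolding rr_def by measurable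
  have rr0: "rr j x \<ge> 0" for j x unfolding rr_def using r(1) mk[of j] by (simp add: less_imp_le)
  have rri: "integrable lborel (rr j)" for j unfolding rr_def by (intro integrable_divide int_S r_int)
  have rr1: "(\<integral>\<^sup>+x. ennreal (rr j x) \<partial>lborel) = 1" for j
  proof -
    have "(\<integral>x. rr j x \<partial>lborel) = 1" unfolding rr_def using mk[of j] by (simp add: mj_def[symmetric])
    then show ?thesis using nn_integral_eq_integral[OF rri[of j]] rr0 by simp
  qed
  \<comment> \<open>Dividing the density by its mass subtracts the logarithm of the mass from the
    log-ratio; outside the ball, and where \<open>r\<close> vanishes, both sides are 0. This gives
    convergence of the truncated entropies to that of \<open>r\<close>.\<close>
  have rr_ent_eq: "rr j x * ln (rr j x / \<nu> x) = (r x * ln (r x / \<nu> x)) * indicat_real (S (k j)) x / mj (k j)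
      - ln (mj (k j)) * (r x * indicat_real (S (k j)) x / mj (k j))" for j x
  proof (cases "r x = 0 \<or> x \<notin> S (k j)")
    case False
    then have rx: "r x > 0" using r(1)[of x] by simp
    have "ln (r x / mj (k j) / \<nu> x) = ln (r x / \<nu> x) - ln (mj (k j))" 
    proof -
      have eq: "r x / mj (k j) / \<nu> x = (r x / \<nu> x) / mj (k j)" by simp
      show ?thesis unfolding eq by (rule ln_divide_pos) (use rx mk[of j] in auto)
    qed
    moreover have "a / c * (u - v) = a * u / c - v * (a / c)" for a c u v :: real
      by (simp add: right_diff_distrib)
    ultimately show ?thesis using False by (simp add: rr_def)
  qed (auto simp: rr_def)
  have rr_ent: "integrable lborel (\<lambda>x. rr j x * ln (rr j x / \<nu> x))" for j
    unfolding rr_ent_eq by (intro Bochner_Integration.integrable_diff integrable_divide integrable_mult_right int_S ent r_int)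
  define hj where "hj j = (\<integral>x. rr j x * ln (rr j x / \<nu> x) \<partial>lborel)" for j
  have hj_eq: "hj j = (\<integral>x. (r x * ln (r x / \<nu> x)) * indicat_real (S (k j)) x \<partial>lborel) / mj (k j) - ln (mj (k j))" for j
  proof -
    have "hj j = (\<integral>x. (r x * ln (r x / \<nu> x)) * indicat_real (S (k j)) x / mj (k j) \<partial>lborel)
        - (\<integral>x. ln (mj (k j)) * (r x * indicat_real (S (k j)) x / mj (k j)) \<partial>lborel)"
      unfolding hj_def rr_ent_eq
      by (intro Bochner_Integration.integral_diff integrable_divide integrable_mult_right int_S ent r_int)
    then show ?thesis using mk[of j] by (simp add: mj_def[symmetric])
  qed
  have kl: "filterlim k at_top sequentially" unfolding k_def by (rule filterlim_add_const_nat_at_top)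
  have mkl: "(\<lambda>j. mj (k j)) \<longlonglongrightarrow> 1" using filterlim_compose[OF ml kl] .
  have "(\<lambda>j. (\<integral>x. (r x * ln (r x / \<nu> x)) * indicat_real (S (k j)) x \<partial>lborel) / mj (k j) - ln (mj (k j))) \<longlonglongrightarrow> h' / 1 - ln 1"
    unfolding h'_def using mkl
    by (intro tendsto_intros filterlim_compose[OF lim_S[OF ent] kl]) auto
  then have hjl: "hj \<longlonglongrightarrow> h'" by (simp add: hj_eq[abs_def])
  define q where "q j x = (\<integral>u. rr j u * gauss \<epsilon> (T \<epsilon> x - u) \<partial>lborel) * D \<epsilon> x" for j x
  have qm: "q j \<in> borel_measurable borel" for j
  proof -
    interpret hd: heat "density lborel (\<lambda>x. ennreal (rr j x))" by (rule heat_density[OF rrm rr1])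
    have "q j = (\<lambda>x. hd.p \<epsilon> (T \<epsilon> x) * D \<epsilon> x)" unfolding q_def using heat_p_density[OF rrm rr0 rr1] by simp
    then show ?thesis using hd.p_meas[OF e(1)] by simp
  qed
  have qb: "Kd \<nu> (q j) \<le> ennreal (bias \<epsilon> + exp (- \<alpha> * \<epsilon>) * (hj j - bias \<epsilon>))" for j
    unfolding q_def hj_def
    by (rule Kd_step_compact[OF e(1) s _ rrm rr0 rr1 _ rr_ent, where R="real (k j)"])
       (auto simp: rr_def S_def indicator_def)
  have ql: "(\<lambda>j. q j x) \<longlonglongrightarrow> r' x" for x
  proof -
    have gi: "integrable lborel (\<lambda>u. r u * gauss \<epsilon> (T \<epsilon> x - u))"
    proof (rule Bochner_Integration.integrable_bound[OF integrable_mult_right[OF r_int, of "(4 * pi * \<epsilon>) powr (- real CARD('n) / 2)"]])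
      show "AE u in lborel. norm (r u * gauss \<epsilon> (T \<epsilon> x - u)) \<le> norm ((4 * pi * \<epsilon>) powr (- real CARD('n) / 2) * r u)"
      proof (rule AE_I2)
        fix u
        have "r u * gauss \<epsilon> (T \<epsilon> x - u) \<le> r u * (4 * pi * \<epsilon>) powr (- real CARD('n) / 2)"
          using r(1) e by (intro mult_left_mono gauss_le) auto
        then show "norm (r u * gauss \<epsilon> (T \<epsilon> x - u)) \<le> norm ((4 * pi * \<epsilon>) powr (- real CARD('n) / 2) * r u)"
          using r(1)[of u] by (simp add: abs_mult mult.commute)
      qed
    qed measurable
    have "(\<lambda>j. (\<integral>u. r u * gauss \<epsilon> (T \<epsilon> x - u) * indicat_real (S (k j)) u \<partial>lborel) / mj (k j) * D \<epsilon> x)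
       \<longlonglongrightarrow> (\<integral>u. r u * gauss \<epsilon> (T \<epsilon> x - u) \<partial>lborel) / 1 * D \<epsilon> x"
      using mkl by (intro tendsto_intros filterlim_compose[OF lim_S[OF gi] kl]) auto
    moreover have "(\<integral>u. rr j u * gauss \<epsilon> (T \<epsilon> x - u) \<partial>lborel) = (\<integral>u. r u * gauss \<epsilon> (T \<epsilon> x - u) * indicat_real (S (k j)) u \<partial>lborel) / mj (k j)" for j
      unfolding rr_def by (subst integral_divide_zero[symmetric]) (intro Bochner_Integration.integral_cong, auto)
    ultimately show ?thesis
      unfolding q_def r'_def heat_p_density[OF m r, folded \<mu>_def] by simp
  qed
  have cl: "(\<lambda>j. bias \<epsilon> + exp (- \<alpha> * \<epsilon>) * (hj j - bias \<epsilon>)) \<longlonglongrightarrow> bias \<epsilon> + exp (- \<alpha> * \<epsilon>) * (h' - bias \<epsilon>)"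
    by (intro tendsto_intros hjl)
  have "Kd \<nu> r' \<le> ennreal (bias \<epsilon> + exp (- \<alpha> * \<epsilon>) * (h' - bias \<epsilon>))"
    by (rule Kd_le_liminf[OF _ qm _ r'0 ql qb cl]) auto
  also have "\<dots> \<le> ennreal (bias \<epsilon> + exp (- \<alpha> * \<epsilon>) * (h - bias \<epsilon>))"
    using h'h by (intro ennreal_leI add_left_mono mult_left_mono) auto
  finally have "Kd \<nu> r' \<le> ennreal (bias \<epsilon> + exp (- \<alpha> * \<epsilon>) * (h - bias \<epsilon>))" .
  with r'm r'0 r'1 law show ?thesis unfolding \<mu>_def by (intro exI[of _ r']) (auto simp: less_imp_le)
qed

section \<open>The laws of the iterates and the final bound\<close>

lemma KL_density:
  assumes m[measurable]: "r \<in> borel_measurable borel" and r: "\<And>x. r x \<ge> 0" "(\<integral>\<^sup>+x. ennreal (r x) \<partial>lborel) = 1"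
  shows "KL \<nu> (density lborel (\<lambda>x. ennreal (r x))) = enn2ereal (Kd \<nu> r)"
proof -
  let ?N = "density lborel (\<lambda>x::real^'n. ennreal (r x))"
  have ac: "absolutely_continuous lborel ?N" by (rule absolutely_continuousI_density) measurable
  have "AE x in lborel. ennreal (r x) = RN_deriv lborel ?N x"
    by (rule sigma_finite_measure.RN_deriv_unique[OF sigma_finite_lborel]) auto
  then have ae: "AE x in lborel. enn2real (RN_deriv lborel ?N x) = r x"
    by eventually_elim (metis enn2real_ennreal r(1))
  have "KL_dens \<nu> (\<lambda>x. enn2real (RN_deriv lborel ?N x)) = KL_dens \<nu> r"
  proof -
    have "(\<integral>\<^sup>+x. ennreal (enn2real (RN_deriv lborel ?N x) * ln (enn2real (RN_deriv lborel ?N x) / \<nu> x)) \<partial>lborel) = (\<integral>\<^sup>+x. ennreal (r x * ln (r x / \<nu> x)) \<partial>lborel)"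
      by (rule nn_integral_cong_AE) (use ae in eventually_elim, simp)
    moreover have "(\<integral>\<^sup>+x. ennreal (- (enn2real (RN_deriv lborel ?N x) * ln (enn2real (RN_deriv lborel ?N x) / \<nu> x))) \<partial>lborel) = (\<integral>\<^sup>+x. ennreal (- (r x * ln (r x / \<nu> x))) \<partial>lborel)"
      by (rule nn_integral_cong_AE) (use ae in eventually_elim, simp)
    ultimately show ?thesis by (simp only: KL_dens_def)
  qed
  also have "\<dots> = enn2ereal (Kd \<nu> r)" by (rule KL_dens_eq) (use r prob in auto)
  finally show ?thesis using ac by (simp add: KL_def)
qed

text \<open>Existence of a density, its mass and the entropy bound are carried through the induction
  together, since \<open>one_step\<close> consumes all of them. Measured from the fixed point
  \<open>bias \<epsilon>\<close>, the contraction factors simply multiply.\<close>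

lemma PLA_law_density:
  assumes e: "\<epsilon> > 0" "8 * L * \<epsilon> \<le> 1" and m: "r \<in> borel_measurable borel"
    and r: "\<And>x. r x \<ge> 0" "(\<integral>\<^sup>+x. ennreal (r x) \<partial>lborel) = 1" and h: "h \<ge> 0" "Kd \<nu> r \<le> ennreal h"
  shows "\<exists>q. q \<in> borel_measurable borel \<and> (\<forall>x. q x \<ge> 0) \<and> (\<integral>\<^sup>+x. ennreal (q x) \<partial>lborel) = 1 \<and>
     PLA_law \<epsilon> f (density lborel (\<lambda>x. ennreal (r x))) k = density lborel (\<lambda>x. ennreal (q x)) \<and>
     Kd \<nu> q \<le> ennreal (bias \<epsilon> + exp (- \<alpha> * \<epsilon> * real k) * (h - bias \<epsilon>))"
proof (induction k)
  case 0
  then show ?case using m r h by (intro exI[of _ r]) auto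
next
  case (Suc k)
  then obtain q where q: "q \<in> borel_measurable borel" "\<And>x. q x \<ge> 0" "(\<integral>\<^sup>+x. ennreal (q x) \<partial>lborel) = 1"
    and law: "PLA_law \<epsilon> f (density lborel (\<lambda>x. ennreal (r x))) k = density lborel (\<lambda>x. ennreal (q x))"
    and K: "Kd \<nu> q \<le> ennreal (bias \<epsilon> + exp (- \<alpha> * \<epsilon> * real k) * (h - bias \<epsilon>))" by auto
  let ?E = "exp (- \<alpha> * \<epsilon> * real k)"
  have "?E \<le> 1" using e alpha by simp
  \<comment> \<open>\<open>one_step\<close> needs a nonnegative entropy bound; the current one is a
    convex combination of \<open>bias \<epsilon>\<close> and \<open>h\<close>.\<close>
  then have "0 \<le> (1 - ?E) * bias \<epsilon> + ?E * h" using bias_nonneg h by simp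
  also have "\<dots> = bias \<epsilon> + ?E * (h - bias \<epsilon>)" by (simp add: algebra_simps)
  finally have "0 \<le> bias \<epsilon> + ?E * (h - bias \<epsilon>)" .
  from one_step[OF e q this K] obtain q' where q': "q' \<in> borel_measurable borel" "\<forall>x. q' x \<ge> 0" "(\<integral>\<^sup>+x. ennreal (q' x) \<partial>lborel) = 1"
    and law': "distr (density lborel (\<lambda>x. ennreal (q x)) \<Otimes>\<^sub>M std_gauss) borel (\<lambda>(x, z). prox \<epsilon> f (x + sqrt (2 * \<epsilon>) *\<^sub>R z)) = density lborel (\<lambda>x. ennreal (q' x))"
    and K': "Kd \<nu> q' \<le> ennreal (bias \<epsilon> + exp (- \<alpha> * \<epsilon>) * (bias \<epsilon> + ?E * (h - bias \<epsilon>) - bias \<epsilon>))"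
    by auto
  have eqE: "exp (- \<alpha> * \<epsilon>) * (bias \<epsilon> + ?E * (h - bias \<epsilon>) - bias \<epsilon>) = exp (- \<alpha> * \<epsilon> * real (Suc k)) * (h - bias \<epsilon>)"
  proof -
    have "exp (- \<alpha> * \<epsilon>) * ?E = exp (- \<alpha> * \<epsilon> * real (Suc k))" by (simp add: exp_add[symmetric] algebra_simps)
    then show ?thesis by (simp only: add_diff_cancel_left' mult.assoc[symmetric])
  qed
  have "Kd \<nu> q' \<le> ennreal (bias \<epsilon> + exp (- \<alpha> * \<epsilon> * real (Suc k)) * (h - bias \<epsilon>))"
    using K' unfolding eqE .
  then show ?case using q' law law' by (intro exI[of _ q'] conjI) simp_all
qed

end

theorem theorem1:
  fixes f :: "real^'n \<Rightarrow> real" and L M \<alpha> \<epsilon> :: real and \<rho>0 :: "real^'n \<Rightarrow> real"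
  assumes prob: "(\<integral>\<^sup>+x. ennreal (exp (- f x)) \<partial>lborel) = 1"
    and smooth: "LM_smooth f L M"
    and alpha_pos: "\<alpha> > 0"
    and lsi: "LSI (\<lambda>x. exp (- f x)) \<alpha>"
    and eps_pos: "\<epsilon> > 0"
    and eps_L: "8 * L * \<epsilon> \<le> 1"
    and eps_M: "M * \<epsilon> \<le> 1"
    and eps_alpha: "32 * L\<^sup>2 * \<epsilon> \<le> 3 * \<alpha>"
    and init: "admissible_density \<rho>0"
  shows "\<forall>k::nat. KL (\<lambda>x. exp (- f x)) (PLA_law \<epsilon> f (density lborel \<rho>0) k)
           \<le> ereal (exp (- \<alpha> * \<epsilon> * real k)) * KL (\<lambda>x. exp (- f x)) (density lborel \<rho>0)
             + ereal (34 * \<epsilon>\<^sup>2 * real CARD('n) * (L ^ 3 + 9 * (real CARD('n))\<^sup>2 * M\<^sup>2) / \<alpha>)"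
proof
  fix k
  interpret lsi_target f L M \<alpha>
    by (intro lsi_target.intro LM.intro lsi_target_axioms.intro smooth prob alpha_pos lsi)
  let ?c = "34 * \<epsilon>\<^sup>2 * real CARD('n) * (L ^ 3 + 9 * (real CARD('n))\<^sup>2 * M\<^sup>2) / \<alpha>"
  let ?E = "exp (- \<alpha> * \<epsilon> * real k)"
  have r: "\<rho>0 \<in> borel_measurable borel" "\<And>x. \<rho>0 x \<ge> 0" "(\<integral>\<^sup>+x. ennreal (\<rho>0 x) \<partial>lborel) = 1"
    using init by (auto simp: admissible_density_def)
  have KL0: "KL \<nu> (density lborel \<rho>0) = enn2ereal (Kd \<nu> \<rho>0)" by (rule KL_density[OF r])
  \<comment> \<open>Comparison of constants: \<open>256/49 <= 34\<close>,
    \<open>8192/2401 <= 306 = 34 * 9\<close>, and \<open>n^2 <= n^3\<close> because the dimension is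
    at least 1.\<close>
  have bias_le: "bias \<epsilon> \<le> ?c"
  proof -
    let ?n = "real CARD('n)"
    have n: "?n \<ge> 1" by simp
    have "?n\<^sup>2 * 1 \<le> ?n\<^sup>2 * ?n" using n by (intro mult_left_mono) auto
    then have n23: "?n\<^sup>2 \<le> ?n ^ 3" by (simp add: power2_eq_square power3_eq_cube mult.assoc)
    have "8192/2401 * (?n * M)\<^sup>2 \<le> 306 * (?n\<^sup>2 * M\<^sup>2)"
      by (simp add: power_mult_distrib mult_right_mono)
    also have "\<dots> \<le> 306 * (?n ^ 3 * M\<^sup>2)"
      by (intro mult_left_mono mult_right_mono n23) auto
    finally have "8192/2401 * (?n * M)\<^sup>2 \<le> 306 * (?n ^ 3 * M\<^sup>2)" .
    moreover have "256/49 * ?n * L ^ 3 \<le> 34 * (?n * L ^ 3)"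
      using mult_nonneg_nonneg[of ?n "L ^ 3"] L_nonneg by simp
    moreover have "34 * ?n * (L ^ 3 + 9 * ?n\<^sup>2 * M\<^sup>2) = 34 * (?n * L ^ 3) + 306 * (?n ^ 3 * M\<^sup>2)"
      by (simp add: algebra_simps power2_eq_square power3_eq_cube)
    ultimately have "256/49 * ?n * L ^ 3 + 8192/2401 * (?n * M)\<^sup>2 \<le> 34 * ?n * (L ^ 3 + 9 * ?n\<^sup>2 * M\<^sup>2)" by linarith
    then have "\<epsilon>\<^sup>2 * (256/49 * ?n * L ^ 3 + 8192/2401 * (?n * M)\<^sup>2) \<le> \<epsilon>\<^sup>2 * (34 * ?n * (L ^ 3 + 9 * ?n\<^sup>2 * M\<^sup>2))"
      by (rule mult_left_mono) simp
    then show ?thesis unfolding bias_def Cst_def using alpha_pos by (simp add: divide_right_mono mult_ac)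
  qed
  show "KL \<nu> (PLA_law \<epsilon> f (density lborel \<rho>0) k) \<le> ereal ?E * KL \<nu> (density lborel \<rho>0) + ereal ?c"
  proof (cases "Kd \<nu> \<rho>0")
    \<comment> \<open>Infinite initial entropy: the factor \<open>?E\<close> is positive, so the
      right-hand side is infinite.\<close>
    case top
    then show ?thesis unfolding KL0 by (simp add: top_ereal_def)
  next
    case (real h)
    then have h: "h \<ge> 0" "Kd \<nu> \<rho>0 \<le> ennreal h" by auto
    obtain q where q: "q \<in> borel_measurable borel" "\<And>x. q x \<ge> 0" "(\<integral>\<^sup>+x. ennreal (q x) \<partial>lborel) = 1"
      and law: "PLA_law \<epsilon> f (density lborel (\<lambda>x. ennreal (\<rho>0 x))) k = density lborel (\<lambda>x. ennreal (q x))"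
      and K: "Kd \<nu> q \<le> ennreal (bias \<epsilon> + ?E * (h - bias \<epsilon>))"
      using PLA_law_density[OF eps_pos eps_L r h, of k] by auto
    have "bias \<epsilon> + ?E * (h - bias \<epsilon>) \<le> ?E * h + ?c"
    proof -
      have "0 \<le> ?E * bias \<epsilon>" by (intro mult_nonneg_nonneg bias_nonneg) simp
      then show ?thesis unfolding right_diff_distrib using bias_le by linarith
    qed
    then have "Kd \<nu> q \<le> ennreal (?E * h + ?c)" by (rule order_trans[OF K ennreal_leI])
    moreover have "0 \<le> ?E * h + ?c" using h bias_le bias_nonneg[of \<epsilon>] by (intro add_nonneg_nonneg) auto
    ultimately have "enn2ereal (Kd \<nu> q) \<le> ereal (?E * h + ?c)"
      by (metis enn2ereal_ennreal less_eq_ennreal.rep_eq)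
    then show ?thesis unfolding law KL_density[OF q] KL0 real(2) using real(1) by (simp add: enn2ereal_ennreal)
  qed
qed

end
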